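(* Let $n,m\in\mathbb{N}$, let $0\le\alpha<n$, and let $0<\alpha_i<n$ for $1\le i\le m$ satisfy $\alpha_1+\dots+\alpha_m=n-\alpha$. Let $A_1,\dots,A_m$ be invertible real $n\times n$ matrices such that $A_i-A_j$ is invertible for $i\ne j$, $1\le i,j\le m$. Let $T_\alpha$ be the integral operator $$T_\alpha f(x)=\int_{\mathbb{R}^n}\frac{1}{|x-A_1y|^{\alpha_1}\cdots|x-A_my|^{\alpha_m}}\,f(y)\,dy .$$ Let $p:\mathbb{R}^n\to[1,\infty)$ be a measurable function such that $1\le p_-\le p_+<\frac{n}{\alpha}$ and such that $p(A_ix)=p(x)$ for a.e. $x\in\mathbb{R}^n$, for every $1\le i\le m$. Let $q(\cdot)$ be defined by $\frac{1}{p(x)}-\frac{1}{q(x)}=\frac{\alpha}{n}$. If the Hardy--Littlewood maximal operator $\mathcal{M}$ is bounded on $L^{\left(\frac{n-\alpha p_-}{np_-}q(\cdot)\right)'}(\mathbb{R}^n)$, then there exists $c>0$ such that, for every $t>0$ and every $f\in L^{p(\cdot)}(\mathbb{R}^n)$, $$\left\|t\,\chi_{\{x:\,T_\alpha f(x)>t\}}\right\|_{q(\cdot)}\le c\,\|f\|_{p(\cdot)} .$$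
   Context: For a measurable function $p:\mathbb{R}^n\to[1,\infty)$, $p_-=\operatorname{ess\,inf}p$ and $p_+=\operatorname{ess\,sup}p$. The variable exponent space $L^{p(\cdot)}(\mathbb{R}^n)$ is the Banach space of measurable functions $f$ on $\mathbb{R}^n$ such that $\int (|f(x)|/\lambda)^{p(x)}dx<\infty$ for some $\lambda>0$, with norm $\|f\|_{p(\cdot)}=\inf\{\lambda>0:\int (|f(x)|/\lambda)^{p(x)}dx\le1\}$. For $\alpha=0$, $n/\alpha$ is read as $\infty$. $\chi_E$ denotes the characteristic function of a set $E$. For an exponent $r(\cdot)$ with values in $[1,\infty)$, $r(\cdot)'$ denotes the pointwise conjugate exponent, $\frac1{r(x)}+\frac1{r(x)'}=1$ (with $r(x)'=\infty$ where $r(x)=1$). Note that $\frac{n-\alpha p_-}{np_-}q(\cdot)\ge1$ a.e. For an exponent $s(\cdot)$ with values in $[1,\infty]$, the norm of $L^{s(\cdot)}(\mathbb{R}^n)$ is $\|f\|_{s(\cdot)}=\inf\{\lambda>0:\int_{\{s<\infty\}}(|f(x)|/\lambda)^{s(x)}dx+\|f/\lambda\|_{L^\infty(\{s=\infty\})}\le1\}$. The Hardy--Littlewood maximal operator is $\mathcal{M}f(x)=\sup_{B}\frac1{|B|}\int_B|f(y)|dy$, the supremum being taken over all balls $B$ containing $x$. "$\mathcal{M}$ is bounded on $X$" means there is a constant $C$ with $\|\mathcal{M}f\|_X\le C\|f\|_X$ for all $f\in X$. *)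

theory Defs
  imports "HOL-Analysis.Analysis" "HOL-Probability.Essential_Supremum"
begin

text \<open>Measure-theoretic notions on \<open>real ^ 'n\<close> refer to the measure \<^const>\<open>lebesgue\<close>.
  Modulars and norms act on functions with values in \<^typ>\<open>ennreal\<close>: a real function \<open>f\<close> is
  passed as \<open>\<lambda>x. ennreal \<bar>f x\<bar>\<close>, and maximal functions, which may be infinite, are passed
  as they are. A norm has the value \<open>\<infinity>\<close> exactly when no admissible \<open>\<lambda>\<close> exists.\<close>

definition ennreal_rpow :: "ennreal \<Rightarrow> real \<Rightarrow> ennreal" where
  "ennreal_rpow u a = (if u = \<infinity> then \<infinity> else ennreal (enn2real u powr a))"

definition vexp_modular :: "(real ^ 'n \<Rightarrow> ereal) \<Rightarrow> (real ^ 'n \<Rightarrow> ennreal) \<Rightarrow> ennreal" where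
  "vexp_modular s g =
     (\<integral>\<^sup>+x. (if s x = \<infinity> then 0 else ennreal_rpow (g x) (real_of_ereal (s x))) \<partial>lebesgue)
     + esssup lebesgue (\<lambda>x. if s x = \<infinity> then g x else 0)"

definition vexp_norm :: "(real ^ 'n \<Rightarrow> ereal) \<Rightarrow> (real ^ 'n \<Rightarrow> ennreal) \<Rightarrow> ennreal" where
  "vexp_norm s g =
     (INF l \<in> {l::real. 0 < l \<and> vexp_modular s (\<lambda>x. g x / ennreal l) \<le> 1}. ennreal l)"

definition vexp_space :: "(real ^ 'n \<Rightarrow> ereal) \<Rightarrow> (real ^ 'n \<Rightarrow> real) set" where
  "vexp_space s =
     {f \<in> borel_measurable lebesgue.
        \<exists>l::real>0. vexp_modular s (\<lambda>x. ennreal \<bar>f x\<bar> / ennreal l) < \<infinity>}"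

definition ess_inf :: "(real ^ 'n \<Rightarrow> real) \<Rightarrow> ereal" where
  "ess_inf p = Sup {z. AE x in lebesgue. z \<le> ereal (p x)}"

definition ess_sup :: "(real ^ 'n \<Rightarrow> real) \<Rightarrow> ereal" where
  "ess_sup p = esssup lebesgue (\<lambda>x. ereal (p x))"

definition conj_exponent :: "(real ^ 'n \<Rightarrow> real) \<Rightarrow> (real ^ 'n \<Rightarrow> ereal)" where
  "conj_exponent r = (\<lambda>x. if r x = 1 then \<infinity> else ereal (r x / (r x - 1)))"

definition HL_maximal :: "(real ^ 'n \<Rightarrow> real) \<Rightarrow> (real ^ 'n \<Rightarrow> ennreal)" where
  "HL_maximal f x =
     (SUP (z, r) \<in> {(z, r::real). 0 < r \<and> x \<in> ball z r}.
        (\<integral>\<^sup>+y\<in>ball z r. ennreal \<bar>f y\<bar> \<partial>lebesgue) / emeasure lebesgue (ball z r))"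

definition HL_maximal_bounded_on :: "(real ^ 'n \<Rightarrow> ereal) \<Rightarrow> bool" where
  "HL_maximal_bounded_on s \<longleftrightarrow>
     (\<exists>C::real. \<forall>f\<in>vexp_space s.
        vexp_norm s (HL_maximal f) \<le> ennreal C * vexp_norm s (\<lambda>x. ennreal \<bar>f x\<bar>))"

text \<open>Division by zero makes the kernel vanish, instead of being infinite, at the finitely many
  \<open>y\<close> with \<open>A i *v y = x\<close> for some \<open>i\<close> (the \<open>A i\<close> being invertible); this is a null set
  for each \<open>x\<close>.\<close>

definition T_kernel ::
  "nat \<Rightarrow> (nat \<Rightarrow> real) \<Rightarrow> (nat \<Rightarrow> real ^ 'n ^ 'n) \<Rightarrow> real ^ 'n \<Rightarrow> real ^ 'n \<Rightarrow> real" where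
  "T_kernel m a A x y = 1 / (\<Prod>i=1..m. norm (x - A i *v y) powr a i)"

text \<open>The integral of \<open>K(x,y) f(y)\<close> is the integral of its positive part minus that of its negative
  part, as an extended real. Thus divergence to \<open>\<infinity>\<close> is recorded as \<open>\<infinity>\<close>, whereas the Bochner
  integral would return 0. Where both parts diverge the value is \<open>\<infinity> - \<infinity> = \<infinity>\<close> in
  \<^typ>\<open>ereal\<close>, so that such points are never omitted from a superlevel set.\<close>

definition T_op ::
  "nat \<Rightarrow> (nat \<Rightarrow> real) \<Rightarrow> (nat \<Rightarrow> real ^ 'n ^ 'n) \<Rightarrow> (real ^ 'n \<Rightarrow> real) \<Rightarrow> real ^ 'n \<Rightarrow> ereal" where
  "T_op m a A f x =
     enn2ereal (\<integral>\<^sup>+y. ennreal (T_kernel m a A x y * f y) \<partial>lebesgue)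
     - enn2ereal (\<integral>\<^sup>+y. ennreal (- (T_kernel m a A x y * f y)) \<partial>lebesgue)"

end

theory Submission
  imports Defs
begin

text \<open>Let \<open>1 / q\<^sub>0 = 1 / p\<^sub>0 - \<alpha> / n\<close> with \<open>p\<^sub>0 = p\<^sub>-\<close>. If the modular of \<open>t \<chi>\<^sub>E\<close>, where \<open>E\<close> is a bounded part of the
  superlevel set, exceeds 1 after division by a large constant, then a dyadic multiple \<open>\<nu>\<close> of that
  constant makes it comparable to 1, and \<open>h = (t / \<nu>)\<^bsup>q - q\<^sub>0\<^esup> \<chi>\<^sub>E\<close> has bounded modular with respect to
  \<open>(q / q\<^sub>0)'\<close>. The Rubio de Francia algorithm, based on the boundedness of \<open>M\<close> there, majorises \<open>h\<close> by
  an \<open>A\<^sub>1\<close> weight \<open>w\<close> with bounded modular, so that the weighted weak type \<open>(p\<^sub>0, q\<^sub>0)\<close> inequality for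
  \<open>T\<^sub>\<alpha>\<close> bounds \<open>t\<^bsup>q\<^sub>0\<^esup> w(E)\<close> and hence \<open>\<nu>\<close>; its right-hand side is controlled by Young's inequality and
  \<open>p \<circ> A\<^sub>i = p\<close>.

  For the weak type inequality the kernel is dominated by
  \<open>\<Sum>\<^sub>i \<bar>x - A\<^sub>i y\<bar>\<^bsup>- \<alpha>\<^sub>i\<^esup> (\<bar>x\<bar> + \<bar>x - A\<^sub>i y\<bar>)\<^bsup>\<alpha> + \<alpha>\<^sub>i - n\<^esup>\<close>, uniformly in \<open>\<alpha> \<ge> 0\<close>. By the \<open>A\<^sub>1\<close> condition
  each term is at most a function of the \<open>w\<close>-measure of the ball of centre \<open>x\<close> and radius \<open>\<bar>x - A\<^sub>i y\<bar>\<close>,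
  and integration over the sublevel sets of that measure reduces the estimate to the Vitali covering
  lemma.\<close>

section \<open>Weights of class A1\<close>

text \<open>Extrapolation normally passes through the duality of variable exponent spaces. Here the
  function to be measured is a multiple of an indicator, so the dual function is explicit; the price
  is that the modular must be finite and comparable to 1, whence the bounded part of the superlevel
  set and the dyadic choice of \<nu>. The delicate case of the weighted estimate is \<alpha> = 0,
  where |x - A_i y|^(-n) is not locally integrable. Since \<alpha>_i < n, the kernel bound retains a
  positive power of |x - A_i y| / (|x| + |x - A_i y|), which restores convergence at small distances
  unless x is near the origin in the sense of the weight; such x fill a set of controlled measure.
  At large distances convergence comes from 1 / p_0 > \<alpha> / n. Measuring distances by
  w-measures of balls keeps the exponents of the unweighted case. The weight then enters the
  right-hand side at A_i y, not at y, which is where the invariance of p under A_i is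
  needed.\<close>

lemma AE_ball_exists:
  fixes x :: "real ^ 'n"
  assumes "AE y in lborel. P y" "0 < r"
  shows "\<exists>y\<in>ball x r. P y"
proof (rule ccontr)
  assume "\<not> ?thesis"
  with assms(1) have "AE y in lborel. y \<notin> ball x r"
    by (auto elim!: eventually_mono)
  hence "emeasure lborel (ball x r) = 0"
    by (subst (asm) AE_iff_measurable[of "ball x r"]) auto
  hence "unit_ball_vol (real CARD('n)) * r ^ CARD('n) \<le> 0"
    using assms(2) by (simp add: emeasure_ball ennreal_eq_0_iff)
  moreover have "0 < unit_ball_vol (real CARD('n)) * r ^ CARD('n)"
    using assms(2) by (intro mult_pos_pos) auto
  ultimately show False by linarith
qed

text \<open>Disjoint balls selected by the Vitali lemma carry at most the total mass of
  \<open>M\<close>, and their fivefold dilates cover. \<open>G\<close> may be non-measurable, so an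
  open superset is produced; Lindelof's theorem makes the cover countable, and finite unions
  increase to it with a bound independent of their number. It serves both for the weak type
  inequality and for changes of variables.\<close>

lemma Vitali_comparison:
  fixes \<mu> M :: "'a :: euclidean_space measure"
  assumes \<mu>: "sets \<mu> = sets borel" and M: "sets M = sets borel"
    and G: "\<And>x. x \<in> G \<Longrightarrow> \<exists>r>0. emeasure \<mu> (ball x (5 * r)) \<le> c * emeasure M (ball x r)"
  shows "\<exists>G'. open G' \<and> G \<subseteq> G' \<and> emeasure \<mu> G' \<le> c * emeasure M UNIV"
proof (cases "G = {}")
  case False
  obtain r where r: "\<And>x. x \<in> G \<Longrightarrow> 0 < r x"
      "\<And>x. x \<in> G \<Longrightarrow> emeasure \<mu> (ball x (5 * r x)) \<le> c * emeasure M (ball x (r x))"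
    using G by metis
  define F where "F = (\<lambda>x. ball x (r x)) ` G"
  obtain F' where F': "F' \<subseteq> F" "countable F'" "\<Union>F' = \<Union>F"
    using Lindelof[of F] by (auto simp: F_def)
  have "G \<subseteq> \<Union>F" using r by (force simp: F_def)
  with False F' have ne: "F' \<noteq> {}" by fastforce
  have "\<exists>p. \<forall>i. p i \<in> G \<and> from_nat_into F' i = ball (p i) (r (p i))"
  proof (intro choice allI)
    fix i
    have "from_nat_into F' i \<in> F" using from_nat_into[OF ne] F'(1) by blast
    thus "\<exists>y. y \<in> G \<and> from_nat_into F' i = ball y (r y)" by (auto simp: F_def)
  qed
  then obtain p where p: "\<And>i. p i \<in> G" "\<And>i. from_nat_into F' i = ball (p i) (r (p i))" by blast
  define U where "U k = (\<Union>i\<le>k. ball (p i) (r (p i)))" for k :: nat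
  have U_F: "(\<Union>k. U k) = \<Union>F"
  proof -
    have "\<Union>F' = (\<Union>i. from_nat_into F' i)" using ne F'(2) by (simp add: range_from_nat_into)
    also have "\<dots> = (\<Union>k. U k)" by (auto simp: U_def p(2))
    finally show ?thesis using F'(3) by simp
  qed
  have bound: "emeasure \<mu> (U k) \<le> c * emeasure M UNIV" for k
  proof -
    \<comment> \<open>The covering lemma needs bounded radii. Those of finitely many balls are
      bounded, crudely, by their sum.\<close>
    obtain C where C: "countable C" "C \<subseteq> {..k}"
      "pairwise (\<lambda>i j. disjnt (ball (p i) (r (p i))) (ball (p j) (r (p j)))) C"
      "U k \<subseteq> (\<Union>i\<in>C. ball (p i) (5 * r (p i)))"
    proof (rule Vitali_covering_lemma_balls[where S = "U k" and K = "{..k}" and a = p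
          and r = "\<lambda>i. r (p i)" and B = "\<Sum>i\<le>k. r (p i)"])
      fix i assume "i \<in> {..k}"
      thus "0 < r (p i) \<and> r (p i) \<le> (\<Sum>i\<le>k. r (p i))"
        using r(1) p(1) member_le_sum[of i "{..k}" "\<lambda>i. r (p i)"] by (simp add: less_imp_le)
    qed (auto simp: U_def)
    have finC: "finite C" using C(2) finite_subset by blast
    have "emeasure \<mu> (U k) \<le> emeasure \<mu> (\<Union>i\<in>C. ball (p i) (5 * r (p i)))"
      using C(4) finC \<mu> by (intro emeasure_mono) auto
    also have "\<dots> \<le> (\<Sum>i\<in>C. emeasure \<mu> (ball (p i) (5 * r (p i))))"
      by (rule emeasure_subadditive_finite[OF finC]) (auto simp: \<mu>)
    also have "\<dots> \<le> (\<Sum>i\<in>C. c * emeasure M (ball (p i) (r (p i))))"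
      by (intro sum_mono r(2) p(1))
    also have "\<dots> = c * (\<Sum>i\<in>C. emeasure M (ball (p i) (r (p i))))"
      by (simp add: sum_distrib_left)
    also have "(\<Sum>i\<in>C. emeasure M (ball (p i) (r (p i)))) = emeasure M (\<Union>i\<in>C. ball (p i) (r (p i)))"
      using C(3) finC M
      by (intro sum_emeasure) (auto simp: disjoint_family_on_def pairwise_def disjnt_def)
    also have "c * \<dots> \<le> c * emeasure M UNIV"
      using M finC by (intro mult_left_mono emeasure_mono) auto
    finally show ?thesis .
  qed
  have "range U \<subseteq> sets \<mu>" by (auto simp: U_def \<mu>)
  moreover have "incseq U" by (fastforce simp: U_def incseq_def)
  ultimately have "emeasure \<mu> (\<Union>F) = (SUP k. emeasure \<mu> (U k))"
    by (simp only: SUP_emeasure_incseq U_F)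
  also have "\<dots> \<le> c * emeasure M UNIV"
    by (rule SUP_least) (rule bound)
  finally have "emeasure \<mu> (\<Union>F) \<le> c * emeasure M UNIV" .
  moreover have "open (\<Union>F)" by (auto simp: F_def)
  ultimately show ?thesis using \<open>G \<subseteq> \<Union>F\<close> by blast
qed auto

text \<open>The exceptional null set in \<open>A1\<close> does not depend on the ball: balls of uncountably many radii are
  tested at a fixed point.\<close>

locale A1_weight =
  fixes w :: "real ^ 'n \<Rightarrow> real" and K :: real
  assumes w_borel [measurable]: "w \<in> borel_measurable borel"
    and w_nonneg: "\<And>y. 0 \<le> w y"
    and w_pos: "AE y in lborel. 0 < w y"
    and K_ge_1: "1 \<le> K"
    and A1: "AE y in lborel. \<forall>x r. y \<in> ball x r \<longrightarrow>
        emeasure (density lborel w) (ball x r) \<le> ennreal (K * w y) * emeasure lborel (ball x r)"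
begin

abbreviation W :: "(real ^ 'n) measure" where "W \<equiv> density lborel w"

abbreviation V :: "real ^ 'n \<Rightarrow> real \<Rightarrow> real" where "V x r \<equiv> measure W (ball x r)"

lemma w_indicator_borel [simp]: "(\<lambda>y. ennreal (w y) * indicator (ball x r) y) \<in> borel_measurable borel"
  by (intro borel_measurable_times_ennreal borel_measurable_indicator
      measurable_compose[OF w_borel measurable_ennreal]) auto

text \<open>Local integrability of \<open>w\<close> comes for free: a single point of the ball at
  which the A1 bound holds gives a finite bound, as \<open>w\<close> is real-valued.\<close>

lemma W_ball_finite: "emeasure W (ball x r) < \<infinity>"
proof (cases "0 < r")
  case True
  then obtain y where "y \<in> ball x r" "\<forall>x r. y \<in> ball x r \<longrightarrow>
      emeasure W (ball x r) \<le> ennreal (K * w y) * emeasure lborel (ball x r)"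
    using AE_ball_exists[OF A1] by blast
  hence "emeasure W (ball x r) \<le> ennreal (K * w y) * emeasure lborel (ball x r)"
    by blast
  also have "\<dots> < \<infinity>"
    using True by (simp add: emeasure_ball ennreal_mult_less_top)
  finally show ?thesis .
qed (simp add: ball_empty)

lemma W_ball: "emeasure W (ball x r) = ennreal (V x r)"
  using W_ball_finite[of x r] by (simp add: emeasure_eq_ennreal_measure)

lemma V_mono: "ball x r \<subseteq> ball y s \<Longrightarrow> V x r \<le> V y s"
proof -
  assume "ball x r \<subseteq> ball y s"
  hence "emeasure W (ball x r) \<le> emeasure W (ball y s)"
    by (intro emeasure_mono) auto
  thus ?thesis by (simp add: W_ball)
qed

lemma V_pos: assumes "0 < r" shows "0 < V x r"
proof -
  have "emeasure W (ball x r) \<noteq> 0"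
  proof
    assume "emeasure W (ball x r) = 0"
    hence "(\<integral>\<^sup>+y. ennreal (w y) * indicator (ball x r) y \<partial>lborel) = 0"
      by (simp add: emeasure_density)
    hence "AE y in lborel. ennreal (w y) * indicator (ball x r) y = 0"
      by (subst (asm) nn_integral_0_iff_AE) auto
    with w_pos have "AE y in lborel. 0 < w y \<and> ennreal (w y) * indicator (ball x r) y = 0"
      by eventually_elim auto
    from AE_ball_exists[OF this \<open>0 < r\<close>, of x] show False by auto
  qed
  thus ?thesis by (simp add: W_ball less_le)
qed

lemma A1_pointwise:
  "AE y in lborel. \<forall>x r. y \<in> ball x r \<longrightarrow> V x r \<le> K * w y * unit_ball_vol (CARD('n)) * r ^ CARD('n)"
  using A1
proof eventually_elim
  case (elim y)
  show ?case
  proof (intro allI impI)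
    fix x r assume y: "y \<in> ball x r"
    hence r: "0 < r" by (metis ball_eq_empty empty_iff not_le)
    have "ennreal (V x r) \<le> ennreal (K * w y) * emeasure lborel (ball x r)"
      using elim y by (simp add: W_ball)
    also have "\<dots> = ennreal (K * w y * unit_ball_vol (CARD('n)) * r ^ CARD('n))"
      using w_nonneg[of y] K_ge_1 r by (simp add: emeasure_ball ennreal_mult' mult_ac)
    finally show "V x r \<le> K * w y * unit_ball_vol (CARD('n)) * r ^ CARD('n)"
      using w_nonneg[of y] K_ge_1 r by (subst (asm) ennreal_le_iff) auto
  qed
qed

text \<open>Integrate the A1 bound for the large ball over the points y of the small one. Thus
  averages of \<open>w\<close> over concentric balls grow by at most the factor \<open>K\<close>
  with the radius, which yields doubling and a power law.\<close>

lemma V_growth: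
  assumes "0 < \<rho>" "\<rho> \<le> R"
  shows "V x R * \<rho> ^ CARD('n) \<le> K * R ^ CARD('n) * V x \<rho>"
proof -
  define v where "v = unit_ball_vol (real CARD('n))"
  have v: "0 < v" by (simp add: v_def)
  have "ennreal (V x R * (v * \<rho> ^ CARD('n))) = (\<integral>\<^sup>+y. ennreal (V x R) * indicator (ball x \<rho>) y \<partial>lborel)"
    using assms v by (simp add: nn_integral_cmult_indicator emeasure_ball v_def ennreal_mult')
  also have "\<dots> \<le> (\<integral>\<^sup>+y. ennreal (K * v * R ^ CARD('n)) * (ennreal (w y) * indicator (ball x \<rho>) y) \<partial>lborel)"
  proof (rule nn_integral_mono_AE, use A1_pointwise in eventually_elim)
    case (elim y)
    show ?case
    proof (cases "y \<in> ball x \<rho>")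
      case True
      hence "y \<in> ball x R" using assms by auto
      with elim have "V x R \<le> K * w y * v * R ^ CARD('n)" by (auto simp: v_def)
      thus ?thesis using True K_ge_1 w_nonneg[of y] v assms
        by (simp flip: ennreal_mult) (simp add: mult_ac)
    qed simp
  qed
  also have "\<dots> = ennreal (K * v * R ^ CARD('n)) * ennreal (V x \<rho>)"
    by (subst nn_integral_cmult) (simp_all add: emeasure_density flip: W_ball)
  also have "\<dots> = ennreal (K * v * R ^ CARD('n) * V x \<rho>)"
    using K_ge_1 v assms by (simp add: ennreal_mult)
  finally have "V x R * (v * \<rho> ^ CARD('n)) \<le> K * v * R ^ CARD('n) * V x \<rho>"
    using K_ge_1 v assms by (subst (asm) ennreal_le_iff) auto
  hence "v * (V x R * \<rho> ^ CARD('n)) \<le> v * (K * R ^ CARD('n) * V x \<rho>)"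
    by (simp add: mult_ac)
  thus ?thesis using v by simp
qed

lemma doubling_const_ge_1: "1 \<le> K * 5 ^ CARD('n)"
  using mult_mono[of 1 K 1 "5 ^ CARD('n)"] K_ge_1 by simp

lemma V_doubling:
  assumes "0 < r" "s \<le> 5 * r"
  shows "V x s \<le> (K * 5 ^ CARD('n)) * V x r"
proof -
  have "V x s \<le> V x (5 * r)" using assms by (intro V_mono) auto
  moreover have "V x (5 * r) * r ^ CARD('n) \<le> K * (5 * r) ^ CARD('n) * V x r"
    using assms by (intro V_growth) auto
  hence "V x (5 * r) \<le> (K * 5 ^ CARD('n)) * V x r"
    using assms by (simp add: power_mult_distrib mult_ac)
  ultimately show ?thesis by simp
qed


section \<open>Sublevel sets of the weighted measure of balls\<close>

lemma small_ball:
  assumes "0 < u"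
  shows "\<exists>r>0. V x r \<le> u"
proof -
  have "(\<lambda>i. measure W (ball x (1 / real (Suc i)))) \<longlonglongrightarrow> measure W (\<Inter>i. ball x (1 / real (Suc i)))"
  proof (rule Lim_measure_decseq)
    show "decseq (\<lambda>i. ball x (1 / real (Suc i)))"
      by (intro decseq_SucI) (auto intro!: subset_ball divide_left_mono)
  qed (auto simp: W_ball)
  moreover have "(\<Inter>i. ball x (1 / real (Suc i))) = {x}"
  proof (intro equalityI subsetI)
    fix y assume y: "y \<in> (\<Inter>i. ball x (1 / real (Suc i)))"
    have "dist x y \<le> 0"
    proof (rule ccontr)
      assume "\<not> dist x y \<le> 0"
      then obtain i where "inverse (real (Suc i)) < dist x y"
        using reals_Archimedean[of "dist x y"] by auto
      moreover have "dist x y < 1 / real (Suc i)" using y by (auto simp del: of_nat_Suc)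
      ultimately show False by (simp add: inverse_eq_divide)
    qed
    thus "y \<in> {x}" by simp
  qed auto
  moreover have "emeasure W {x} = 0"
    by (simp add: emeasure_density nn_integral_0_iff_AE AE_lborel_singleton)
  hence "measure W {x} = 0" by (simp add: measure_def)
  ultimately have "(\<lambda>i. V x (1 / real (Suc i))) \<longlonglongrightarrow> 0" by simp
  hence "eventually (\<lambda>i. V x (1 / real (Suc i)) < u) sequentially"
    using assms by (simp add: order_tendsto_iff)
  then obtain i where "V x (1 / real (Suc i)) < u" by (auto simp: eventually_sequentially)
  thus ?thesis by (intro exI[of _ "1 / real (Suc i)"]) auto
qed

text \<open>The sublevel set is a ball around x, but at its radius \<open>Sup S\<close> the value of
  \<open>V x\<close> need not be controlled by continuity; a radius above half the supremum is
  admissible and doubling pays for the rest. The cutoff \<open>k\<close> keeps \<open>S\<close>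
  bounded. If 0 is the only possible radius, any ball of small measure will do.\<close>

lemma sublevel_subset_ball:
  assumes "0 < u"
  shows "\<exists>r>0. {z. V x (dist x z) \<le> u \<and> dist x z \<le> k} \<subseteq> ball x r \<and> V x r \<le> (K * 5 ^ CARD('n)) * u"
proof -
  define S where "S = {s. 0 \<le> s \<and> s \<le> k \<and> V x s \<le> u}"
  show ?thesis
  proof (cases "\<exists>s\<in>S. 0 < s")
    case True
    have bdd: "bdd_above S" by (auto simp: S_def)
    then have *: "0 < Sup S" using True by (meson cSup_upper less_le_trans)
    obtain s where s: "s \<in> S" "Sup S / 2 < s"
      using less_cSupD[of S "Sup S / 2"] True * by (auto simp: field_simps)
    have "0 < s" using s * by simp
    have "{z. V x (dist x z) \<le> u \<and> dist x z \<le> k} \<subseteq> ball x (2 * s)"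
    proof safe
      fix z assume "V x (dist x z) \<le> u" "dist x z \<le> k"
      hence "dist x z \<le> Sup S" using bdd by (intro cSup_upper) (auto simp: S_def)
      thus "z \<in> ball x (2 * s)" using s by simp
    qed
    moreover have "V x (2 * s) \<le> (K * 5 ^ CARD('n)) * V x s" using \<open>0 < s\<close> by (intro V_doubling) auto
    moreover have "(K * 5 ^ CARD('n)) * V x s \<le> (K * 5 ^ CARD('n)) * u"
      using s doubling_const_ge_1 by (intro mult_left_mono) (auto simp: S_def)
    ultimately show ?thesis using \<open>0 < s\<close> by (intro exI[of _ "2 * s"]) auto
  next
    case False
    obtain r where r: "r > 0" "V x r \<le> u" using small_ball[OF assms] by blast
    have "{z. V x (dist x z) \<le> u \<and> dist x z \<le> k} \<subseteq> ball x r"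
    proof safe
      fix z assume "V x (dist x z) \<le> u" "dist x z \<le> k"
      hence "dist x z \<in> S" by (auto simp: S_def)
      with False have "dist x z = 0" by (metis not_less zero_le_dist order.antisym)
      thus "z \<in> ball x r" using r by simp
    qed
    moreover have "u \<le> (K * 5 ^ CARD('n)) * u"
      using mult_right_mono[OF doubling_const_ge_1, of u] assms by simp
    ultimately show ?thesis using r by (intro exI[of _ r]) auto
  qed
qed

lemma V_measurable [measurable]: "V x \<in> borel_measurable borel"
  by (intro borel_measurable_mono monoI V_mono) auto

lemma emeasure_sublevel_SUP:
  assumes "sets M = sets borel"
  shows "emeasure M {z. V x (dist x z) \<le> u} = (SUP k::nat. emeasure M {z. V x (dist x z) \<le> u \<and> dist x z \<le> real k})"
proof -
  have meas: "{z. V x (dist x z) \<le> u \<and> dist x z \<le> real k} \<in> sets M" for k :: nat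
    unfolding assms by measurable
  have "(SUP k::nat. emeasure M {z. V x (dist x z) \<le> u \<and> dist x z \<le> real k})
      = emeasure M (\<Union>k::nat. {z. V x (dist x z) \<le> u \<and> dist x z \<le> real k})"
    using meas by (intro SUP_emeasure_incseq) (auto simp: incseq_def)
  also have "(\<Union>k::nat. {z. V x (dist x z) \<le> u \<and> dist x z \<le> real k}) = {z. V x (dist x z) \<le> u}"
    by (auto intro: real_arch_simple)
  finally show ?thesis by simp
qed

lemma W_sublevel_le:
  assumes "0 < u"
  shows "emeasure W {z. V x (dist x z) \<le> u} \<le> ennreal ((K * 5 ^ CARD('n)) * u)"
proof (subst emeasure_sublevel_SUP, simp, rule SUP_least)
  fix k :: nat
  obtain r where r: "{z. V x (dist x z) \<le> u \<and> dist x z \<le> k} \<subseteq> ball x r" "V x r \<le> (K * 5 ^ CARD('n)) * u"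
    using sublevel_subset_ball[OF assms, of x k] by blast
  have "emeasure W {z. V x (dist x z) \<le> u \<and> dist x z \<le> k} \<le> emeasure W (ball x r)"
    using r by (intro emeasure_mono) auto
  also have "\<dots> \<le> ennreal ((K * 5 ^ CARD('n)) * u)"
    using r by (simp add: W_ball ennreal_leI)
  finally show "emeasure W {z. V x (dist x z) \<le> u \<and> dist x z \<le> real k} \<le> ennreal ((K * 5 ^ CARD('n)) * u)" .
qed

text \<open>A maximal function over sublevel sets of \<open>V x\<close> is thereby reduced to one
  over balls centred at x, at the cost of one doubling constant.\<close>

lemma large_sublevel_imp_ball:
  assumes "sets M = sets borel" "0 < u" "0 < lam"
    and "ennreal ((K * 5 ^ CARD('n)) * lam * u) < emeasure M {z. V x (dist x z) \<le> u}"
  shows "\<exists>r>0. ennreal (lam * V x r) < emeasure M (ball x r)"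
proof -
  from assms(4) obtain k :: nat where
    k: "ennreal ((K * 5 ^ CARD('n)) * lam * u) < emeasure M {z. V x (dist x z) \<le> u \<and> dist x z \<le> real k}"
    unfolding emeasure_sublevel_SUP[OF assms(1)] less_SUP_iff by auto
  obtain r where r: "0 < r" "{z. V x (dist x z) \<le> u \<and> dist x z \<le> k} \<subseteq> ball x r" "V x r \<le> (K * 5 ^ CARD('n)) * u"
    using sublevel_subset_ball[OF assms(2), of x k] by blast
  have "ennreal (lam * V x r) \<le> ennreal ((K * 5 ^ CARD('n)) * lam * u)"
    using mult_left_mono[OF r(3), of lam] assms(3) by (intro ennreal_leI) (simp add: mult_ac)
  also note k
  also have "emeasure M {z. V x (dist x z) \<le> u \<and> dist x z \<le> real k} \<le> emeasure M (ball x r)"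
    using r assms(1) by (intro emeasure_mono) auto
  finally show ?thesis using r(1) by blast
qed

text \<open>The weak type (1,1) bound for the centred maximal function of \<open>M\<close> relative
  to \<open>W\<close>; doubling absorbs the dilation by 5 in the covering argument.\<close>

lemma weak_type:
  assumes M: "sets M = sets borel" and lam: "0 < lam"
    and G: "\<And>x. x \<in> G \<Longrightarrow> \<exists>r>0. ennreal (lam * V x r) < emeasure M (ball x r)"
  shows "\<exists>G'. open G' \<and> G \<subseteq> G' \<and>
    emeasure W G' \<le> ennreal (K * 5 ^ CARD('n) / lam) * emeasure M UNIV"
proof (rule Vitali_comparison)
  fix x assume "x \<in> G"
  then obtain r where r: "r > 0" "ennreal (lam * V x r) < emeasure M (ball x r)" using G by blast
  have "emeasure W (ball x (5 * r)) \<le> ennreal ((K * 5 ^ CARD('n)) * V x r)"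
    unfolding W_ball using r by (intro ennreal_leI V_doubling) auto
  also have "\<dots> = ennreal (K * 5 ^ CARD('n) / lam) * ennreal (lam * V x r)"
    using lam K_ge_1 by (simp flip: ennreal_mult)
  also have "\<dots> \<le> ennreal (K * 5 ^ CARD('n) / lam) * emeasure M (ball x r)"
    using r by (intro mult_left_mono) auto
  finally show "\<exists>r>0. emeasure W (ball x (5 * r)) \<le> ennreal (K * 5 ^ CARD('n) / lam) * emeasure M (ball x r)"
    using r by blast
qed (use M in simp_all)

end

section \<open>Invertible matrices and the kernel\<close>

lemma invertible_matrix_vector_inverse:
  fixes A :: "real ^ 'n ^ 'n"
  assumes "invertible A"
  shows "A *v (matrix_inv A *v x) = x" "matrix_inv A *v (A *v x) = x"
proof -
  have *: "A ** matrix_inv A = mat 1" "matrix_inv A ** A = mat 1"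
    using someI_ex[OF assms[unfolded invertible_def]] by (auto simp: matrix_inv_def)
  show "A *v (matrix_inv A *v x) = x" "matrix_inv A *v (A *v x) = x"
    by (simp_all add: matrix_vector_mul_assoc *)
qed

lemma matrix_vector_mult_borel [measurable (raw)]:
  fixes A :: "real ^ 'n ^ 'm"
  assumes "f \<in> borel_measurable M"
  shows "(\<lambda>x. A *v f x) \<in> borel_measurable M"
  using assms by (rule borel_measurable_continuous_on[rotated])
    (intro linear_continuous_on matrix_vector_mul_bounded_linear)

lemma invertible_bounded_below:
  fixes A :: "real ^ 'n ^ 'n"
  assumes "invertible A"
  shows "\<exists>Q>0. \<forall>y. norm y \<le> Q * norm (A *v y)"
proof -
  obtain Q where "0 < Q" "\<And>v. norm (matrix_inv A *v v) \<le> norm v * Q"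
    using bounded_linear.pos_bounded[OF matrix_vector_mul_bounded_linear[of "matrix_inv A"]] by auto
  thus ?thesis
    by (metis invertible_matrix_vector_inverse(2)[OF assms] mult.commute)
qed

text \<open>The change of variables formula of the library requires a well-ordered index type, and the
  inequality suffices.\<close>

lemma emeasure_matrix_vimage_le:
  fixes A :: "real ^ 'n ^ 'n"
  assumes "invertible A"
  shows "\<exists>c>0. \<forall>S\<in>sets borel. emeasure lborel ((*v) A -` S) \<le> ennreal c * emeasure lborel S"
proof -
  obtain Q where Q: "0 < Q" "\<And>y. norm y \<le> Q * norm (A *v y)"
    using invertible_bounded_below[OF assms] by blast
  define N where "N = CARD('n)"
  define v where "v = unit_ball_vol (real N)"
  have v: "0 < v" by (simp add: v_def)
  define c where "c = (Q * 5) ^ N"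
  have c: "0 < c" using Q by (simp add: c_def)
  define \<mu> where "\<mu> = distr lborel borel ((*v) A)"
  have mA: "(*v) A \<in> borel_measurable borel"
    using matrix_vector_mult_borel[of "\<lambda>x. x" borel A] by simp
  have \<mu>: "emeasure \<mu> S = emeasure lborel ((*v) A -` S)" if "S \<in> sets borel" for S
    using that mA by (simp add: \<mu>_def emeasure_distr)
  have ball: "emeasure \<mu> (ball x (5 * r)) \<le> ennreal c * emeasure lborel (ball x r)" if "0 < r" for x r
  proof -
    define z where "z = matrix_inv A *v x"
    have "(*v) A -` ball x (5 * r) \<subseteq> ball z (Q * (5 * r))"
    proof
      fix y assume "y \<in> (*v) A -` ball x (5 * r)"
      hence "norm (A *v (z - y)) < 5 * r"
        by (simp add: z_def matrix_vector_mult_diff_distrib invertible_matrix_vector_inverse[OF assms] dist_norm)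
      hence "Q * norm (A *v (z - y)) < Q * (5 * r)" using Q(1) by simp
      with Q(2)[of "z - y"] show "y \<in> ball z (Q * (5 * r))" by (simp add: dist_norm)
    qed
    hence "emeasure \<mu> (ball x (5 * r)) \<le> emeasure lborel (ball z (Q * (5 * r)))"
      by (simp add: \<mu> emeasure_mono)
    also have "\<dots> = ennreal c * emeasure lborel (ball x r)"
      using that Q(1) by (simp add: emeasure_ball c_def N_def power_mult_distrib mult_ac flip: ennreal_mult)
    finally show ?thesis .
  qed
  \<comment> \<open>For open \<open>U\<close> the comparison measure is Lebesgue measure restricted
    to \<open>U\<close>: its total mass is that of \<open>U\<close>, and small balls inside
    \<open>U\<close> do not feel the restriction.\<close>
  have op: "emeasure \<mu> U \<le> ennreal c * emeasure lborel U" if "open U" for U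
  proof -
    have U: "U \<in> sets borel" using that by simp
    have "\<exists>G'. open G' \<and> U \<subseteq> G' \<and>
        emeasure \<mu> G' \<le> ennreal c * emeasure (density lborel (indicator U)) UNIV"
    proof (rule Vitali_comparison)
      fix x assume "x \<in> U"
      from openE[OF \<open>open U\<close> this] obtain r where r: "0 < r" "ball x r \<subseteq> U" .
      have "U \<inter> ball x r = ball x r" using r by blast
      hence *: "emeasure (density lborel (indicator U)) (ball x r) = emeasure lborel (ball x r)"
        using emeasure_restricted[of U lborel "ball x r"] U by simp
      show "\<exists>r>0. emeasure \<mu> (ball x (5 * r)) \<le> ennreal c * emeasure (density lborel (indicator U)) (ball x r)"
        using ball[OF r(1), of x] r(1) * by (intro exI[of _ r]) simp
    qed (simp_all add: \<mu>_def)
    then obtain G' where "open G'" "U \<subseteq> G'"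
      "emeasure \<mu> G' \<le> ennreal c * emeasure (density lborel (indicator U)) UNIV" by blast
    moreover have "emeasure \<mu> U \<le> emeasure \<mu> G'"
      using calculation by (intro emeasure_mono) (auto simp: \<mu>_def)
    ultimately show ?thesis using U by (simp add: emeasure_restricted)
  qed
  \<comment> \<open>Outer regularity passes from open to Borel sets; the excess e / c becomes e
    after multiplication by c.\<close>
  have "emeasure \<mu> S \<le> ennreal c * emeasure lborel S" if S: "S \<in> sets borel" for S
  proof (rule ennreal_le_epsilon)
    fix e :: real assume e: "0 < e"
    have "0 < e / c" using e c by simp
    then obtain U where U: "open U" "S \<subseteq> U" "emeasure lborel (U - S) < e / c"
      using outer_regular_lborel[OF S, of "e / c"] by blast
    have "emeasure \<mu> S \<le> emeasure \<mu> U" using U by (intro emeasure_mono) (auto simp: \<mu>_def)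
    also have "\<dots> \<le> ennreal c * emeasure lborel U" using op U by simp
    also have "emeasure lborel U \<le> emeasure lborel S + emeasure lborel (U - S)"
      using U S emeasure_subadditive[of S lborel "U - S"] by (simp add: Un_absorb1)
    also have "\<dots> \<le> emeasure lborel S + ennreal (e / c)"
      using U by (intro add_left_mono) (auto intro: less_imp_le)
    also have "ennreal c * (emeasure lborel S + ennreal (e / c)) = ennreal c * emeasure lborel S + ennreal e"
      using c e by (simp add: distrib_left flip: ennreal_mult)
    finally show "emeasure \<mu> S \<le> ennreal c * emeasure lborel S + ennreal e" by (simp add: mult_left_mono)
  qed
  thus ?thesis using c \<mu> by (intro exI[of _ c]) auto
qed

lemma nn_integral_matrix_image_le:
  fixes A :: "real ^ 'n ^ 'n"
  assumes "invertible A"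
  shows "\<exists>c>0. \<forall>g\<in>borel_measurable borel. (\<integral>\<^sup>+y. g (A *v y) \<partial>lborel) \<le> ennreal c * (\<integral>\<^sup>+z. g z \<partial>lborel)"
proof -
  obtain c where c: "0 < c" "\<And>S. S \<in> sets borel \<Longrightarrow> emeasure lborel ((*v) A -` S) \<le> ennreal c * emeasure lborel S"
    using emeasure_matrix_vimage_le[OF assms] by blast
  have mA: "(*v) A \<in> borel_measurable borel"
    using matrix_vector_mult_borel[of "\<lambda>x. x" borel A] by simp
  have le: "distr lborel borel ((*v) A) \<le> density lborel (\<lambda>_. ennreal c)"
    using c(2) mA by (subst le_measure) (auto simp: emeasure_distr emeasure_density nn_integral_cmult_indicator)
  have "(\<integral>\<^sup>+y. g (A *v y) \<partial>lborel) \<le> ennreal c * (\<integral>\<^sup>+z. g z \<partial>lborel)" if "g \<in> borel_measurable borel" for g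
    using nn_integral_mono_measure[OF _ le, of g] that mA
    by (simp add: nn_integral_distr nn_integral_density nn_integral_cmult)
  thus ?thesis using c by blast
qed

text \<open>Preimages of null sets under \<open>A\<close> are null. This moves almost everywhere
  facts on weights and exponents to the points \<open>A *v y\<close>.\<close>

lemma AE_matrix_image:
  fixes A :: "real ^ 'n ^ 'n"
  assumes "invertible A" and "AE z in lborel. P z"
  shows "AE y in lborel. P (A *v y)"
proof -
  obtain N where N: "N \<in> sets lborel" "emeasure lborel N = 0" "{z. \<not> P z} \<subseteq> N"
    using assms(2) by (auto elim!: AE_E)
  have [measurable]: "N \<in> sets borel" using N by simp
  obtain c where "\<forall>g\<in>borel_measurable borel. (\<integral>\<^sup>+y. g (A *v y) \<partial>lborel) \<le> ennreal c * (\<integral>\<^sup>+z. g z \<partial>lborel)"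
    using nn_integral_matrix_image_le[OF assms(1)] by blast
  from bspec[OF this, of "indicator N"]
  have "(\<integral>\<^sup>+y. indicator N (A *v y) \<partial>lborel) = 0"
    using N by simp
  hence "AE y in lborel. indicator N (A *v y) = (0::ennreal)"
    by (subst (asm) nn_integral_0_iff_AE) auto
  thus ?thesis
  proof eventually_elim
    case (elim y)
    thus "P (A *v y)" using N(3) by (auto simp: indicator_def split: if_splits)
  qed
qed

text \<open>If the factor \<open>i\<close> is the smallest one, then all others are comparable to
  \<open>\<bar>x\<bar> + \<bar>x - A\<^sub>i y\<bar>\<close>, because \<open>\<bar>y\<bar> \<lesssim> \<bar>(A\<^sub>i - A\<^sub>j) y\<bar> \<le> 2 \<bar>x - A\<^sub>j y\<bar>\<close>.\<close>

lemma T_kernel_le_sum: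
  fixes A :: "nat \<Rightarrow> real ^ 'n ^ 'n"
  assumes m: "1 \<le> m"
    and a: "\<And>i. i \<in> {1..m} \<Longrightarrow> 0 < a i"
    and s: "(\<Sum>i=1..m. a i) = s"
    and inv: "\<And>i j. i \<in> {1..m} \<Longrightarrow> j \<in> {1..m} \<Longrightarrow> i \<noteq> j \<Longrightarrow> invertible (A i - A j)"
  shows "\<exists>C>0. \<forall>x y. T_kernel m a A x y \<le>
    C * (\<Sum>i=1..m. norm (x - A i *v y) powr (- a i) * (norm x + norm (x - A i *v y)) powr (- (s - a i)))"
proof -
  have "\<forall>i. \<exists>L>0. \<forall>y. norm (A i *v y) \<le> norm y * L"
    using bounded_linear.pos_bounded[OF matrix_vector_mul_bounded_linear[of "A _"]] by simp
  then obtain L where L: "\<And>i. 0 < L i" "\<And>i y. norm (A i *v y) \<le> norm y * L i" by metis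
  have "\<forall>i j. \<exists>Q>0. i \<in> {1..m} \<longrightarrow> j \<in> {1..m} \<longrightarrow> i \<noteq> j \<longrightarrow> (\<forall>y. norm y \<le> Q * norm ((A i - A j) *v y))"
    using invertible_bounded_below[OF inv] zero_less_one by metis
  then obtain Q where Q: "\<And>i j. 0 < Q i j"
    "\<And>i j y. i \<in> {1..m} \<Longrightarrow> j \<in> {1..m} \<Longrightarrow> i \<noteq> j \<Longrightarrow> norm y \<le> Q i j * norm ((A i - A j) *v y)"
    by metis
  have nn: "0 \<le> 2 * Q i j * L j" for i j
    using Q(1)[of i j] L(1)[of j] by simp
  \<comment> \<open>One constant dominating \<open>2 + 2 * Q i j * L j\<close> for all pairs, since
    the index of the smallest factor varies with x and y.\<close>
  define M where "M = 2 + (\<Sum>i=1..m. \<Sum>j=1..m. 2 * Q i j * L j)"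
  have M: "2 + 2 * Q i j * L j \<le> M" if "i \<in> {1..m}" "j \<in> {1..m}" for i j
  proof -
    have "2 * Q i j * L j \<le> (\<Sum>j=1..m. 2 * Q i j * L j)"
      using that nn by (intro member_le_sum) auto
    also have "\<dots> \<le> (\<Sum>i=1..m. \<Sum>j=1..m. 2 * Q i j * L j)"
      using that nn
      by (intro member_le_sum[of i _ "\<lambda>i. \<Sum>j=1..m. 2 * Q i j * L j"]) (auto intro!: sum_nonneg)
    finally show ?thesis by (simp add: M_def)
  qed
  have M1: "1 \<le> M"
  proof -
    have "0 \<le> (\<Sum>i=1..m. \<Sum>j=1..m. 2 * Q i j * L j)"
      using nn by (intro sum_nonneg) auto
    thus ?thesis by (simp add: M_def)
  qed
  have s0: "0 \<le> s" unfolding s[symmetric] using a by (intro sum_nonneg less_imp_le) auto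
  have "T_kernel m a A x y \<le> M powr s * (\<Sum>i=1..m. norm (x - A i *v y) powr (- a i) *
      (norm x + norm (x - A i *v y)) powr (- (s - a i)))" for x y
  proof -
    define \<rho> where "\<rho> i = norm (x - A i *v y)" for i
    define g where "g i = \<rho> i powr (- a i) * (norm x + \<rho> i) powr (- (s - a i))" for i
    have g0: "0 \<le> g i" for i by (simp add: g_def)
    have K: "T_kernel m a A x y = 1 / (\<Prod>i=1..m. \<rho> i powr a i)" by (simp add: T_kernel_def \<rho>_def)
    have "T_kernel m a A x y \<le> M powr s * (\<Sum>i=1..m. g i)"
    proof (cases "\<forall>i\<in>{1..m}. 0 < \<rho> i")
      \<comment> \<open>Where a factor vanishes the kernel is 0 by the convention on
        division.\<close>
      case False
      then obtain i where "i \<in> {1..m}" "\<rho> i = 0" by (auto simp: \<rho>_def)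
      hence "(\<Prod>i=1..m. \<rho> i powr a i) = 0" by (intro prod_zero) (auto intro!: bexI[of _ i])
      hence "T_kernel m a A x y = 0" by (simp add: K)
      thus ?thesis using g0 by (simp add: sum_nonneg)
    next
      case True
      obtain i where i: "i \<in> {1..m}" "\<And>j. j \<in> {1..m} \<Longrightarrow> \<rho> i \<le> \<rho> j"
      proof -
        have fin: "finite (\<rho> ` {1..m})" "\<rho> ` {1..m} \<noteq> {}" using m by auto
        obtain i where "i \<in> {1..m}" "\<rho> i = Min (\<rho> ` {1..m})" using Min_in[OF fin] by auto
        thus ?thesis using that Min_le[OF fin(1)] by auto
      qed
      define T where "T = norm x + \<rho> i"
      have T: "0 < T" using True i(1) by (auto simp: T_def intro: add_nonneg_pos)
      have Tj: "T / M \<le> \<rho> j" if j: "j \<in> {1..m}" "j \<noteq> i" for j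
      proof -
        have "norm ((A i - A j) *v y) \<le> \<rho> i + \<rho> j"
          using norm_triangle_ineq4[of "x - A j *v y" "x - A i *v y"]
          by (simp add: \<rho>_def matrix_vector_mult_diff_rdistrib)
        also have "\<dots> \<le> 2 * \<rho> j" using i(2)[OF j(1)] by simp
        finally have "Q i j * norm ((A i - A j) *v y) \<le> Q i j * (2 * \<rho> j)"
          using Q(1) by (intro mult_left_mono) (auto intro: less_imp_le)
        with Q(2)[OF i(1) j(1) j(2)[symmetric], of y] have "norm y \<le> 2 * Q i j * \<rho> j" by simp
        hence "norm y * L j \<le> 2 * Q i j * \<rho> j * L j"
          using L(1)[of j] by (intro mult_right_mono) auto
        with L(2)[of j y] have Ay: "norm (A j *v y) \<le> 2 * Q i j * L j * \<rho> j" by (simp add: mult_ac)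
        have "norm x \<le> \<rho> j + norm (A j *v y)"
          using norm_triangle_ineq[of "x - A j *v y" "A j *v y"] by (simp add: \<rho>_def)
        with Ay i(2)[OF j(1)] have "T \<le> (2 + 2 * Q i j * L j) * \<rho> j"
          by (simp add: T_def algebra_simps)
        also have "\<dots> \<le> M * \<rho> j"
          using M[OF i(1) j(1)] by (intro mult_right_mono) (auto simp: \<rho>_def)
        finally show ?thesis using M1 by (simp add: field_simps)
      qed
      \<comment> \<open>The exponent s - a i is the sum of the exponents of the other factors, each
        of which is at least T / M.\<close>
      have "\<rho> i powr a i * (T / M) powr (s - a i) = \<rho> i powr a i * (\<Prod>j\<in>{1..m}-{i}. (T / M) powr a j)"
      proof -
        have "s - a i = (\<Sum>j\<in>{1..m}-{i}. a j)"
          using i(1) by (simp add: s[symmetric] sum_diff1)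
        thus ?thesis using T M1 by (simp add: powr_sum)
      qed
      also have "\<dots> \<le> \<rho> i powr a i * (\<Prod>j\<in>{1..m}-{i}. \<rho> j powr a j)"
        using Tj T M1 a by (intro mult_left_mono prod_mono conjI powr_mono2) (auto intro: less_imp_le)
      also have "\<dots> = (\<Prod>j=1..m. \<rho> j powr a j)"
        using i(1) by (intro prod.remove[symmetric]) auto
      finally have le: "\<rho> i powr a i * (T / M) powr (s - a i) \<le> (\<Prod>j=1..m. \<rho> j powr a j)" .
      have "\<rho> i \<noteq> 0" using True i(1) by fastforce
      hence "0 < \<rho> i powr a i * (T / M) powr (s - a i)" using T M1 by simp
      with le have "T_kernel m a A x y \<le> 1 / (\<rho> i powr a i * (T / M) powr (s - a i))"
        unfolding K by (intro divide_left_mono mult_pos_pos) auto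
      also have "\<dots> = M powr (s - a i) * g i"
        using T M1 by (simp add: g_def T_def[symmetric] powr_divide powr_minus divide_simps
            del: minus_diff_eq)
      also have "\<dots> \<le> M powr s * g i"
        using M1 a[OF i(1)] g0 by (intro mult_right_mono powr_mono) auto
      also have "\<dots> \<le> M powr s * (\<Sum>i=1..m. g i)"
        using i(1) g0 by (intro mult_left_mono member_le_sum) auto
      finally show ?thesis .
    qed
    thus ?thesis by (simp add: g_def \<rho>_def)
  qed
  thus ?thesis using M1 by (intro exI[of _ "M powr s"]) auto
qed

section \<open>The weighted weak type estimate\<close>

text \<open>Compare g with \<open>\<theta> * w powr (1 / p)\<close>: below it the first summand
  suffices, above it the second. Unlike the conjugate exponent form of Young's inequality this
  includes p = 1, and \<theta> remains free for optimisation.\<close>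

lemma Young_powr:
  fixes g w \<theta> p :: real
  assumes "0 \<le> g" "0 \<le> w" "0 < \<theta>" "1 \<le> p"
  shows "g * w powr (1 - 1 / p) \<le> \<theta> * w + \<theta> powr (1 - p) * g powr p"
proof (cases "w = 0 \<or> g = 0")
  case True
  thus ?thesis using assms by auto
next
  case False
  hence pos: "0 < w" "0 < g" using assms by auto
  show ?thesis
  proof (cases "g \<le> \<theta> * w powr (1 / p)")
    case True
    have "g * w powr (1 - 1 / p) \<le> \<theta> * w powr (1 / p) * w powr (1 - 1 / p)"
      using True by (intro mult_right_mono) auto
    also have "\<dots> = \<theta> * w" using pos by (simp flip: powr_add add: mult.assoc)
    finally show ?thesis by (simp add: add_increasing2)
  next
    case False
    hence "w powr (1 / p) \<le> g / \<theta>" using assms by (simp add: field_simps)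
    hence "(w powr (1 / p)) powr (p - 1) \<le> (g / \<theta>) powr (p - 1)"
      using assms by (intro powr_mono2) auto
    also have "(w powr (1 / p)) powr (p - 1) = w powr (1 - 1 / p)"
      using assms by (simp add: powr_powr diff_divide_distrib)
    finally have "g * w powr (1 - 1 / p) \<le> g * (g / \<theta>) powr (p - 1)"
      using pos by (intro mult_left_mono) auto
    also have "\<dots> = \<theta> powr (1 - p) * (g powr 1 * g powr (p - 1))"
    proof -
      have "\<theta> powr (1 - p) = inverse (\<theta> powr (p - 1))"
        using powr_minus[of \<theta> "p - 1"] by simp
      thus ?thesis using pos assms by (simp add: powr_divide field_simps)
    qed
    also have "\<dots> = \<theta> powr (1 - p) * g powr p"
      using pos by (subst powr_add[symmetric]) simp
    finally show ?thesis using assms by (simp add: add_increasing)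
  qed
qed

section \<open>Layer decomposition in the level variable\<close>

lemma min_powr_mono:
  fixes u v :: real
  assumes "0 < u" "u \<le> v" "0 < s" "0 \<le> \<delta>"
  shows "min 1 ((u / s) powr \<delta>) \<le> min 1 ((v / s) powr \<delta>)"
proof -
  have "(u / s) powr \<delta> \<le> (v / s) powr \<delta>"
    using assms by (intro powr_mono2 divide_right_mono) auto
  thus ?thesis by linarith
qed

text \<open>A density in the level u whose tail over [N, infinity) dominates a quarter of N^(\<beta>
  - 1) min(1, (N / s)^\<delta>), the radial factor of the kernel when N is the weighted measure of
  the ball.\<close>

definition layer :: "real \<Rightarrow> real \<Rightarrow> real \<Rightarrow> real \<Rightarrow> real" where
  "layer \<beta> \<delta> s u = u powr (\<beta> - 2) * min 1 ((u / s) powr \<delta>)"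

lemma layer_nonneg: "0 \<le> layer \<beta> \<delta> s u"
  by (simp add: layer_def)

lemma layer_measurable [measurable]: "layer \<beta> \<delta> s \<in> borel_measurable borel"
  unfolding layer_def[abs_def] by measurable

text \<open>The part of the tail over [N, 2N] is enough: there the minimum is at least its value at
  N, and the power loses at most 2^(\<beta> - 2), which is at least 1/4.\<close>

lemma layer_cake_le:
  assumes N: "0 < N" and s: "0 < s" and "0 \<le> \<beta>" "\<beta> \<le> 1" "0 \<le> \<delta>"
  shows "ennreal (N powr (\<beta> - 1) * min 1 ((N / s) powr \<delta>))
    \<le> 4 * (\<integral>\<^sup>+u. ennreal (layer \<beta> \<delta> s u) * indicator {N..} u \<partial>lborel)"
proof -
  define m where "m = min 1 ((N / s) powr \<delta>)"
  have m: "0 \<le> m" by (simp add: m_def)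
  have low: "(2 * N) powr (\<beta> - 2) * m \<le> layer \<beta> \<delta> s u" if "N \<le> u" "u \<le> 2 * N" for u
    unfolding layer_def m_def using that assms
    by (intro mult_mono powr_mono2' min_powr_mono) auto
  have "1 / 4 * (N powr (\<beta> - 1) * m) \<le> (2 * N) powr (\<beta> - 2) * m * N"
  proof -
    have "(2 * N) powr (\<beta> - 2) * N = 2 powr (\<beta> - 2) * (N powr (\<beta> - 2) * N powr 1)"
      using N by (simp add: powr_mult)
    also have "N powr (\<beta> - 2) * N powr 1 = N powr (\<beta> - 1)"
      by (subst powr_add[symmetric]) simp
    finally have *: "(2 * N) powr (\<beta> - 2) * m * N = 2 powr (\<beta> - 2) * (N powr (\<beta> - 1) * m)"
      by (simp add: mult_ac)
    have "2 powr (- 2) \<le> (2::real) powr (\<beta> - 2)" using assms by (intro powr_mono) auto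
    hence "1 / 4 \<le> (2::real) powr (\<beta> - 2)" by (simp add: powr_minus divide_simps)
    thus ?thesis unfolding * using m by (intro mult_right_mono) auto
  qed
  hence "N powr (\<beta> - 1) * m \<le> 4 * ((2 * N) powr (\<beta> - 2) * m * N)" by simp
  hence "ennreal (N powr (\<beta> - 1) * m) \<le> 4 * ennreal ((2 * N) powr (\<beta> - 2) * m * N)"
    using m N by (simp add: ennreal_leI flip: ennreal_numeral ennreal_mult)
  also have "ennreal ((2 * N) powr (\<beta> - 2) * m * N)
      = (\<integral>\<^sup>+u. ennreal ((2 * N) powr (\<beta> - 2) * m) * indicator {N..2*N} u \<partial>lborel)"
    using N m by (simp add: nn_integral_cmult_indicator ennreal_mult)
  also have "\<dots> \<le> (\<integral>\<^sup>+u. ennreal (layer \<beta> \<delta> s u) * indicator {N..} u \<partial>lborel)"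
    using low by (intro nn_integral_mono) (auto simp: indicator_def intro!: ennreal_leI)
  finally show ?thesis by (simp add: m_def mult_left_mono)
qed

lemma has_integral_mult_indicator:
  fixes f :: "real \<Rightarrow> real"
  assumes "(f has_integral I) S"
  shows "((\<lambda>x. f x * indicator S x) has_integral I) UNIV"
proof -
  have "(\<lambda>x. f x * indicator S x) = (\<lambda>x. if x \<in> S then f x else 0)" by (auto simp: fun_eq_iff)
  thus ?thesis using assms by (simp add: has_integral_restrict_UNIV)
qed

text \<open>Near 0 the minimum contributes (u / s)^\<delta>, so the integrand is of order u^(\<beta>
  + \<delta> - 1). For \<beta> = 0 convergence rests on \<delta> alone.\<close>

lemma layer_integral_0:
  assumes s: "0 < s" and "0 \<le> \<beta>" "0 \<le> \<delta>" "0 < \<beta> + \<delta>"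
  shows "(\<integral>\<^sup>+u. ennreal (layer \<beta> \<delta> s u * u) * indicator {0..s} u \<partial>lborel)
    \<le> ennreal (s powr \<beta> / (\<beta> + \<delta>))"
proof -
  have "((\<lambda>u. u powr (\<beta> + \<delta> - 1)) has_integral (s powr (\<beta> + \<delta> - 1 + 1) / (\<beta> + \<delta> - 1 + 1))) {0..s}"
    using assms by (intro has_integral_powr_from_0) auto
  hence "((\<lambda>u. s powr (- \<delta>) * u powr (\<beta> + \<delta> - 1)) has_integral s powr (- \<delta>) * (s powr (\<beta> + \<delta>) / (\<beta> + \<delta>))) {0..s}"
    by (intro has_integral_mult_right) simp
  hence I: "((\<lambda>u. s powr (- \<delta>) * u powr (\<beta> + \<delta> - 1) * indicator {0..s} u) has_integral
      s powr (- \<delta>) * (s powr (\<beta> + \<delta>) / (\<beta> + \<delta>))) UNIV"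
    by (rule has_integral_mult_indicator)
  have "(\<integral>\<^sup>+u. ennreal (layer \<beta> \<delta> s u * u) * indicator {0..s} u \<partial>lborel)
      \<le> (\<integral>\<^sup>+u. ennreal (s powr (- \<delta>) * u powr (\<beta> + \<delta> - 1) * indicator {0..s} u) \<partial>lborel)"
  proof (rule nn_integral_mono)
    fix u :: real
    show "ennreal (layer \<beta> \<delta> s u * u) * indicator {0..s} u
        \<le> ennreal (s powr (- \<delta>) * u powr (\<beta> + \<delta> - 1) * indicator {0..s} u)"
    proof (cases "0 < u \<and> u \<le> s")
      case True
      have "layer \<beta> \<delta> s u * u \<le> u powr (\<beta> - 2) * (u / s) powr \<delta> * u"
        unfolding layer_def using True by (intro mult_right_mono mult_left_mono) auto
      also have "\<dots> = s powr (- \<delta>) * (u powr (\<beta> - 2) * u powr \<delta> * u powr 1)"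
        using True s by (simp add: powr_divide powr_minus field_simps)
      also have "u powr (\<beta> - 2) * u powr \<delta> * u powr 1 = u powr (\<beta> + \<delta> - 1)"
        by (subst powr_add[symmetric])+ (simp add: algebra_simps)
      finally show ?thesis using True by (simp add: ennreal_leI)
    qed (auto simp: indicator_def layer_def)
  qed
  also have "\<dots> = ennreal (s powr (- \<delta>) * (s powr (\<beta> + \<delta>) / (\<beta> + \<delta>)))"
    by (rule nn_integral_has_integral_lborel[OF _ _ I]) auto
  also have "s powr (- \<delta>) * (s powr (\<beta> + \<delta>) / (\<beta> + \<delta>)) = s powr \<beta> / (\<beta> + \<delta>)"
    by (simp flip: powr_add)
  finally show ?thesis .
qed

text \<open>Bounding the minimum by 1 leaves the exponent -1 - e, integrable at infinity because 1 /
  p > \<beta>.\<close>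

lemma layer_integral_inf:
  assumes s: "0 < s" and e: "0 < e" and e_eq: "e = 1 / p - \<beta>"
  shows "(\<integral>\<^sup>+u. ennreal (layer \<beta> \<delta> s u * u powr (1 - 1 / p)) * indicator {s<..} u \<partial>lborel)
    \<le> ennreal (s powr (- e) / e)"
proof -
  have "((\<lambda>u. u powr (- 1 - e)) has_integral - (s powr (- 1 - e + 1)) / (- 1 - e + 1)) {s..}"
    using assms by (intro has_integral_powr_to_inf) auto
  hence "((\<lambda>u. u powr (- 1 - e)) has_integral (s powr (- e) / e)) {s..}" by simp
  hence I: "((\<lambda>u. u powr (- 1 - e) * indicator {s..} u) has_integral (s powr (- e) / e)) UNIV"
    by (rule has_integral_mult_indicator)
  have "(\<integral>\<^sup>+u. ennreal (layer \<beta> \<delta> s u * u powr (1 - 1 / p)) * indicator {s<..} u \<partial>lborel)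
      \<le> (\<integral>\<^sup>+u. ennreal (u powr (- 1 - e) * indicator {s..} u) \<partial>lborel)"
  proof (rule nn_integral_mono)
    fix u :: real
    show "ennreal (layer \<beta> \<delta> s u * u powr (1 - 1 / p)) * indicator {s<..} u
        \<le> ennreal (u powr (- 1 - e) * indicator {s..} u)"
    proof (cases "s < u")
      case True
      have "layer \<beta> \<delta> s u * u powr (1 - 1 / p) \<le> u powr (\<beta> - 2) * 1 * u powr (1 - 1 / p)"
        unfolding layer_def by (intro mult_right_mono mult_left_mono) auto
      also have "\<dots> = u powr (- 1 - e)" by (simp add: e_eq algebra_simps flip: powr_add)
      finally show ?thesis using True by (simp add: ennreal_leI)
    qed auto
  qed
  also have "\<dots> = ennreal (s powr (- e) / e)"
    by (rule nn_integral_has_integral_lborel[OF _ _ I]) auto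
  finally show ?thesis .
qed

lemma nn_integral_linear_combination:
  assumes [measurable]: "f \<in> borel_measurable M" "g \<in> borel_measurable M"
  shows "(\<integral>\<^sup>+x. a * f x + b * g x \<partial>M) = a * (\<integral>\<^sup>+x. f x \<partial>M) + b * (\<integral>\<^sup>+x. g x \<partial>M)"
  by (simp add: nn_integral_add nn_integral_cmult)

section \<open>Potentials relative to an A1 weight\<close>

context A1_weight
begin

text \<open>With \<rho> = |x - z|, R = |x| and \<gamma> = n - \<alpha> - a the kernel is
  \<rho>^(\<alpha> - n) (\<rho> / (R + \<rho>))^\<gamma>. The A1 bound at z trades \<rho>^(-n) for
  w(z) divided by the measure N of the ball of radius \<rho>; the growth law and s \<le> V x R trade
  the remaining ratio for a power of N / s.\<close>

lemma kernel_pointwise: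
  fixes \<alpha> a s :: real
  defines "n \<equiv> real CARD('n)"
  assumes \<alpha>: "0 \<le> \<alpha>" "\<alpha> < n" and a: "a \<le> n - \<alpha>" and s: "0 < s"
  shows "AE z in lborel. \<forall>x. s \<le> V x (norm x) \<longrightarrow> x \<noteq> z \<longrightarrow>
    norm (x - z) powr (- a) * (norm x + norm (x - z)) powr (- (n - \<alpha> - a))
    \<le> ((K * unit_ball_vol n * 2 ^ CARD('n)) powr (1 - \<alpha> / n) * K powr ((n - \<alpha> - a) / n)) *
      (V x (dist x z) powr (\<alpha> / n - 1) * min 1 ((V x (dist x z) / s) powr ((n - \<alpha> - a) / n)) * w z powr (1 - \<alpha> / n))"
  using A1_pointwise
proof eventually_elim
  case (elim z)
  show ?case
  proof (intro allI impI)
    fix x assume x: "s \<le> V x (norm x)" "x \<noteq> z"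
    define \<gamma> where "\<gamma> = n - \<alpha> - a"
    have n: "0 < n" by (simp add: n_def)
    have \<gamma>: "0 \<le> \<gamma>" using a by (simp add: \<gamma>_def)
    define \<rho> where "\<rho> = norm (x - z)"
    define R where "R = norm x"
    define N where "N = V x \<rho>"
    have dist: "dist x z = \<rho>" by (simp add: \<rho>_def dist_norm)
    have \<rho>: "0 < \<rho>" using x by (simp add: \<rho>_def)
    have N: "0 < N" unfolding N_def using \<rho> by (rule V_pos)
    have R: "0 < R"
    proof (rule ccontr)
      assume "\<not> 0 < R"
      hence "V x (norm x) = 0" by (simp add: R_def)
      thus False using x s by simp
    qed
    define c where "c = K * unit_ball_vol n * 2 ^ CARD('n)"
    have c: "0 \<le> c" using K_ge_1 n by (simp add: c_def)
    \<comment> \<open>The radius is doubled because z lies on the boundary of the open ball of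
      radius \<rho>, where the A1 bound says nothing.\<close>
    have "N \<le> V x (2 * \<rho>)" unfolding N_def using \<rho> by (intro V_mono subset_ball) auto
    also have "\<dots> \<le> K * w z * unit_ball_vol n * (2 * \<rho>) ^ CARD('n)"
    proof -
      have "z \<in> ball x (2 * \<rho>)" using \<rho> dist by simp
      thus ?thesis using elim unfolding n_def by blast
    qed
    also have "\<dots> = c * w z * \<rho> powr n"
      using \<rho> by (simp add: c_def n_def powr_realpow power_mult_distrib mult_ac)
    finally have "N * \<rho> powr (- n) \<le> c * w z"
      using \<rho> by (simp add: powr_minus field_simps)
    hence "(N * \<rho> powr (- n)) powr (1 - \<alpha> / n) \<le> (c * w z) powr (1 - \<alpha> / n)"
      using N \<alpha> n by (intro powr_mono2) auto
    also have "(N * \<rho> powr (- n)) powr (1 - \<alpha> / n) = N powr (1 - \<alpha> / n) * \<rho> powr (- (n - \<alpha>))"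
      using N n by (simp add: powr_mult powr_powr algebra_simps)
    also have "(c * w z) powr (1 - \<alpha> / n) = c powr (1 - \<alpha> / n) * w z powr (1 - \<alpha> / n)"
      using c w_nonneg by (simp add: powr_mult)
    finally have "N powr (\<alpha> / n - 1) * (N powr (1 - \<alpha> / n) * \<rho> powr (- (n - \<alpha>)))
        \<le> N powr (\<alpha> / n - 1) * (c powr (1 - \<alpha> / n) * w z powr (1 - \<alpha> / n))"
      by (intro mult_left_mono) auto
    moreover have "N powr (\<alpha> / n - 1) * N powr (1 - \<alpha> / n) = 1"
      using N by (simp flip: powr_add)
    ultimately have 1: "\<rho> powr (- (n - \<alpha>)) \<le> c powr (1 - \<alpha> / n) * (N powr (\<alpha> / n - 1) * w z powr (1 - \<alpha> / n))"
      by (simp add: mult.assoc[symmetric]) (simp add: mult_ac)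
    have "(\<rho> / (R + \<rho>)) powr \<gamma> \<le> 1"
      using \<rho> R \<gamma> by (intro powr_le1) auto
    moreover have K1: "1 \<le> K powr (\<gamma> / n)" using K_ge_1 \<gamma> n by (intro ge_one_powr_ge_zero) auto
    \<comment> \<open>For \<rho> < R the growth law compares the two radii. For \<rho> \<ge> R
      monotonicity gives s \<le> N, so the right-hand side is at least 1.\<close>
    moreover have "(\<rho> / (R + \<rho>)) powr \<gamma> \<le> K powr (\<gamma> / n) * (N / s) powr (\<gamma> / n)"
    proof (cases "\<rho> < R")
      case True
      have "V x R * \<rho> ^ CARD('n) \<le> K * R ^ CARD('n) * N"
        unfolding N_def using True \<rho> by (intro V_growth) auto
      moreover have "s * \<rho> ^ CARD('n) \<le> V x R * \<rho> ^ CARD('n)"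
        using x \<rho> by (intro mult_right_mono) (auto simp: R_def)
      ultimately have "s * \<rho> ^ CARD('n) \<le> K * R ^ CARD('n) * N" by linarith
      hence "(\<rho> / R) powr n \<le> K * (N / s)"
        using R s \<rho> by (simp add: n_def powr_realpow power_divide field_simps)
      hence "((\<rho> / R) powr n) powr (\<gamma> / n) \<le> (K * (N / s)) powr (\<gamma> / n)"
        using \<gamma> n by (intro powr_mono2) auto
      also have "((\<rho> / R) powr n) powr (\<gamma> / n) = (\<rho> / R) powr \<gamma>" using n by (simp add: powr_powr)
      also have "(K * (N / s)) powr (\<gamma> / n) = K powr (\<gamma> / n) * (N / s) powr (\<gamma> / n)"
        using K_ge_1 N s by (intro powr_mult) 
      finally have *: "(\<rho> / R) powr \<gamma> \<le> K powr (\<gamma> / n) * (N / s) powr (\<gamma> / n)" .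
      have "\<rho> / (R + \<rho>) \<le> \<rho> / R" using \<rho> R by (intro divide_left_mono) auto
      hence "(\<rho> / (R + \<rho>)) powr \<gamma> \<le> (\<rho> / R) powr \<gamma>"
        using \<rho> R \<gamma> by (intro powr_mono2) auto
      with * show ?thesis by linarith
    next
      case False
      hence "s \<le> N" using x(1) V_mono[of x R x \<rho>] by (simp add: N_def R_def subset_ball)
      hence "1 \<le> (N / s) powr (\<gamma> / n)" using s \<gamma> n by (intro ge_one_powr_ge_zero) auto
      with K1 have "1 \<le> K powr (\<gamma> / n) * (N / s) powr (\<gamma> / n)"
        using mult_mono[of 1 "K powr (\<gamma> / n)" 1 "(N / s) powr (\<gamma> / n)"] by simp
      moreover have "(\<rho> / (R + \<rho>)) powr \<gamma> \<le> 1"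
        using \<rho> R \<gamma> by (intro powr_le1) auto
      ultimately show ?thesis by linarith
    qed
    ultimately have 2: "(\<rho> / (R + \<rho>)) powr \<gamma> \<le> K powr (\<gamma> / n) * min 1 ((N / s) powr (\<gamma> / n))"
      by (simp add: min_mult_distrib_left)
    have "\<rho> powr (- a) * (R + \<rho>) powr (- \<gamma>) = \<rho> powr (- (n - \<alpha>)) * (\<rho> / (R + \<rho>)) powr \<gamma>"
    proof -
      have "\<rho> powr (- a) = \<rho> powr (- (n - \<alpha>)) * \<rho> powr \<gamma>" by (simp add: \<gamma>_def flip: powr_add)
      moreover have "(\<rho> / (R + \<rho>)) powr \<gamma> = \<rho> powr \<gamma> * (R + \<rho>) powr (- \<gamma>)"
        using \<rho> R by (simp add: powr_divide powr_minus_divide)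
      ultimately show ?thesis by (simp only: mult.assoc)
    qed
    also have "\<dots> \<le> (c powr (1 - \<alpha> / n) * (N powr (\<alpha> / n - 1) * w z powr (1 - \<alpha> / n))) *
        (K powr (\<gamma> / n) * min 1 ((N / s) powr (\<gamma> / n)))"
      using 1 2 by (intro mult_mono) auto
    finally have "\<rho> powr (- a) * (R + \<rho>) powr (- \<gamma>) \<le> (c powr (1 - \<alpha> / n) * K powr (\<gamma> / n)) *
        (N powr (\<alpha> / n - 1) * min 1 ((N / s) powr (\<gamma> / n)) * w z powr (1 - \<alpha> / n))"
      by (simp only: mult_ac)
    thus "norm (x - z) powr (- a) * (norm x + norm (x - z)) powr (- (n - \<alpha> - a))
      \<le> ((K * unit_ball_vol n * 2 ^ CARD('n)) powr (1 - \<alpha> / n) * K powr ((n - \<alpha> - a) / n)) *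
        (V x (dist x z) powr (\<alpha> / n - 1) * min 1 ((V x (dist x z) / s) powr ((n - \<alpha> - a) / n)) * w z powr (1 - \<alpha> / n))"
      unfolding dist c_def \<gamma>_def \<rho>_def R_def N_def .
  qed
qed

text \<open>The points excluded from the potential estimate. By doubling, a small ball around x
  reaching the origin forces a small ball of radius |x| around the origin, so they lie in one
  sublevel set centred at 0.\<close>

lemma emeasure_near_origin_le:
  assumes "0 < s"
  shows "\<exists>F\<in>sets borel. {x. V x (norm x) < s} \<subseteq> F \<and>
    emeasure W F \<le> ennreal ((K * 5 ^ CARD('n)) * ((K * 5 ^ CARD('n)) * s))"
proof (intro bexI conjI)
  define F where "F = {z :: real ^ 'n. V 0 (dist 0 z) \<le> (K * 5 ^ CARD('n)) * s}"
  have sublevel: "{z. V x (dist x z) \<le> u} \<in> sets borel" for x u by measurable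
  show "F \<in> sets borel" unfolding F_def by (rule sublevel)
  show "emeasure W F \<le> ennreal ((K * 5 ^ CARD('n)) * ((K * 5 ^ CARD('n)) * s))"
    unfolding F_def using assms K_ge_1 by (intro W_sublevel_le mult_pos_pos) auto
  show "{x. V x (norm x) < s} \<subseteq> F"
  proof safe
    fix x assume x: "V x (norm x) < s"
    show "x \<in> F"
    proof (cases "x = 0")
      case True
      thus ?thesis using assms K_ge_1 by (simp add: F_def)
    next
      case False
      have "ball 0 (norm x) \<subseteq> ball x (2 * norm x)"
      proof
        fix y :: "real ^ 'n" assume "y \<in> ball 0 (norm x)"
        thus "y \<in> ball x (2 * norm x)" using norm_triangle_ineq4[of x y] by (simp add: dist_norm)
      qed
      hence "V 0 (norm x) \<le> V x (2 * norm x)" by (rule V_mono)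
      also have "\<dots> \<le> (K * 5 ^ CARD('n)) * V x (norm x)" using False by (intro V_doubling) auto
      also have "\<dots> \<le> (K * 5 ^ CARD('n)) * s" using x K_ge_1 by (intro mult_left_mono) auto
      finally show ?thesis by (simp add: F_def)
    qed
  qed
qed

text \<open>Off the superlevel set of a maximal function (hypothesis on all \<open>u > 0\<close>) and away from the origin
  (\<open>s \<le> V x (norm x)\<close>) the potential is small once \<open>s\<close> is large and then \<open>\<eta>\<close> is small; \<open>h\<close> is
  integrated over \<open>{N \<le> u}\<close> by Young's inequality with the parameter \<open>min \<eta> (X / u) powr (1 / p)\<close>.\<close>

lemma potential_estimate:
  fixes \<alpha> a s p \<eta> X c :: real and B :: "real ^ 'n ^ 'n" and f :: "real ^ 'n \<Rightarrow> real"
  defines "n \<equiv> real CARD('n)"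
  defines "\<beta> \<equiv> \<alpha> / n" and "\<delta> \<equiv> (n - \<alpha> - a) / n"
  assumes \<alpha>: "0 \<le> \<alpha>" "\<alpha> < n" and a: "a \<le> n - \<alpha>" "a < n" and s: "0 < s"
    and p: "1 \<le> p" "0 < 1 / p - \<beta>" and \<eta>: "0 < \<eta>" and X: "0 < X"
    and B: "invertible B"
    and c: "0 < c" "\<And>g. g \<in> borel_measurable borel \<Longrightarrow> (\<integral>\<^sup>+y. g (B *v y) \<partial>lborel) \<le> ennreal c * (\<integral>\<^sup>+z. g z \<partial>lborel)"
    and f [measurable]: "f \<in> borel_measurable borel" and f_nonneg: "\<And>y. 0 \<le> f y"
    and fX: "(\<integral>\<^sup>+y. ennreal (f y powr p * w (B *v y) powr (p * (1 / p - \<beta>))) \<partial>lborel) \<le> ennreal X"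
    and xs: "s \<le> V x (norm x)"
    and x\<eta>: "\<And>u. 0 < u \<Longrightarrow> (\<integral>\<^sup>+y. ennreal (f y powr p * w (B *v y) powr (p * (1 / p - \<beta>))) *
                indicator {z. V x (dist x z) \<le> u} (B *v y) \<partial>lborel) \<le> ennreal (\<eta> * u)"
  shows "(\<integral>\<^sup>+y. ennreal (norm (x - B *v y) powr (- a) * (norm x + norm (x - B *v y)) powr (- (n - \<alpha> - a)) * f y) \<partial>lborel)
    \<le> ennreal (4 * ((K * unit_ball_vol n * 2 ^ CARD('n)) powr (1 - \<beta>) * K powr \<delta>) * (c * (K * 5 ^ CARD('n)) + 1) *
       (\<eta> powr (1 / p) * (s powr \<beta> / (\<beta> + \<delta>)) + X powr (1 / p) * (s powr (- (1 / p - \<beta>)) / (1 / p - \<beta>))))"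
proof -
  have n: "0 < n" by (simp add: n_def)
  have \<beta>: "0 \<le> \<beta>" "\<beta> < 1" using \<alpha> n by (simp_all add: \<beta>_def)
  have \<delta>: "0 \<le> \<delta>" "0 < \<beta> + \<delta>" using a n by (simp_all add: \<beta>_def \<delta>_def flip: add_divide_distrib)
  define e where "e = 1 / p - \<beta>"
  define D where "D = K * 5 ^ CARD('n)"
  have D: "1 \<le> D" using doubling_const_ge_1 by (simp add: D_def)
  define C where "C = (K * unit_ball_vol n * 2 ^ CARD('n)) powr (1 - \<beta>) * K powr \<delta>"
  have C: "0 \<le> C" by (simp add: C_def)
  have L0: "0 \<le> c * D + 1" using c(1) D by simp
  define N where "N y = V x (dist x (B *v y))" for y
  have N_meas [measurable]: "N \<in> borel_measurable borel" unfolding N_def[abs_def] by measurable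
  \<comment> \<open>What the kernel bound leaves once its dependence on the measure
    \<open>N y\<close> is split off.\<close>
  define h where "h y = f y * w (B *v y) powr (1 - \<beta>)" for y
  have h_meas [measurable]: "h \<in> borel_measurable borel" unfolding h_def[abs_def] by measurable
  have h0: "0 \<le> h y" for y using f_nonneg by (simp add: h_def)
  define \<Phi> where "\<Phi> y = f y powr p * w (B *v y) powr (p * e)" for y
  have \<Phi>_meas [measurable]: "\<Phi> \<in> borel_measurable borel" unfolding \<Phi>_def[abs_def] by measurable
  have \<Phi>0: "0 \<le> \<Phi> y" for y by (simp add: \<Phi>_def)

  have inner: "(\<integral>\<^sup>+y. ennreal (h y) * indicator {y. N y \<le> u} y \<partial>lborel)
      \<le> ennreal ((c * D + 1) * (u * (min \<eta> (X / u)) powr (1 / p)))" if u: "0 < u" for u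
  proof -
    define \<theta> where "\<theta> = (min \<eta> (X / u)) powr (1 / p)"
    have m: "0 < min \<eta> (X / u)" using \<eta> X u by simp
    hence \<theta>: "0 < \<theta>" unfolding \<theta>_def powr_gt_zero by linarith
    \<comment> \<open>The total mass bound X is the better one for large u, the maximal function
      bound \<open>\<eta> * u\<close> for small u; both are needed for the two ends of the level
      integral.\<close>
    have Y: "(\<integral>\<^sup>+y. ennreal (\<Phi> y) * indicator {y. N y \<le> u} y \<partial>lborel) \<le> ennreal (u * min \<eta> (X / u))"
    proof -
      have "(\<integral>\<^sup>+y. ennreal (\<Phi> y) * indicator {y. N y \<le> u} y \<partial>lborel) \<le> (\<integral>\<^sup>+y. ennreal (\<Phi> y) \<partial>lborel)"
        by (intro nn_integral_mono) (auto simp: indicator_def)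
      also have "\<dots> \<le> ennreal X" using fX by (simp add: \<Phi>_def e_def)
      finally have "(\<integral>\<^sup>+y. ennreal (\<Phi> y) * indicator {y. N y \<le> u} y \<partial>lborel) \<le> ennreal X" .
      moreover have "(\<integral>\<^sup>+y. ennreal (\<Phi> y) * indicator {y. N y \<le> u} y \<partial>lborel) \<le> ennreal (\<eta> * u)"
        using x\<eta>[OF u] by (simp add: \<Phi>_def e_def N_def indicator_def)
      ultimately show ?thesis using u by (auto simp: min_def field_simps)
    qed
    have [measurable]: "{z. V x (dist x z) \<le> u} \<in> sets borel" by measurable
    have "(\<integral>\<^sup>+y. ennreal (w (B *v y)) * indicator {y. N y \<le> u} y \<partial>lborel)
        \<le> ennreal c * (\<integral>\<^sup>+z. ennreal (w z) * indicator {z. V x (dist x z) \<le> u} z \<partial>lborel)"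
      using c(2)[of "\<lambda>z. ennreal (w z) * indicator {z. V x (dist x z) \<le> u} z"]
      by (simp add: N_def indicator_def)
    also have "(\<integral>\<^sup>+z. ennreal (w z) * indicator {z. V x (dist x z) \<le> u} z \<partial>lborel)
        = emeasure W {z. V x (dist x z) \<le> u}"
      by (simp add: emeasure_density)
    also have "ennreal c * \<dots> \<le> ennreal c * ennreal (D * u)"
      using W_sublevel_le[OF u] by (intro mult_left_mono) (simp_all add: D_def)
    also have "\<dots> = ennreal (c * (D * u))"
      using c(1) D u by (simp flip: ennreal_mult)
    finally have W_le: "(\<integral>\<^sup>+y. ennreal (w (B *v y)) * indicator {y. N y \<le> u} y \<partial>lborel) \<le> ennreal (c * (D * u))" .
    have "(\<integral>\<^sup>+y. ennreal (h y) * indicator {y. N y \<le> u} y \<partial>lborel)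
        \<le> (\<integral>\<^sup>+y. ennreal \<theta> * (ennreal (w (B *v y)) * indicator {y. N y \<le> u} y)
             + ennreal (\<theta> powr (1 - p)) * (ennreal (\<Phi> y) * indicator {y. N y \<le> u} y) \<partial>lborel)"
    proof (rule nn_integral_mono)
      fix y
      \<comment> \<open>The exponent 1 - \<beta> splits as e + (1 - 1 / p), so that Young's
        inequality produces exactly \<open>\<Phi>\<close> and the weight itself.\<close>
      have "h y = (f y * w (B *v y) powr e) * w (B *v y) powr (1 - 1 / p)"
        by (simp add: h_def e_def mult.assoc flip: powr_add)
      also have "\<dots> \<le> \<theta> * w (B *v y) + \<theta> powr (1 - p) * (f y * w (B *v y) powr e) powr p"
        using f_nonneg w_nonneg \<theta> p by (intro Young_powr) auto
      also have "(f y * w (B *v y) powr e) powr p = \<Phi> y"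
        using f_nonneg w_nonneg by (simp add: \<Phi>_def powr_mult powr_powr mult.commute)
      finally have "h y \<le> \<theta> * w (B *v y) + \<theta> powr (1 - p) * \<Phi> y" .
      hence "ennreal (h y) \<le> ennreal \<theta> * ennreal (w (B *v y)) + ennreal (\<theta> powr (1 - p)) * ennreal (\<Phi> y)"
        using \<theta> w_nonneg \<Phi>0 by (simp add: ennreal_leI flip: ennreal_mult ennreal_plus)
      thus "ennreal (h y) * indicator {y. N y \<le> u} y
          \<le> ennreal \<theta> * (ennreal (w (B *v y)) * indicator {y. N y \<le> u} y)
             + ennreal (\<theta> powr (1 - p)) * (ennreal (\<Phi> y) * indicator {y. N y \<le> u} y)"
        by (simp add: indicator_def)
    qed
    also have "\<dots> = ennreal \<theta> * (\<integral>\<^sup>+y. ennreal (w (B *v y)) * indicator {y. N y \<le> u} y \<partial>lborel)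
        + ennreal (\<theta> powr (1 - p)) * (\<integral>\<^sup>+y. ennreal (\<Phi> y) * indicator {y. N y \<le> u} y \<partial>lborel)"
      by (rule nn_integral_linear_combination) measurable
    also have "\<dots> \<le> ennreal \<theta> * ennreal (c * (D * u)) + ennreal (\<theta> powr (1 - p)) * ennreal (u * min \<eta> (X / u))"
      by (intro add_mono mult_left_mono Y W_le) auto
    also have "\<dots> = ennreal (\<theta> * (c * (D * u)) + \<theta> powr (1 - p) * (u * min \<eta> (X / u)))"
      using \<theta> c(1) D u m by (simp flip: ennreal_mult ennreal_plus)
    \<comment> \<open>This is the purpose of the choice of \<theta>: its p-th power is the minimum,
      so both summands have order u \<theta>.\<close>
    also have "\<theta> powr (1 - p) * (u * min \<eta> (X / u)) = u * \<theta>"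
    proof -
      have "\<theta> powr p = (min \<eta> (X / u)) powr 1" unfolding \<theta>_def powr_powr using p by simp
      also have "\<dots> = min \<eta> (X / u)" by (rule powr_one[OF less_imp_le[OF m]])
      finally have "\<theta> powr p = min \<eta> (X / u)" .
      hence "\<theta> powr (1 - p) * (u * min \<eta> (X / u)) = u * (\<theta> powr (1 - p) * \<theta> powr p)" by simp
      also have "\<dots> = u * \<theta>" using \<theta> by (simp flip: powr_add)
      finally show ?thesis .
    qed
    also have "\<theta> * (c * (D * u)) + u * \<theta> = (c * D + 1) * (u * \<theta>)" by (simp add: algebra_simps)
    finally show ?thesis by (simp add: \<theta>_def)
  qed

  have "AE y in lborel. norm (x - B *v y) powr (- a) * (norm x + norm (x - B *v y)) powr (- (n - \<alpha> - a))
      \<le> C * (N y powr (\<beta> - 1) * min 1 ((N y / s) powr \<delta>) * w (B *v y) powr (1 - \<beta>)) \<and> x \<noteq> B *v y"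
  proof -
    have "AE z in lborel. norm (x - z) powr (- a) * (norm x + norm (x - z)) powr (- (n - \<alpha> - a))
      \<le> C * (V x (dist x z) powr (\<beta> - 1) * min 1 ((V x (dist x z) / s) powr \<delta>) * w z powr (1 - \<beta>)) \<and> x \<noteq> z"
      using kernel_pointwise[OF \<alpha>[unfolded n_def] a(1)[unfolded n_def] s] AE_lborel_singleton[of x]
    proof eventually_elim
      case (elim z)
      thus ?case using xs unfolding C_def \<beta>_def \<delta>_def n_def by auto
    qed
    from AE_matrix_image[OF B this] show ?thesis by (simp add: N_def)
  qed
  hence "(\<integral>\<^sup>+y. ennreal (norm (x - B *v y) powr (- a) * (norm x + norm (x - B *v y)) powr (- (n - \<alpha> - a)) * f y) \<partial>lborel)
    \<le> (\<integral>\<^sup>+y. ennreal (4 * C) * (\<integral>\<^sup>+u. ennreal (layer \<beta> \<delta> s u) * indicator {N y..} u * ennreal (h y) \<partial>lborel) \<partial>lborel)"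
  proof (intro nn_integral_mono_AE, eventually_elim)
    case (elim y)
    have N: "0 < N y" unfolding N_def using elim by (intro V_pos) auto
    have "norm (x - B *v y) powr (- a) * (norm x + norm (x - B *v y)) powr (- (n - \<alpha> - a)) * f y
        \<le> C * (N y powr (\<beta> - 1) * min 1 ((N y / s) powr \<delta>) * w (B *v y) powr (1 - \<beta>)) * f y"
      using elim f_nonneg by (intro mult_right_mono) auto
    also have "\<dots> = C * ((N y powr (\<beta> - 1) * min 1 ((N y / s) powr \<delta>)) * h y)" by (simp add: h_def mult_ac)
    finally have "ennreal (norm (x - B *v y) powr (- a) * (norm x + norm (x - B *v y)) powr (- (n - \<alpha> - a)) * f y)
        \<le> ennreal C * (ennreal (N y powr (\<beta> - 1) * min 1 ((N y / s) powr \<delta>)) * ennreal (h y))"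
      using C h0 by (simp add: ennreal_leI flip: ennreal_mult)
    also have "\<dots> \<le> ennreal C * ((4 * (\<integral>\<^sup>+u. ennreal (layer \<beta> \<delta> s u) * indicator {N y..} u \<partial>lborel)) * ennreal (h y))"
      using N s \<beta> \<delta> by (intro mult_left_mono mult_right_mono layer_cake_le) auto
    also have "\<dots> = ennreal (4 * C) * ((\<integral>\<^sup>+u. ennreal (layer \<beta> \<delta> s u) * indicator {N y..} u \<partial>lborel) * ennreal (h y))"
      using C by (simp add: ennreal_mult mult_ac)
    also have "(\<integral>\<^sup>+u. ennreal (layer \<beta> \<delta> s u) * indicator {N y..} u \<partial>lborel) * ennreal (h y)
        = (\<integral>\<^sup>+u. ennreal (layer \<beta> \<delta> s u) * indicator {N y..} u * ennreal (h y) \<partial>lborel)"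
      by (subst nn_integral_multc) measurable
    finally show ?case .
  qed
  also have "\<dots> = ennreal (4 * C) * (\<integral>\<^sup>+y. \<integral>\<^sup>+u. ennreal (layer \<beta> \<delta> s u) * indicator {N y..} u * ennreal (h y) \<partial>lborel \<partial>lborel)"
  proof (rule nn_integral_cmult)
    have "(\<lambda>(y, u). ennreal (layer \<beta> \<delta> s u) * indicator {(y, u). N y \<le> u} (y, u) * ennreal (h y))
        \<in> borel_measurable (lborel \<Otimes>\<^sub>M lborel)" by measurable
    hence "(\<lambda>y. \<integral>\<^sup>+u. ennreal (layer \<beta> \<delta> s u) * indicator {(y, u). N y \<le> u} (y, u) * ennreal (h y) \<partial>lborel)
        \<in> borel_measurable lborel" by measurable
    thus "(\<lambda>y. \<integral>\<^sup>+u. ennreal (layer \<beta> \<delta> s u) * indicator {N y..} u * ennreal (h y) \<partial>lborel)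
        \<in> borel_measurable lborel" by (simp add: indicator_def)
  qed
  finally have 1: "(\<integral>\<^sup>+y. ennreal (norm (x - B *v y) powr (- a) * (norm x + norm (x - B *v y)) powr (- (n - \<alpha> - a)) * f y) \<partial>lborel)
    \<le> ennreal (4 * C) * (\<integral>\<^sup>+y. \<integral>\<^sup>+u. ennreal (layer \<beta> \<delta> s u) * indicator {N y..} u * ennreal (h y) \<partial>lborel \<partial>lborel)" .
  have "(\<integral>\<^sup>+y. \<integral>\<^sup>+u. ennreal (layer \<beta> \<delta> s u) * indicator {N y..} u * ennreal (h y) \<partial>lborel \<partial>lborel)
      = (\<integral>\<^sup>+u. \<integral>\<^sup>+y. ennreal (layer \<beta> \<delta> s u) * indicator {(u, y). N y \<le> u} (u, y) * ennreal (h y) \<partial>lborel \<partial>lborel)"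
    by (subst lborel_pair.Fubini'[symmetric]) (measurable, simp add: indicator_def)
  also have "\<dots> = (\<integral>\<^sup>+u. ennreal (layer \<beta> \<delta> s u) * (\<integral>\<^sup>+y. ennreal (h y) * indicator {y. N y \<le> u} y \<partial>lborel) \<partial>lborel)"
    by (subst nn_integral_cmult[symmetric]) (measurable, simp add: indicator_def mult_ac cong: if_cong)
  \<comment> \<open>The minimum is replaced by \<eta> for u \<le> s and by X / u for u > s.\<close>
  also have "\<dots> \<le> (\<integral>\<^sup>+u. ennreal (c * D + 1) * (ennreal (\<eta> powr (1 / p)) * (ennreal (layer \<beta> \<delta> s u * u) * indicator {0..s} u)
      + ennreal (X powr (1 / p)) * (ennreal (layer \<beta> \<delta> s u * u powr (1 - 1 / p)) * indicator {s<..} u)) \<partial>lborel)"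
  proof (rule nn_integral_mono_AE, use AE_lborel_singleton[of "0::real"] in eventually_elim)
    case (elim u)
    show ?case
    proof (cases "0 < u")
      \<comment> \<open>Now u < 0, as 0 was discarded, and the sublevel set is empty.\<close>
      case False
      hence "u < N y" for y unfolding N_def using elim by (intro less_le_trans[of u 0 "V x _"]) auto
      hence "indicator {y. N y \<le> u} y = (0 :: ennreal)" for y by (simp add: not_le)
      thus ?thesis by (simp only: mult_zero_right nn_integral_const mult_zero_left zero_le)
    next
      case True
      have "ennreal (layer \<beta> \<delta> s u) * (\<integral>\<^sup>+y. ennreal (h y) * indicator {y. N y \<le> u} y \<partial>lborel)
          \<le> ennreal (layer \<beta> \<delta> s u) * ennreal ((c * D + 1) * (u * (min \<eta> (X / u)) powr (1 / p)))"
        using inner[OF True] by (rule mult_left_mono) simp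
      also have "\<dots> = ennreal (c * D + 1) * ennreal (layer \<beta> \<delta> s u * (u * (min \<eta> (X / u)) powr (1 / p)))"
        unfolding ennreal_mult'[OF layer_nonneg, symmetric] ennreal_mult'[OF L0, symmetric] by (simp only: mult_ac)
      finally have A: "ennreal (layer \<beta> \<delta> s u) * (\<integral>\<^sup>+y. ennreal (h y) * indicator {y. N y \<le> u} y \<partial>lborel)
        \<le> ennreal (c * D + 1) * ennreal (layer \<beta> \<delta> s u * (u * (min \<eta> (X / u)) powr (1 / p)))" .
      have B: "ennreal (layer \<beta> \<delta> s u * (u * (min \<eta> (X / u)) powr (1 / p)))
          \<le> ennreal (\<eta> powr (1 / p)) * (ennreal (layer \<beta> \<delta> s u * u) * indicator {0..s} u)
            + ennreal (X powr (1 / p)) * (ennreal (layer \<beta> \<delta> s u * u powr (1 - 1 / p)) * indicator {s<..} u)"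
      proof (cases "u \<le> s")
        case True
        have "(min \<eta> (X / u)) powr (1 / p) \<le> \<eta> powr (1 / p)"
          using \<eta> X \<open>0 < u\<close> p by (intro powr_mono2) auto
        hence "layer \<beta> \<delta> s u * (u * (min \<eta> (X / u)) powr (1 / p)) \<le> layer \<beta> \<delta> s u * (u * \<eta> powr (1 / p))"
          using layer_nonneg \<open>0 < u\<close> by (intro mult_left_mono) auto
        also have "\<dots> = \<eta> powr (1 / p) * (layer \<beta> \<delta> s u * u)" by (simp only: mult_ac)
        finally have "ennreal (layer \<beta> \<delta> s u * (u * (min \<eta> (X / u)) powr (1 / p)))
            \<le> ennreal (\<eta> powr (1 / p)) * ennreal (layer \<beta> \<delta> s u * u)"
          unfolding ennreal_mult'[OF powr_ge_zero, symmetric] by (rule ennreal_leI)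
        thus ?thesis using True \<open>0 < u\<close> by simp
      next
        case False
        have "(min \<eta> (X / u)) powr (1 / p) \<le> (X / u) powr (1 / p)"
          using \<eta> X \<open>0 < u\<close> p by (intro powr_mono2) auto
        hence "layer \<beta> \<delta> s u * (u * (min \<eta> (X / u)) powr (1 / p)) \<le> layer \<beta> \<delta> s u * (u * (X / u) powr (1 / p))"
          using layer_nonneg \<open>0 < u\<close> by (intro mult_left_mono) auto
        also have "u * (X / u) powr (1 / p) = X powr (1 / p) * u powr (1 - 1 / p)"
          using X \<open>0 < u\<close> by (simp add: powr_divide powr_diff)
        also have "layer \<beta> \<delta> s u * (X powr (1 / p) * u powr (1 - 1 / p))
            = X powr (1 / p) * (layer \<beta> \<delta> s u * u powr (1 - 1 / p))" by (simp only: mult_ac)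
        finally have "ennreal (layer \<beta> \<delta> s u * (u * (min \<eta> (X / u)) powr (1 / p)))
            \<le> ennreal (X powr (1 / p)) * ennreal (layer \<beta> \<delta> s u * u powr (1 - 1 / p))"
          unfolding ennreal_mult'[OF powr_ge_zero, symmetric] by (rule ennreal_leI)
        thus ?thesis using False by simp
      qed
      show ?thesis by (rule order.trans[OF A mult_left_mono[OF B]]) simp
    qed
  qed
  also have "\<dots> = ennreal (c * D + 1) * (ennreal (\<eta> powr (1 / p)) * (\<integral>\<^sup>+u. ennreal (layer \<beta> \<delta> s u * u) * indicator {0..s} u \<partial>lborel)
      + ennreal (X powr (1 / p)) * (\<integral>\<^sup>+u. ennreal (layer \<beta> \<delta> s u * u powr (1 - 1 / p)) * indicator {s<..} u \<partial>lborel))"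
  proof -
    have 1: "(\<lambda>u. ennreal (layer \<beta> \<delta> s u * u) * indicator {0..s} u) \<in> borel_measurable lborel" by measurable
    have 2: "(\<lambda>u. ennreal (layer \<beta> \<delta> s u * u powr (1 - 1 / p)) * indicator {s<..} u) \<in> borel_measurable lborel"
      by measurable
    have 3: "(\<lambda>u. ennreal (\<eta> powr (1 / p)) * (ennreal (layer \<beta> \<delta> s u * u) * indicator {0..s} u)
        + ennreal (X powr (1 / p)) * (ennreal (layer \<beta> \<delta> s u * u powr (1 - 1 / p)) * indicator {s<..} u))
        \<in> borel_measurable lborel"
      by (rule borel_measurable_add[OF borel_measurable_times_ennreal[OF borel_measurable_const 1]
            borel_measurable_times_ennreal[OF borel_measurable_const 2]])
    show ?thesis
      unfolding nn_integral_cmult[OF 3] nn_integral_linear_combination[OF 1 2] ..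
  qed
  also have "\<dots> \<le> ennreal (c * D + 1) * (ennreal (\<eta> powr (1 / p)) * ennreal (s powr \<beta> / (\<beta> + \<delta>))
      + ennreal (X powr (1 / p)) * ennreal (s powr (- e) / e))"
    using s \<beta> \<delta> p by (intro mult_left_mono add_mono layer_integral_0 layer_integral_inf) (auto simp: e_def)
  also have "\<dots> = ennreal ((c * D + 1) * (\<eta> powr (1 / p) * (s powr \<beta> / (\<beta> + \<delta>)) + X powr (1 / p) * (s powr (- e) / e)))"
  proof -
    have "0 \<le> s powr \<beta> / (\<beta> + \<delta>)" "0 \<le> s powr (- e) / e" using \<delta> p by (simp_all add: e_def)
    hence "0 \<le> \<eta> powr (1 / p) * (s powr \<beta> / (\<beta> + \<delta>))" "0 \<le> X powr (1 / p) * (s powr (- e) / e)"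
      by (intro mult_nonneg_nonneg; simp)+
    thus ?thesis
      by (simp only: ennreal_mult'[OF powr_ge_zero] ennreal_plus ennreal_mult'[OF L0])
  qed
  finally have 2: "(\<integral>\<^sup>+y. \<integral>\<^sup>+u. ennreal (layer \<beta> \<delta> s u) * indicator {N y..} u * ennreal (h y) \<partial>lborel \<partial>lborel) \<le>
    ennreal ((c * D + 1) * (\<eta> powr (1 / p) * (s powr \<beta> / (\<beta> + \<delta>)) + X powr (1 / p) * (s powr (- e) / e)))" .
  have "ennreal (4 * C) * (\<integral>\<^sup>+y. \<integral>\<^sup>+u. ennreal (layer \<beta> \<delta> s u) * indicator {N y..} u * ennreal (h y) \<partial>lborel \<partial>lborel)
    \<le> ennreal (4 * C) * ennreal ((c * D + 1) * (\<eta> powr (1 / p) * (s powr \<beta> / (\<beta> + \<delta>)) + X powr (1 / p) * (s powr (- e) / e)))"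
    by (rule mult_left_mono[OF 2]) simp
  also have "\<dots> = ennreal (4 * C * (c * D + 1) * (\<eta> powr (1 / p) * (s powr \<beta> / (\<beta> + \<delta>)) + X powr (1 / p) * (s powr (- e) / e)))"
    using C by (subst ennreal_mult'[symmetric]) (simp_all add: mult.assoc)
  finally show ?thesis using 1 unfolding C_def D_def e_def by (rule order.trans[rotated])
qed

end

text \<open>The order of choice matters: s is taken large first, which makes the terms with s^(-e)
  small, and \<eta> is then taken small depending on s, to compensate the growth of
  s^\<beta>.\<close>

lemma ex_balanced_constants:
  fixes P Q :: "'i \<Rightarrow> real" and \<beta> e p X \<tau> :: real
  assumes "finite I" "0 < e" "0 < p" "0 < \<tau>"
  shows "\<exists>s>0. \<exists>\<eta>>0. \<forall>i\<in>I. P i * (\<eta> powr (1 / p) * (s powr \<beta> / Q i) + X powr (1 / p) * (s powr (- e) / e)) \<le> \<tau>"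
proof -
  have lim_s: "((\<lambda>s. P i * (X powr (1 / p) * (s powr (- e) / e))) \<longlongrightarrow> P i * (X powr (1 / p) * (0 / e))) at_top" for i
    using assms by (intro tendsto_intros tendsto_neg_powr filterlim_ident) auto
  have "\<forall>\<^sub>F s in at_top. P i * (X powr (1 / p) * (s powr (- e) / e)) < \<tau> / 2" for i
    by (rule order_tendstoD(2)[OF lim_s]) (use assms in simp)
  hence "\<forall>\<^sub>F s in at_top. 0 < s \<and> (\<forall>i\<in>I. P i * (X powr (1 / p) * (s powr (- e) / e)) < \<tau> / 2)"
    using assms by (auto intro!: eventually_conj eventually_gt_at_top eventually_ball_finite)
  then obtain s where s: "0 < s" "\<And>i. i \<in> I \<Longrightarrow> P i * (X powr (1 / p) * (s powr (- e) / e)) < \<tau> / 2"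
    by (auto simp: eventually_at_top_linorder)
  have lim: "((\<lambda>\<eta>::real. \<eta> powr (1 / p)) \<longlongrightarrow> 0 powr (1 / p)) (at_right 0)"
    using assms by (intro tendsto_powr2 tendsto_intros eventually_at_right_less[THEN eventually_mono]) auto
  have lim_\<eta>: "((\<lambda>\<eta>. P i * (\<eta> powr (1 / p) * (s powr \<beta> / Q i))) \<longlongrightarrow> P i * (0 powr (1 / p) * (s powr \<beta> / Q i))) (at_right 0)" for i
    by (intro tendsto_mult tendsto_const lim)
  have "\<forall>\<^sub>F \<eta> in at_right 0. P i * (\<eta> powr (1 / p) * (s powr \<beta> / Q i)) < \<tau> / 2" for i
    by (rule order_tendstoD(2)[OF lim_\<eta>]) (use assms in simp)
  hence "\<forall>\<^sub>F \<eta> in at_right 0. 0 < \<eta> \<and> (\<forall>i\<in>I. P i * (\<eta> powr (1 / p) * (s powr \<beta> / Q i)) < \<tau> / 2)"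
    using assms by (auto intro!: eventually_conj eventually_at_right_less eventually_ball_finite)
  then obtain \<eta> where \<eta>: "0 < \<eta>" "\<And>i. i \<in> I \<Longrightarrow> P i * (\<eta> powr (1 / p) * (s powr \<beta> / Q i)) < \<tau> / 2"
    using eventually_happens'[OF trivial_limit_at_right_real] by blast
  have "P i * (\<eta> powr (1 / p) * (s powr \<beta> / Q i) + X powr (1 / p) * (s powr (- e) / e)) \<le> \<tau>" if "i \<in> I" for i
    unfolding distrib_left using s(2)[OF that] \<eta>(2)[OF that] by linarith
  thus ?thesis using s(1) \<eta>(1) by blast
qed

section \<open>The weak type inequality for A1 weights\<close>

lemma T_kernel_nonneg: "0 \<le> T_kernel m a A x y"
  by (simp add: T_kernel_def prod_nonneg)

text \<open>The constant is chosen before \<open>w\<close> and \<open>f\<close> and depends on the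
  weight only through \<open>K\<close> and the bound \<open>X\<close>; extrapolation applies it to
  weights that vary with the function. Level 1 suffices, since other levels follow by scaling
  \<open>f\<close> and \<open>w\<close>.\<close>

lemma weighted_weak_type:
  fixes m :: nat and \<alpha> p K X :: real and a :: "nat \<Rightarrow> real" and A :: "nat \<Rightarrow> real ^ 'n ^ 'n" and n :: real
  defines "n \<equiv> real CARD('n)"
  assumes m: "1 \<le> m" and \<alpha>: "0 \<le> \<alpha>" "\<alpha> < n"
    and a: "\<And>i. i \<in> {1..m} \<Longrightarrow> 0 < a i \<and> a i < n" and sum_a: "(\<Sum>i=1..m. a i) = n - \<alpha>"
    and A: "\<And>i. i \<in> {1..m} \<Longrightarrow> invertible (A i)"
    and AA: "\<And>i j. i \<in> {1..m} \<Longrightarrow> j \<in> {1..m} \<Longrightarrow> i \<noteq> j \<Longrightarrow> invertible (A i - A j)"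
    and p: "1 \<le> p" "0 < 1 / p - \<alpha> / n" and X: "0 < X" and K: "1 \<le> K"
  shows "\<exists>C\<ge>0. \<forall>w f. A1_weight w K \<longrightarrow> f \<in> borel_measurable borel \<longrightarrow> (\<forall>y. 0 \<le> f y) \<longrightarrow>
    (\<forall>i\<in>{1..m}. (\<integral>\<^sup>+y. ennreal (f y powr p * w (A i *v y) powr (p * (1 / p - \<alpha> / n))) \<partial>lborel) \<le> ennreal X) \<longrightarrow>
    (\<exists>G\<in>sets borel. {x. 1 < (\<integral>\<^sup>+y. ennreal (T_kernel m a A x y * f y) \<partial>lborel)} \<subseteq> G \<and>
       emeasure (density lborel w) G \<le> ennreal C)"
proof -
  define \<beta> where "\<beta> = \<alpha> / n"
  define \<delta> where "\<delta> i = (n - \<alpha> - a i) / n" for i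
  define D where "D = K * 5 ^ CARD('n)"
  have D: "0 < D" using K by (simp add: D_def)
  have a_le: "a i \<le> n - \<alpha>" if "i \<in> {1..m}" for i
    unfolding sum_a[symmetric] using a that by (intro member_le_sum) (auto intro: less_imp_le)
  have "\<exists>C>0. \<forall>x y. T_kernel m a A x y \<le> C * (\<Sum>i=1..m. norm (x - A i *v y) powr (- a i) *
      (norm x + norm (x - A i *v y)) powr (- (n - \<alpha> - a i)))"
    by (rule T_kernel_le_sum[OF m conjunct1[OF a] sum_a AA])
  then obtain C0 where C0: "0 < C0" "\<And>x y. T_kernel m a A x y \<le> C0 * (\<Sum>i=1..m. norm (x - A i *v y) powr (- a i) *
      (norm x + norm (x - A i *v y)) powr (- (n - \<alpha> - a i)))"
    by blast
  have "\<exists>c. \<forall>i\<in>{1..m}. 0 < c i \<and> (\<forall>g\<in>borel_measurable borel. (\<integral>\<^sup>+y. g (A i *v y) \<partial>lborel) \<le> ennreal (c i) * (\<integral>\<^sup>+z. g z \<partial>lborel))"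
    using nn_integral_matrix_image_le[OF A] by (intro bchoice ballI) simp
  then obtain c where c: "\<And>i. i \<in> {1..m} \<Longrightarrow> 0 < c i"
    "\<And>i g. i \<in> {1..m} \<Longrightarrow> g \<in> borel_measurable borel \<Longrightarrow> (\<integral>\<^sup>+y. g (A i *v y) \<partial>lborel) \<le> ennreal (c i) * (\<integral>\<^sup>+z. g z \<partial>lborel)"
    by blast
  define P where "P i = 4 * ((K * unit_ball_vol n * 2 ^ CARD('n)) powr (1 - \<beta>) * K powr \<delta> i) * (c i * D + 1)" for i
  \<comment> \<open>The threshold 1 / (C0 m) lets the m potentials, added and multiplied by
    \<open>C0\<close>, stay at most 1 off the exceptional set.\<close>
  obtain s \<eta> where s: "0 < s" and \<eta>: "0 < \<eta>" and s\<eta>: "\<And>i. i \<in> {1..m} \<Longrightarrow>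
      P i * (\<eta> powr (1 / p) * (s powr \<beta> / (\<beta> + \<delta> i)) + X powr (1 / p) * (s powr (- (1 / p - \<beta>)) / (1 / p - \<beta>))) \<le> 1 / (C0 * m)"
    using ex_balanced_constants[of "{1..m}" "1 / p - \<beta>" p "1 / (C0 * m)" P \<beta> "\<lambda>i. \<beta> + \<delta> i" X] p C0 m
    by (auto simp: \<beta>_def)
  \<comment> \<open>The points near the origin give the first term, the m maximal superlevel sets
    the second.\<close>
  define C where "C = D * (D * s) + real m * (D / (\<eta> / D) * X)"
  have C: "0 \<le> C" using D s \<eta> X by (simp add: C_def)
  show ?thesis
  proof (intro exI[of _ C] conjI C allI impI)
    fix w :: "real ^ 'n \<Rightarrow> real" and f :: "real ^ 'n \<Rightarrow> real"
    assume "A1_weight w K" and f [measurable]: "f \<in> borel_measurable borel" and f_nonneg: "\<forall>y. 0 \<le> f y"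
      and fX: "\<forall>i\<in>{1..m}. (\<integral>\<^sup>+y. ennreal (f y powr p * w (A i *v y) powr (p * (1 / p - \<alpha> / n))) \<partial>lborel) \<le> ennreal X"
    interpret A1_weight w K by fact
    define \<Phi> where "\<Phi> i y = f y powr p * w (A i *v y) powr (p * (1 / p - \<beta>))" for i y
    have \<Phi>_meas [measurable]: "\<Phi> i \<in> borel_measurable borel" for i unfolding \<Phi>_def[abs_def] by measurable
    \<comment> \<open>Pushing forward by \<open>A i\<close> turns the mass of
      \<open>\<Phi> i\<close> over points y with A_i y in a set into the measure of that set, as the
      covering lemma requires.\<close>
    define M where "M i = distr (density lborel (\<Phi> i)) borel ((*v) (A i))" for i
    have A_meas [measurable]: "(*v) (A i) \<in> borel_measurable borel" for i
      using matrix_vector_mult_borel[of "\<lambda>x. x" borel "A i"] by simp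
    have M_sets: "sets (M i) = sets borel" for i by (simp add: M_def)
    have M: "emeasure (M i) S = (\<integral>\<^sup>+y. ennreal (\<Phi> i y) * indicator S (A i *v y) \<partial>lborel)" if [measurable]: "S \<in> sets borel" for i S
    proof -
      have "emeasure (M i) S = emeasure (density lborel (\<Phi> i)) ((*v) (A i) -` S)"
        unfolding M_def by (subst emeasure_distr) auto
      also have "\<dots> = (\<integral>\<^sup>+y. ennreal (\<Phi> i y) * indicator ((*v) (A i) -` S) y \<partial>lborel)"
        using measurable_sets[OF A_meas that, of i] by (subst emeasure_density) auto
      finally show ?thesis by (simp add: indicator_def)
    qed
    \<comment> \<open>The points at which the potential estimate lacks its maximal function
      hypothesis. Passing to balls costs \<open>D\<close>, hence the level \<open>\<eta> / D\<close>
      below.\<close>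
    define G where "G i = {x. \<exists>u>0. ennreal (\<eta> * u) < emeasure (M i) {z. V x (dist x z) \<le> u}}" for i
    have "\<exists>G'. open G' \<and> G i \<subseteq> G' \<and> emeasure W G' \<le> ennreal (D / (\<eta> / D)) * emeasure (M i) UNIV" for i
      unfolding D_def
    proof (rule weak_type[OF M_sets])
      show "0 < \<eta> / (K * 5 ^ CARD('n))" using \<eta> D by (simp add: D_def)
      fix x assume "x \<in> G i"
      then obtain u where u: "0 < u" "ennreal (\<eta> * u) < emeasure (M i) {z. V x (dist x z) \<le> u}" by (auto simp: G_def)
      show "\<exists>r>0. ennreal (\<eta> / (K * 5 ^ CARD('n)) * V x r) < emeasure (M i) (ball x r)"
        using u K \<eta> by (intro large_sublevel_imp_ball[OF M_sets u(1)]) (simp_all add: D_def)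
    qed
    then obtain G' where G': "\<And>i. open (G' i)" "\<And>i. G i \<subseteq> G' i"
      "\<And>i. emeasure W (G' i) \<le> ennreal (D / (\<eta> / D)) * emeasure (M i) UNIV" by metis
    have G'_le: "emeasure W (G' i) \<le> ennreal (D / (\<eta> / D) * X)" if i: "i \<in> {1..m}" for i
    proof -
      have "emeasure (M i) UNIV \<le> ennreal X" using fX i by (simp add: M \<Phi>_def \<beta>_def)
      hence "ennreal (D / (\<eta> / D)) * emeasure (M i) UNIV \<le> ennreal (D / (\<eta> / D)) * ennreal X"
        by (rule mult_left_mono) simp
      also have "\<dots> = ennreal (D / (\<eta> / D) * X)" using D \<eta> by (intro ennreal_mult'[symmetric]) simp
      finally show ?thesis using G'(3)[of i] by (rule order.trans[rotated])
    qed
    obtain F where F: "F \<in> sets borel" "{x. V x (norm x) < s} \<subseteq> F" "emeasure W F \<le> ennreal (D * (D * s))"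
      using emeasure_near_origin_le[OF s] unfolding D_def by blast
    have sub: "{x. 1 < (\<integral>\<^sup>+y. ennreal (T_kernel m a A x y * f y) \<partial>lborel)} \<subseteq> F \<union> (\<Union>i\<in>{1..m}. G' i)"
    proof safe
      fix x assume x: "1 < (\<integral>\<^sup>+y. ennreal (T_kernel m a A x y * f y) \<partial>lborel)" "x \<notin> (\<Union>i\<in>{1..m}. G' i)"
      show "x \<in> F"
      proof (rule ccontr)
        assume "x \<notin> F"
        hence xs: "s \<le> V x (norm x)" using F(2) by force
        define k where "k i y = norm (x - A i *v y) powr (- a i) * (norm x + norm (x - A i *v y)) powr (- (n - \<alpha> - a i))" for i y
        have k_meas [measurable]: "k i \<in> borel_measurable borel" for i unfolding k_def[abs_def] by measurable
        have k0: "0 \<le> k i y" for i y by (simp add: k_def)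
        have ki: "(\<integral>\<^sup>+y. ennreal (k i y * f y) \<partial>lborel) \<le> ennreal (1 / (C0 * m))" if i: "i \<in> {1..m}" for i
        proof -
          have "x \<notin> G i" using x(2) G'(2) i by blast
          have est: "(\<integral>\<^sup>+y. ennreal (\<Phi> i y) * indicator {z. V x (dist x z) \<le> u} (A i *v y) \<partial>lborel) \<le> ennreal (\<eta> * u)" if "0 < u" for u
          proof -
            have S: "{z. V x (dist x z) \<le> u} \<in> sets borel" by measurable
            have "emeasure (M i) {z. V x (dist x z) \<le> u} \<le> ennreal (\<eta> * u)"
            proof (rule ccontr)
              assume "\<not> ?thesis"
              hence "x \<in> G i" unfolding G_def not_le using that by blast
              with \<open>x \<notin> G i\<close> show False ..
            qed
            thus ?thesis by (simp only: M[OF S])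
          qed
          have "(\<integral>\<^sup>+y. ennreal (k i y * f y) \<partial>lborel) \<le> ennreal (P i * (\<eta> powr (1 / p) * (s powr \<beta> / (\<beta> + \<delta> i)) + X powr (1 / p) * (s powr (- (1 / p - \<beta>)) / (1 / p - \<beta>))))"
            unfolding k_def P_def D_def \<beta>_def \<delta>_def n_def
            by (rule potential_estimate[OF \<alpha>(1) \<alpha>(2)[unfolded n_def] a_le[OF i, unfolded n_def]
                conjunct2[OF a[OF i], unfolded n_def] s p(1) p(2)[unfolded n_def] \<eta> X A[OF i] c(1)[OF i] c(2)[OF i] f
                spec[OF f_nonneg] bspec[OF fX i, unfolded n_def] xs est[unfolded \<Phi>_def \<beta>_def n_def]])
          also have "\<dots> \<le> ennreal (1 / (C0 * m))" using s\<eta>[OF i] by (rule ennreal_leI)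
          finally show ?thesis .
        qed
        have "(\<integral>\<^sup>+y. ennreal (T_kernel m a A x y * f y) \<partial>lborel) \<le> (\<integral>\<^sup>+y. ennreal C0 * (\<Sum>i=1..m. ennreal (k i y * f y)) \<partial>lborel)"
        proof (rule nn_integral_mono)
          fix y
          have "T_kernel m a A x y * f y \<le> (C0 * (\<Sum>i=1..m. k i y)) * f y"
            using C0(2)[of x y] f_nonneg unfolding k_def by (intro mult_right_mono) auto
          also have "\<dots> = C0 * (\<Sum>i=1..m. k i y * f y)" by (simp only: sum_distrib_right mult.assoc)
          finally have "ennreal (T_kernel m a A x y * f y) \<le> ennreal (C0 * (\<Sum>i=1..m. k i y * f y))" by (rule ennreal_leI)
          also have "\<dots> = ennreal C0 * (\<Sum>i=1..m. ennreal (k i y * f y))"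
            using C0(1) k0 f_nonneg by (subst ennreal_mult') (auto simp: sum_ennreal)
          finally show "ennreal (T_kernel m a A x y * f y) \<le> ennreal C0 * (\<Sum>i=1..m. ennreal (k i y * f y))" .
        qed
        also have "\<dots> = ennreal C0 * (\<Sum>i=1..m. (\<integral>\<^sup>+y. ennreal (k i y * f y) \<partial>lborel))"
          by (subst nn_integral_cmult, measurable, subst nn_integral_sum) auto
        also have "\<dots> \<le> ennreal C0 * (\<Sum>i=1..m. ennreal (1 / (C0 * m)))"
          by (intro mult_left_mono sum_mono ki) auto
        also have "(\<Sum>i=1..m. ennreal (1 / (C0 * m))) = ennreal (m * (1 / (C0 * m)))"
          using C0(1) by (subst sum_ennreal) auto
        also have "ennreal C0 * ennreal (m * (1 / (C0 * m))) = ennreal 1"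
          using C0(1) m by (subst ennreal_mult'[symmetric]) auto
        finally show False using x(1) by simp
      qed
    qed
    have "emeasure W (F \<union> (\<Union>i\<in>{1..m}. G' i)) \<le> emeasure W F + emeasure W (\<Union>i\<in>{1..m}. G' i)"
      using F(1) G'(1) by (intro emeasure_subadditive) auto
    also have "\<dots> \<le> emeasure W F + (\<Sum>i\<in>{1..m}. emeasure W (G' i))"
      using G'(1) by (intro add_left_mono emeasure_subadditive_finite) auto
    also have "\<dots> \<le> ennreal (D * (D * s)) + (\<Sum>i\<in>{1..m}. ennreal (D / (\<eta> / D) * X))"
      by (intro add_mono F(3) sum_mono G'_le) auto
    also have "(\<Sum>i\<in>{1..m}. ennreal (D / (\<eta> / D) * X)) = ennreal (real m * (D / (\<eta> / D) * X))"
      using D \<eta> X by (subst sum_ennreal) auto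
    also have "ennreal (D * (D * s)) + \<dots> = ennreal C"
      unfolding C_def using D s \<eta> X by (intro ennreal_plus[symmetric]) auto
    finally show "\<exists>G\<in>sets borel. {x. 1 < (\<integral>\<^sup>+y. ennreal (T_kernel m a A x y * f y) \<partial>lborel)} \<subseteq> G \<and> emeasure W G \<le> ennreal C"
      using sub F(1) G'(1) by (intro bexI[of _ "F \<union> (\<Union>i\<in>{1..m}. G' i)"] conjI) (auto intro!: sets.finite_UN)
  qed
qed

section \<open>The Rubio de Francia algorithm\<close>

lemma ennreal_rpow_mono: "u \<le> v \<Longrightarrow> 0 \<le> a \<Longrightarrow> ennreal_rpow u a \<le> ennreal_rpow v a"
  by (cases "v = \<infinity>") (auto simp: ennreal_rpow_def top_unique less_top intro!: ennreal_leI powr_mono2 enn2real_mono)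

lemma ennreal_rpow_ennreal [simp]: "0 \<le> u \<Longrightarrow> ennreal_rpow (ennreal u) a = ennreal (u powr a)"
  by (simp add: ennreal_rpow_def)

lemma ennreal_rpow_cmult_le:
  assumes "0 \<le> c" "c \<le> 1" "1 \<le> a"
  shows "ennreal_rpow (ennreal c * u) a \<le> ennreal c * ennreal_rpow u a"
proof (cases "c = 0")
  case False
  hence c: "0 < c" using assms by simp
  show ?thesis
  proof (cases u)
    case (real r)
    have "c powr a \<le> c powr 1" using c assms by (intro powr_mono') auto
    hence "(c * r) powr a \<le> c * r powr a" using c real by (simp add: powr_mult mult_right_mono)
    thus ?thesis using real c by (simp add: ennreal_leI flip: ennreal_mult')
  next
    case top
    thus ?thesis using c by (simp add: ennreal_rpow_def ennreal_mult_top)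
  qed
qed (simp add: ennreal_rpow_def)

text \<open>Every term is at most the 1/a-th power of the right-hand side, hence so is any average;
  the weights 2^(-k-1) sum to 1.\<close>

lemma ennreal_rpow_suminf_le:
  assumes "1 \<le> a"
  shows "ennreal_rpow (\<Sum>k. ennreal ((1 / 2) ^ Suc k) * u k) a \<le> (\<Sum>k. ennreal_rpow (u k) a)"
proof (cases "(\<Sum>k. ennreal_rpow (u k) a)")
  case (real z)
  have u: "u k \<le> ennreal (z powr (1 / a))" for k
  proof -
    have "ennreal_rpow (u k) a \<le> (\<Sum>k. ennreal_rpow (u k) a)"
      using sum_le_suminf[of "\<lambda>k. ennreal_rpow (u k) a" "{k}"] by simp
    hence *: "ennreal_rpow (u k) a \<le> ennreal z" using real by simp
    show ?thesis
    proof (cases "u k")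
      case (real r)
      with * have "r powr a \<le> z" using \<open>0 \<le> z\<close> by simp
      hence "(r powr a) powr (1 / a) \<le> z powr (1 / a)" using assms by (intro powr_mono2) auto
      thus ?thesis using real assms by (simp add: powr_powr ennreal_leI)
    qed (use * in \<open>simp add: ennreal_rpow_def top_unique\<close>)
  qed
  have "(\<Sum>k. ennreal ((1 / 2) ^ Suc k) * u k) \<le> (\<Sum>k. ennreal ((1 / 2) ^ Suc k) * ennreal (z powr (1 / a)))"
    by (intro suminf_le mult_left_mono u) auto
  also have "\<dots> = (\<Sum>k. ennreal ((1 / 2) ^ Suc k)) * ennreal (z powr (1 / a))"
    by (rule ennreal_suminf_multc)
  also have "(\<Sum>k. ennreal ((1 / 2) ^ Suc k)) = ennreal 1"
    using power_half_series by (intro suminf_ennreal_eq) auto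
  finally have "ennreal_rpow (\<Sum>k. ennreal ((1 / 2) ^ Suc k) * u k) a \<le> ennreal_rpow (ennreal (z powr (1 / a))) a"
    using assms by (intro ennreal_rpow_mono) auto
  also have "\<dots> = ennreal z" using real assms by (simp add: powr_powr)
  finally show ?thesis using real by simp
qed simp

text \<open>The uncentred maximal function has open superlevel sets, being unions of balls, whatever
  f is.\<close>

lemma HL_maximal_borel: "HL_maximal f \<in> borel_measurable borel"
proof (rule borel_measurableI_greater)
  fix c
  define avg where "avg z r = (\<integral>\<^sup>+y\<in>ball z r. ennreal \<bar>f y\<bar> \<partial>lebesgue) / emeasure lebesgue (ball z r)" for z r
  have *: "c < HL_maximal f x \<longleftrightarrow> (\<exists>z r. 0 < r \<and> x \<in> ball z r \<and> c < avg z r)" for x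
    unfolding HL_maximal_def less_SUP_iff avg_def by auto
  have "{x \<in> space borel. c < HL_maximal f x} = {x. \<exists>z r. 0 < r \<and> x \<in> ball z r \<and> c < avg z r}"
    by (simp add: * del: mem_ball)
  also have "\<dots> = (\<Union>z. \<Union>r\<in>{r. 0 < r \<and> c < avg z r}. ball z r)" by blast
  also have "open \<dots>" by auto
  finally show "{x \<in> space borel. c < HL_maximal f x} \<in> sets borel" by simp
qed

section \<open>Modulars and norms for exponents in [1, infinity]\<close>

locale variable_exponent =
  fixes s :: "real ^ 'n \<Rightarrow> ereal"
  assumes s_meas [measurable]: "s \<in> borel_measurable lebesgue"
    and s_ge_1: "AE x in lebesgue. 1 \<le> s x"
begin

lemma exponent_ge_1: "AE x in lebesgue. s x \<noteq> \<infinity> \<longrightarrow> 1 \<le> real_of_ereal (s x)"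
  using s_ge_1
proof eventually_elim
  case (elim x)
  thus ?case by (cases "s x") auto
qed

lemma rpow_measurable [measurable]:
  assumes [measurable]: "g \<in> borel_measurable lebesgue"
  shows "(\<lambda>x. if s x = \<infinity> then 0 else ennreal_rpow (g x) (real_of_ereal (s x))) \<in> borel_measurable lebesgue"
  unfolding ennreal_rpow_def by measurable

lemma indicator_top_measurable [measurable]:
  assumes [measurable]: "g \<in> borel_measurable lebesgue"
  shows "(\<lambda>x. if s x = \<infinity> then g x else (0::ennreal)) \<in> borel_measurable lebesgue"
  by measurable

lemma modular_mono:
  assumes [measurable]: "g \<in> borel_measurable lebesgue" and "AE x in lebesgue. g x \<le> g' x"
  shows "vexp_modular s g \<le> vexp_modular s g'"
  unfolding vexp_modular_def
proof (rule add_mono)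
  show "(\<integral>\<^sup>+x. (if s x = \<infinity> then 0 else ennreal_rpow (g x) (real_of_ereal (s x))) \<partial>lebesgue)
    \<le> (\<integral>\<^sup>+x. (if s x = \<infinity> then 0 else ennreal_rpow (g' x) (real_of_ereal (s x))) \<partial>lebesgue)"
    using assms(2) exponent_ge_1
    by (intro nn_integral_mono_AE, eventually_elim) (auto intro!: ennreal_rpow_mono)
  show "esssup lebesgue (\<lambda>x. if s x = \<infinity> then g x else 0) \<le> esssup lebesgue (\<lambda>x. if s x = \<infinity> then g' x else 0)"
    using assms(2) by (intro esssup_AE_mono) (measurable, auto elim!: eventually_mono)
qed

lemma modular_cmult_le:
  assumes [measurable]: "g \<in> borel_measurable lebesgue" and c: "0 \<le> c" "c \<le> 1"
  shows "vexp_modular s (\<lambda>x. ennreal c * g x) \<le> ennreal c * vexp_modular s g"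
proof -
  have "(\<integral>\<^sup>+x. (if s x = \<infinity> then 0 else ennreal_rpow (ennreal c * g x) (real_of_ereal (s x))) \<partial>lebesgue)
    \<le> (\<integral>\<^sup>+x. ennreal c * (if s x = \<infinity> then 0 else ennreal_rpow (g x) (real_of_ereal (s x))) \<partial>lebesgue)"
    by (rule nn_integral_mono_AE, use exponent_ge_1 in eventually_elim) (use c in \<open>auto intro!: ennreal_rpow_cmult_le\<close>)
  also have "\<dots> = ennreal c * (\<integral>\<^sup>+x. (if s x = \<infinity> then 0 else ennreal_rpow (g x) (real_of_ereal (s x))) \<partial>lebesgue)"
    by (rule nn_integral_cmult) measurable
  finally have 1: "(\<integral>\<^sup>+x. (if s x = \<infinity> then 0 else ennreal_rpow (ennreal c * g x) (real_of_ereal (s x))) \<partial>lebesgue)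
    \<le> ennreal c * (\<integral>\<^sup>+x. (if s x = \<infinity> then 0 else ennreal_rpow (g x) (real_of_ereal (s x))) \<partial>lebesgue)" .
  have "AE x in lebesgue. (if s x = \<infinity> then ennreal c * g x else 0)
      \<le> ennreal c * esssup lebesgue (\<lambda>x. if s x = \<infinity> then g x else 0)"
    using esssup_AE[of "\<lambda>x. if s x = \<infinity> then g x else 0" lebesgue]
    by eventually_elim (auto intro!: mult_left_mono split: if_splits)
  hence 2: "esssup lebesgue (\<lambda>x. if s x = \<infinity> then ennreal c * g x else 0)
      \<le> ennreal c * esssup lebesgue (\<lambda>x. if s x = \<infinity> then g x else 0)"
    by (intro esssup_I) measurable
  show ?thesis unfolding vexp_modular_def distrib_left by (rule add_mono[OF 1 2])
qed

lemma norm_le_if_modular_le: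
  assumes "0 < b" "vexp_modular s (\<lambda>x. g x / ennreal b) \<le> 1"
  shows "vexp_norm s g \<le> ennreal b"
  unfolding vexp_norm_def using assms by (intro INF_lower) auto

text \<open>The factor 2 leaves room for an admissible scale strictly above the infimum, so that
  attainment of the infimum need not be discussed.\<close>

lemma modular_le_if_norm_le:
  assumes [measurable]: "g \<in> borel_measurable lebesgue" and X: "0 < X" "vexp_norm s g \<le> ennreal X"
  shows "vexp_modular s (\<lambda>x. g x / ennreal (2 * X)) \<le> 1"
proof -
  have "vexp_norm s g < ennreal (2 * X)"
    using X(2) by (rule order.strict_trans1) (use X(1) in \<open>simp add: ennreal_less_iff\<close>)
  then obtain l where l: "0 < l" "vexp_modular s (\<lambda>x. g x / ennreal l) \<le> 1" "ennreal l < ennreal (2 * X)"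
    unfolding vexp_norm_def INF_less_iff by auto
  have "vexp_modular s (\<lambda>x. g x / ennreal (2 * X)) \<le> vexp_modular s (\<lambda>x. g x / ennreal l)"
  proof (intro modular_mono AE_I2)
    fix x
    have "inverse (2 * X) \<le> inverse l"
      using l(1,3) by (intro le_imp_inverse_le) (simp_all add: ennreal_less_iff)
    hence "inverse (ennreal (2 * X)) \<le> inverse (ennreal l)"
      unfolding inverse_ennreal[OF l(1)] inverse_ennreal[OF mult_pos_pos[OF zero_less_numeral X(1)]]
      by (rule ennreal_leI)
    thus "g x / ennreal (2 * X) \<le> g x / ennreal l" unfolding divide_ennreal_def by (rule mult_left_mono) simp
  qed measurable
  with l show ?thesis by simp
qed

lemma modular_finite_imp_finite:
  assumes [measurable]: "g \<in> borel_measurable lebesgue" and fin: "vexp_modular s g < \<infinity>"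
  shows "AE x in lebesgue. g x < \<infinity>"
proof -
  have "(\<integral>\<^sup>+x. (if s x = \<infinity> then 0 else ennreal_rpow (g x) (real_of_ereal (s x))) \<partial>lebesgue) \<noteq> \<infinity>"
    and E: "esssup lebesgue (\<lambda>x. if s x = \<infinity> then g x else 0) < \<infinity>"
    using fin unfolding vexp_modular_def by (auto simp: less_top)
  hence "AE x in lebesgue. (if s x = \<infinity> then 0 else ennreal_rpow (g x) (real_of_ereal (s x))) \<noteq> \<infinity>"
    by (intro nn_integral_PInf_AE) measurable
  thus ?thesis using esssup_AE[of "\<lambda>x. if s x = \<infinity> then g x else 0" lebesgue]
  proof eventually_elim
    case (elim x)
    show ?case
    proof (cases "s x = \<infinity>")
      case True
      thus ?thesis using elim(2) E by (auto intro: order.strict_trans1)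
    next
      case False
      thus ?thesis using elim(1) by (auto simp: ennreal_rpow_def less_top split: if_splits)
    qed
  qed
qed

end

section \<open>Iterated maximal functions and the weight they generate\<close>

lemma nn_integral_ball_le_HL_maximal:
  fixes f :: "real ^ 'n \<Rightarrow> real"
  assumes "y \<in> ball x r" and f: "\<And>z. 0 \<le> f z"
  shows "(\<integral>\<^sup>+z. ennreal (f z) * indicator (ball x r) z \<partial>lborel) \<le> HL_maximal f y * emeasure lborel (ball x r)"
proof -
  have r: "0 < r" using assms(1) by (metis ball_eq_empty empty_iff not_le)
  have pos: "emeasure lborel (ball x r) \<noteq> 0" "emeasure lborel (ball x r) \<noteq> \<infinity>"
  proof -
    have "0 < unit_ball_vol (real CARD('n)) * r ^ CARD('n)" using r by (intro mult_pos_pos) auto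
    hence "ennreal (unit_ball_vol (real CARD('n)) * r ^ CARD('n)) \<noteq> 0" unfolding ennreal_eq_0_iff by linarith
    thus "emeasure lborel (ball x r) \<noteq> 0" "emeasure lborel (ball x r) \<noteq> \<infinity>"
      using r by (simp_all add: emeasure_ball)
  qed
  have "(\<integral>\<^sup>+z\<in>ball x r. ennreal \<bar>f z\<bar> \<partial>lebesgue) / emeasure lebesgue (ball x r) \<le> HL_maximal f y"
    unfolding HL_maximal_def using r assms(1) by (intro SUP_upper2[of "(x, r)"]) auto
  hence "(\<integral>\<^sup>+z. ennreal (f z) * indicator (ball x r) z \<partial>lborel) / emeasure lborel (ball x r) \<le> HL_maximal f y"
    using f by (simp add: nn_integral_completion)
  hence "(\<integral>\<^sup>+z. ennreal (f z) * indicator (ball x r) z \<partial>lborel) / emeasure lborel (ball x r) * emeasure lborel (ball x r)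
      \<le> HL_maximal f y * emeasure lborel (ball x r)"
    by (rule mult_right_mono) simp
  thus ?thesis using pos by (simp add: ennreal_divide_times ennreal_divide_self less_top)
qed

text \<open>Iteration needs real values, so infinite values of the maximal function become 0. The
  iterates agree with the true ones a.e. once each maximal function is finite a.e.\<close>

primrec HL_iterate :: "(real ^ 'n \<Rightarrow> real) \<Rightarrow> nat \<Rightarrow> real ^ 'n \<Rightarrow> real" where
  "HL_iterate h 0 = h"
| "HL_iterate h (Suc k) = (\<lambda>x. enn2real (HL_maximal (HL_iterate h k) x))"

lemma HL_iterate_nonneg: "(\<And>x. 0 \<le> h x) \<Longrightarrow> 0 \<le> HL_iterate h k x"
  by (cases k) auto

lemma HL_iterate_borel: "h \<in> borel_measurable borel \<Longrightarrow> HL_iterate h k \<in> borel_measurable borel"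
  by (cases k) (auto intro: borel_measurable_enn2real HL_maximal_borel)

lemma ennreal_suminf_Suc_le: "(\<Sum>k. f (Suc k)) \<le> (\<Sum>k. f k :: ennreal)"
proof (rule suminf_le_const[OF summableI])
  fix n
  have "(\<Sum>k<n. f (Suc k)) \<le> (\<Sum>k<Suc n. f k)"
    unfolding sum.lessThan_Suc_shift by simp
  also have "\<dots> \<le> (\<Sum>k. f k)" by (intro sum_le_suminf) auto
  finally show "(\<Sum>k<n. f (Suc k)) \<le> (\<Sum>k. f k)" .
qed

text \<open>The maximal operator shifts the series by one index: averages of the k-th term are at
  most \<open>K\<close> times the next term, so averages of the sum over a ball containing y are at
  most K w(y).\<close>

lemma A1_weight_HL_series:
  fixes h :: "real ^ 'n \<Rightarrow> real"
  assumes h [measurable]: "h \<in> borel_measurable borel" and h_nonneg: "\<And>x. 0 \<le> h x"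
    and h_nz: "(\<integral>\<^sup>+x. ennreal (h x) \<partial>lborel) \<noteq> 0" and K: "1 \<le> K"
    and iter: "\<And>k. AE x in lborel. ennreal (HL_iterate h (Suc k) x) = HL_maximal (HL_iterate h k) x"
    and fin: "AE x in lborel. (\<Sum>k. ennreal (HL_iterate h k x / K ^ k)) < \<infinity>"
  shows "A1_weight (\<lambda>x. enn2real (\<Sum>k. ennreal (HL_iterate h k x / K ^ k))) K"
    and "AE x in lborel. h x \<le> enn2real (\<Sum>k. ennreal (HL_iterate h k x / K ^ k))"
proof -
  define S where "S x = (\<Sum>k. ennreal (HL_iterate h k x / K ^ k))" for x
  define w where "w x = enn2real (S x)" for x
  have [measurable]: "HL_iterate h k \<in> borel_measurable borel" for k by (rule HL_iterate_borel[OF h])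
  have S_meas [measurable]: "S \<in> borel_measurable borel" unfolding S_def[abs_def] by measurable
  have w_meas [measurable]: "w \<in> borel_measurable borel" unfolding w_def[abs_def] by measurable
  have H0: "0 \<le> HL_iterate h k x" for k x by (rule HL_iterate_nonneg[OF h_nonneg])
  have wS: "AE x in lborel. ennreal (w x) = S x"
    using fin by eventually_elim (simp add: w_def S_def)
  have A1: "AE y in lborel. \<forall>x r. y \<in> ball x r \<longrightarrow>
      emeasure (density lborel w) (ball x r) \<le> ennreal (K * w y) * emeasure lborel (ball x r)"
  proof -
    \<comment> \<open>One null set serves all iterates, and the bounds at y then hold for every ball
      containing y.\<close>
    have "AE y in lborel. \<forall>k. ennreal (HL_iterate h (Suc k) y) = HL_maximal (HL_iterate h k) y"
      using iter by (simp add: AE_all_countable)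
    thus ?thesis using wS
    proof eventually_elim
      case (elim y)
      show ?case
      proof (intro allI impI)
        fix x r assume y: "y \<in> ball x r"
        have [measurable]: "ball x r \<in> sets borel" by simp
        have ball_le: "(\<integral>\<^sup>+z. ennreal (HL_iterate h k z / K ^ k) * indicator (ball x r) z \<partial>lborel)
          \<le> ennreal K * emeasure lborel (ball x r) * ennreal (HL_iterate h (Suc k) y / K ^ Suc k)" for k
        proof -
          have "(\<integral>\<^sup>+z. ennreal (HL_iterate h k z / K ^ k) * indicator (ball x r) z \<partial>lborel)
            = (\<integral>\<^sup>+z. ennreal (1 / K ^ k) * (ennreal (HL_iterate h k z) * indicator (ball x r) z) \<partial>lborel)"
            using K H0 by (intro nn_integral_cong) (simp add: mult.assoc[symmetric] flip: ennreal_mult)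
          also have "\<dots> = ennreal (1 / K ^ k) * (\<integral>\<^sup>+z. ennreal (HL_iterate h k z) * indicator (ball x r) z \<partial>lborel)"
            by (rule nn_integral_cmult) measurable
          also have "\<dots> \<le> ennreal (1 / K ^ k) * (HL_maximal (HL_iterate h k) y * emeasure lborel (ball x r))"
            using nn_integral_ball_le_HL_maximal[OF y H0] by (rule mult_left_mono) simp
          also have "HL_maximal (HL_iterate h k) y = ennreal (HL_iterate h (Suc k) y)"
            using elim(1) by (simp only:)
          also have "\<dots> = ennreal K * (ennreal (K ^ k) * ennreal (HL_iterate h (Suc k) y / K ^ Suc k))"
          proof -
            have "ennreal K * (ennreal (K ^ k) * ennreal t) = ennreal (K * (K ^ k * t))" for t
              using K by (simp add: ennreal_mult')
            thus ?thesis using K by simp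
          qed
          also have "ennreal (1 / K ^ k) * (ennreal K * (ennreal (K ^ k) * ennreal (HL_iterate h (Suc k) y / K ^ Suc k)) * emeasure lborel (ball x r))
            = (ennreal (1 / K ^ k) * ennreal (K ^ k)) * (ennreal K * emeasure lborel (ball x r) * ennreal (HL_iterate h (Suc k) y / K ^ Suc k))"
            by (simp only: mult_ac)
          also have "ennreal (1 / K ^ k) * ennreal (K ^ k) = 1"
            using K by (subst ennreal_mult'[symmetric]) simp_all
          finally show ?thesis by (simp only: mult_1_left)
        qed
        have "emeasure (density lborel w) (ball x r) = (\<integral>\<^sup>+z. ennreal (w z) * indicator (ball x r) z \<partial>lborel)"
          by (simp add: emeasure_density)
        also have "\<dots> = (\<integral>\<^sup>+z. (\<Sum>k. ennreal (HL_iterate h k z / K ^ k) * indicator (ball x r) z) \<partial>lborel)"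
          by (rule nn_integral_cong_AE, use wS in eventually_elim) (simp add: S_def ennreal_suminf_multc)
        also have "\<dots> = (\<Sum>k. \<integral>\<^sup>+z. ennreal (HL_iterate h k z / K ^ k) * indicator (ball x r) z \<partial>lborel)"
          by (rule nn_integral_suminf) measurable
        also have "\<dots> \<le> (\<Sum>k. ennreal K * emeasure lborel (ball x r) * ennreal (HL_iterate h (Suc k) y / K ^ Suc k))"
          by (intro suminf_le ball_le) auto
        also have "\<dots> = ennreal K * emeasure lborel (ball x r) * (\<Sum>k. ennreal (HL_iterate h (Suc k) y / K ^ Suc k))"
          by (rule ennreal_suminf_cmult)
        also have "\<dots> \<le> ennreal K * emeasure lborel (ball x r) * S y"
          unfolding S_def by (rule mult_left_mono[OF ennreal_suminf_Suc_le]) simp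
        also have "\<dots> = ennreal (K * w y) * emeasure lborel (ball x r)"
          using K elim(2) by (simp add: ennreal_mult' mult_ac)
        finally show "emeasure (density lborel w) (ball x r) \<le> ennreal (K * w y) * emeasure lborel (ball x r)" .
      qed
    qed
  qed
  have hw: "AE x in lborel. h x \<le> w x"
    using wS
  proof eventually_elim
    case (elim x)
    have "ennreal (h x) \<le> S x"
      unfolding S_def using sum_le_suminf[of "\<lambda>k. ennreal (HL_iterate h k x / K ^ k)" "{0}"] by simp
    hence "ennreal (h x) \<le> ennreal (w x)" unfolding elim .
    moreover have "0 \<le> w x" by (simp add: w_def)
    ultimately show ?case by simp
  qed
  have "emeasure (density lborel w) UNIV \<noteq> 0"
  proof
    assume "emeasure (density lborel w) UNIV = 0"
    moreover have "(\<integral>\<^sup>+x. ennreal (h x) \<partial>lborel) \<le> (\<integral>\<^sup>+x. ennreal (w x) \<partial>lborel)"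
      by (rule nn_integral_mono_AE, use hw in eventually_elim) (rule ennreal_leI)
    ultimately show False using h_nz by (simp add: emeasure_density)
  qed
  \<comment> \<open>If w(y) = 0 at a point satisfying the A1 bound, all balls around y have measure
    0, contradicting the positive total mass inherited from h.\<close>
  have "AE y in lborel. 0 < w y"
    using A1
  proof eventually_elim
    case (elim y)
    show ?case
    proof (rule ccontr)
      assume "\<not> 0 < w y"
      hence "w y = 0" by (simp add: w_def less_le)
      have "emeasure (density lborel w) (ball y (real (Suc k))) = 0" for k
        using spec[OF spec[OF elim, of y], of "real (Suc k)"] \<open>w y = 0\<close> by simp
      hence "emeasure (density lborel w) (\<Union>k. ball y (real (Suc k))) = 0"
        by (intro emeasure_UN_eq_0) auto
      moreover have "(\<Union>k. ball y (real (Suc k))) = UNIV"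
      proof -
        have "\<exists>k. dist y x < real (Suc k)" for x
        proof -
          obtain k where "dist y x < real k" using reals_Archimedean2 by blast
          hence "dist y x < real (Suc k)" by simp
          thus ?thesis ..
        qed
        thus ?thesis by auto
      qed
      ultimately show False using \<open>emeasure (density lborel w) UNIV \<noteq> 0\<close> by simp
    qed
  qed
  hence "A1_weight w K"
    using K A1 by unfold_locales (auto simp: w_def)
  thus "A1_weight (\<lambda>x. enn2real (\<Sum>k. ennreal (HL_iterate h k x / K ^ k))) K"
    by (simp add: w_def[abs_def] S_def)
  show "AE x in lborel. h x \<le> enn2real (\<Sum>k. ennreal (HL_iterate h k x / K ^ k))"
    using hw by (simp add: w_def S_def)
qed

section \<open>The Rubio de Francia majorant\<close>

context variable_exponent
begin

text \<open>The constant \<open>K\<close> comes only from the operator bound, not from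
  \<open>h\<close> or \<open>b\<close>. The integral and essential supremum parts of the modular are
  kept apart because they are used at different points.\<close>

lemma Rubio_de_Francia:
  assumes bdd: "HL_maximal_bounded_on s"
  shows "\<exists>K\<ge>1. \<forall>h b. h \<in> borel_measurable borel \<longrightarrow> (\<forall>x. 0 \<le> h x) \<longrightarrow> (\<integral>\<^sup>+x. ennreal (h x) \<partial>lborel) \<noteq> 0 \<longrightarrow>
    1 \<le> b \<longrightarrow> vexp_modular s (\<lambda>x. ennreal (h x)) \<le> ennreal b \<longrightarrow>
    (\<exists>w. A1_weight w K \<and> (AE x in lborel. h x \<le> w x) \<and>
      (\<integral>\<^sup>+x. (if s x = \<infinity> then 0 else ennreal ((w x / (2 * b)) powr real_of_ereal (s x))) \<partial>lebesgue) \<le> 2 \<and>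
      (AE x in lebesgue. s x = \<infinity> \<longrightarrow> w x \<le> 2 * b))"
proof -
  obtain C0 where C0: "\<And>f. f \<in> vexp_space s \<Longrightarrow> vexp_norm s (HL_maximal f) \<le> ennreal C0 * vexp_norm s (\<lambda>x. ennreal \<bar>f x\<bar>)"
    using bdd by (auto simp: HL_maximal_bounded_on_def)
  \<comment> \<open>The 2 pays for passing from norm to modular, and the maximum handles a
    \<open>C0\<close> below 1. In \<open>K = 4 * B\<close> one factor 2 gives the convex weights
    2^(-k-1) and another makes the modulars summable.\<close>
  define B where "B = 2 * max 1 C0"
  define K where "K = 4 * B"
  have B: "2 \<le> B" and K: "1 \<le> K" by (auto simp: B_def K_def)
  show ?thesis
  proof (intro exI[of _ K] conjI K allI impI)
    fix h :: "real ^ 'n \<Rightarrow> real" and b :: real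
    assume h [measurable]: "h \<in> borel_measurable borel" and h_nonneg: "\<forall>x. 0 \<le> h x"
      and h_nz: "(\<integral>\<^sup>+x. ennreal (h x) \<partial>lborel) \<noteq> 0" and b: "1 \<le> b"
      and h_mod: "vexp_modular s (\<lambda>x. ennreal (h x)) \<le> ennreal b"
    define H where "H = HL_iterate h"
    have H_borel: "H k \<in> borel_measurable borel" for k unfolding H_def by (rule HL_iterate_borel[OF h])
    have H_meas [measurable]: "H k \<in> borel_measurable lebesgue" for k
      using H_borel[of k] by (intro measurable_completion) simp
    have M_meas [measurable]: "HL_maximal f \<in> borel_measurable lebesgue" for f :: "real ^ 'n \<Rightarrow> real"
      by (intro measurable_completion) (simp add: HL_maximal_borel)
    have H0: "0 \<le> H k x" for k x unfolding H_def using h_nonneg by (intro HL_iterate_nonneg) auto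
    have bB: "0 < b * B ^ k" for k using b B by simp
    have next_step: "(AE x in lebesgue. ennreal (H (Suc k) x) = HL_maximal (H k) x) \<and>
        vexp_modular s (\<lambda>x. ennreal (H (Suc k) x) / ennreal (b * B ^ Suc k)) \<le> 1"
      if IH: "vexp_modular s (\<lambda>x. ennreal (H k x) / ennreal (b * B ^ k)) \<le> 1" for k
    proof -
      have space: "H k \<in> vexp_space s"
        using IH bB[of k] H0 by (auto simp: vexp_space_def intro!: exI[of _ "b * B ^ k"] order.strict_trans1[OF IH])
      have "vexp_norm s (HL_maximal (H k)) \<le> ennreal C0 * vexp_norm s (\<lambda>x. ennreal \<bar>H k x\<bar>)"
        by (rule C0[OF space])
      also have "\<dots> \<le> ennreal (max 1 C0) * ennreal (b * B ^ k)"
        using norm_le_if_modular_le[OF bB IH] H0 by (intro mult_mono ennreal_leI) auto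
      also have "\<dots> = ennreal (max 1 C0 * (b * B ^ k))" by (rule ennreal_mult'[symmetric]) simp
      finally have norm_le: "vexp_norm s (HL_maximal (H k)) \<le> ennreal (max 1 C0 * (b * B ^ k))" .
      have "0 < max 1 C0 * (b * B ^ k)" by (rule mult_pos_pos[OF _ bB]) simp
      from modular_le_if_norm_le[OF M_meas this norm_le]
      have "vexp_modular s (\<lambda>x. HL_maximal (H k) x / ennreal (2 * (max 1 C0 * (b * B ^ k)))) \<le> 1" .
      also have "2 * (max 1 C0 * (b * B ^ k)) = b * B ^ Suc k" by (simp add: B_def)
      finally have mod: "vexp_modular s (\<lambda>x. HL_maximal (H k) x / ennreal (b * B ^ Suc k)) \<le> 1" .
      \<comment> \<open>A finite modular excludes infinite values a.e., so the truncation in the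
        definition of the iterates is harmless.\<close>
      have "AE x in lebesgue. HL_maximal (H k) x / ennreal (b * B ^ Suc k) < \<infinity>"
      proof (rule modular_finite_imp_finite)
        show "(\<lambda>x. HL_maximal (H k) x / ennreal (b * B ^ Suc k)) \<in> borel_measurable lebesgue" by measurable
        show "vexp_modular s (\<lambda>x. HL_maximal (H k) x / ennreal (b * B ^ Suc k)) < \<infinity>"
          by (rule le_less_trans[OF mod]) simp
      qed
      hence fin: "AE x in lebesgue. ennreal (H (Suc k) x) = HL_maximal (H k) x"
      proof eventually_elim
        case (elim x)
        hence "HL_maximal (H k) x \<noteq> \<infinity>" by (auto simp: ennreal_top_divide)
        thus ?case by (simp add: H_def less_top)
      qed
      have "vexp_modular s (\<lambda>x. ennreal (H (Suc k) x) / ennreal (b * B ^ Suc k))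
          \<le> vexp_modular s (\<lambda>x. HL_maximal (H k) x / ennreal (b * B ^ Suc k))"
        by (rule modular_mono) (measurable, use fin in \<open>auto elim: eventually_mono\<close>)
      with mod fin show ?thesis by auto
    qed
    have mod: "vexp_modular s (\<lambda>x. ennreal (H k x) / ennreal (b * B ^ k)) \<le> 1" for k
    proof (induction k)
      case 0
      have eq: "(\<lambda>x. ennreal (H 0 x) / ennreal (b * B ^ 0)) = (\<lambda>x. ennreal (1 / b) * ennreal (h x))"
        using b h_nonneg by (auto simp: H_def fun_eq_iff divide_ennreal simp flip: ennreal_mult)
      have "vexp_modular s (\<lambda>x. ennreal (1 / b) * ennreal (h x)) \<le> ennreal (1 / b) * vexp_modular s (\<lambda>x. ennreal (h x))"
        using b H_meas[of 0] by (intro modular_cmult_le) (auto simp: H_def)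
      also have "\<dots> \<le> ennreal (1 / b) * ennreal b" using h_mod by (rule mult_left_mono) simp
      also have "\<dots> = 1" using b by (simp flip: ennreal_mult)
      finally show ?case unfolding eq .
    next
      case (Suc k)
      show ?case by (rule conjunct2[OF next_step[OF Suc]])
    qed
    \<comment> \<open>By convexity the factor 2^(-k) bounds the modular of \<open>U k\<close> by
      2^(-k); the sum 2 of these bounds is the 2 in the conclusion.\<close>
    define U where "U k x = ennreal ((1 / 2) ^ k) * (ennreal (H k x) / ennreal (b * B ^ k))" for k x
    have U_meas [measurable]: "U k \<in> borel_measurable lebesgue" for k unfolding U_def[abs_def] by measurable
    define Z where "Z x = (\<Sum>k. ennreal ((1 / 2) ^ Suc k) * U k x)" for x
    have Z_meas [measurable]: "Z \<in> borel_measurable lebesgue" unfolding Z_def[abs_def] by measurable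
    define S where "S x = (\<Sum>k. ennreal (H k x / K ^ k))" for x
    have SZ: "S x = ennreal (2 * b) * Z x" for x
    proof -
      have "ennreal (H k x / K ^ k) = ennreal (2 * b) * (ennreal ((1 / 2) ^ Suc k) * U k x)" for k
      proof -
        have half: "(1 / 2) ^ k * (1 / 2) ^ k = (1 / 4 :: real) ^ k"
          by (simp flip: power_mult_distrib)
        have "(2 * b) * ((1 / 2) ^ Suc k * ((1 / 2) ^ k * (H k x / (b * B ^ k)))) = ((1 / 2) ^ k * (1 / 2) ^ k) * (H k x / B ^ k)"
          using b by simp
        also have "\<dots> = H k x / K ^ k"
          unfolding half by (simp add: K_def power_mult_distrib power_divide)
        finally have real_eq: "(2 * b) * ((1 / 2) ^ Suc k * ((1 / 2) ^ k * (H k x / (b * B ^ k)))) = H k x / K ^ k" .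
        have "ennreal (2 * b) * (ennreal c * (ennreal d * ennreal t)) = ennreal (2 * b * (c * (d * t)))" if "0 \<le> c" "0 \<le> d" for c d t
          using that b by (simp add: ennreal_mult')
        from this[of "(1 / 2) ^ Suc k" "(1 / 2) ^ k" "H k x / (b * B ^ k)"]
        show ?thesis unfolding U_def divide_ennreal[OF H0 bB] real_eq by simp
      qed
      thus ?thesis unfolding S_def Z_def by (simp add: ennreal_suminf_cmult)
    qed
    have int: "(\<integral>\<^sup>+x. (if s x = \<infinity> then 0 else ennreal_rpow (Z x) (real_of_ereal (s x))) \<partial>lebesgue) \<le> 2"
    proof -
      have "(\<integral>\<^sup>+x. (if s x = \<infinity> then 0 else ennreal_rpow (Z x) (real_of_ereal (s x))) \<partial>lebesgue)
        \<le> (\<integral>\<^sup>+x. (\<Sum>k. if s x = \<infinity> then 0 else ennreal_rpow (U k x) (real_of_ereal (s x))) \<partial>lebesgue)"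
        by (rule nn_integral_mono_AE, use exponent_ge_1 in eventually_elim)
           (auto simp: Z_def simp del: power_Suc intro!: ennreal_rpow_suminf_le)
      also have "\<dots> = (\<Sum>k. \<integral>\<^sup>+x. (if s x = \<infinity> then 0 else ennreal_rpow (U k x) (real_of_ereal (s x))) \<partial>lebesgue)"
        by (rule nn_integral_suminf) (rule rpow_measurable[OF U_meas])
      also have "\<dots> \<le> (\<Sum>k. ennreal ((1 / 2) ^ k))"
      proof (intro suminf_le)
        fix k
        have "(\<integral>\<^sup>+x. (if s x = \<infinity> then 0 else ennreal_rpow (U k x) (real_of_ereal (s x))) \<partial>lebesgue)
          \<le> vexp_modular s (U k)" unfolding vexp_modular_def by simp
        also have "\<dots> \<le> ennreal ((1 / 2) ^ k) * vexp_modular s (\<lambda>x. ennreal (H k x) / ennreal (b * B ^ k))"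
          unfolding U_def[abs_def] by (rule modular_cmult_le) (auto simp: power_le_one)
        also have "\<dots> \<le> ennreal ((1 / 2) ^ k) * 1" using mod by (rule mult_left_mono) simp
        finally show "(\<integral>\<^sup>+x. (if s x = \<infinity> then 0 else ennreal_rpow (U k x) (real_of_ereal (s x))) \<partial>lebesgue)
          \<le> ennreal ((1 / 2) ^ k)" by simp
      qed auto
      also have "\<dots> = ennreal 2"
        using geometric_sums[of "1 / 2 :: real"] by (intro suminf_ennreal_eq) auto
      finally show ?thesis by simp
    qed
    have top: "AE x in lebesgue. s x = \<infinity> \<longrightarrow> Z x \<le> 1"
    proof -
      have "AE x in lebesgue. \<forall>k. s x = \<infinity> \<longrightarrow> ennreal (H k x) / ennreal (b * B ^ k) \<le> 1"
        unfolding AE_all_countable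
      proof
        fix k
        have "esssup lebesgue (\<lambda>x. if s x = \<infinity> then ennreal (H k x) / ennreal (b * B ^ k) else 0) \<le> 1"
          using mod[of k] unfolding vexp_modular_def by (rule order.trans[rotated]) simp
        with esssup_AE[of "\<lambda>x. if s x = \<infinity> then ennreal (H k x) / ennreal (b * B ^ k) else 0" lebesgue]
        show "AE x in lebesgue. s x = \<infinity> \<longrightarrow> ennreal (H k x) / ennreal (b * B ^ k) \<le> 1"
          by (auto elim!: eventually_mono split: if_splits)
      qed
      thus ?thesis
      proof eventually_elim
        case (elim x)
        show ?case
        proof
          assume "s x = \<infinity>"
          have "U k x \<le> 1" for k
          proof -
            have "U k x \<le> 1 * 1" unfolding U_def
              using elim \<open>s x = \<infinity>\<close> by (intro mult_mono) (auto simp: power_le_one ennreal_le_1)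
            thus ?thesis by simp
          qed
          hence "Z x \<le> (\<Sum>k. ennreal ((1 / 2) ^ Suc k) * 1)"
            unfolding Z_def by (intro suminf_le mult_left_mono) auto
          also have "\<dots> = ennreal 1" unfolding mult_1_right using power_half_series by (intro suminf_ennreal_eq) auto
          finally show "Z x \<le> 1" by simp
        qed
      qed
    qed
    have Zfin: "AE x in lebesgue. Z x < \<infinity>"
    proof -
      have "AE x in lebesgue. (if s x = \<infinity> then 0 else ennreal_rpow (Z x) (real_of_ereal (s x))) \<noteq> \<infinity>"
        using int by (intro nn_integral_PInf_AE rpow_measurable Z_meas) (auto simp: top_unique)
      thus ?thesis using top
      proof eventually_elim
        case (elim x)
        thus ?case by (cases "s x = \<infinity>") (auto simp: ennreal_rpow_def less_top split: if_splits intro: order.strict_trans1)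
      qed
    qed
    hence "AE x in lborel. Z x < \<infinity>" by (simp add: AE_completion_iff)
    hence Sfin: "AE x in lborel. S x < \<infinity>"
      by eventually_elim (simp add: SZ ennreal_mult_less_top)
    have iter: "AE x in lborel. ennreal (HL_iterate h (Suc k) x) = HL_maximal (HL_iterate h k) x" for k
      using next_step[OF mod[of k]] by (simp add: H_def AE_completion_iff)
    define w where "w x = enn2real (S x)" for x
    have A1: "A1_weight w K" and hw: "AE x in lborel. h x \<le> w x"
      using A1_weight_HL_series[OF h _ h_nz K iter] h_nonneg Sfin
      by (simp_all add: w_def[abs_def] S_def H_def)
    have wZ: "w x / (2 * b) = enn2real (Z x)" for x
      using b by (simp add: w_def SZ enn2real_mult)
    show "\<exists>w. A1_weight w K \<and> (AE x in lborel. h x \<le> w x) \<and>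
      (\<integral>\<^sup>+x. (if s x = \<infinity> then 0 else ennreal ((w x / (2 * b)) powr real_of_ereal (s x))) \<partial>lebesgue) \<le> 2 \<and>
      (AE x in lebesgue. s x = \<infinity> \<longrightarrow> w x \<le> 2 * b)"
    proof (intro exI[of _ w] conjI A1 hw)
      have "(\<integral>\<^sup>+x. (if s x = \<infinity> then 0 else ennreal ((w x / (2 * b)) powr real_of_ereal (s x))) \<partial>lebesgue)
        = (\<integral>\<^sup>+x. (if s x = \<infinity> then 0 else ennreal_rpow (Z x) (real_of_ereal (s x))) \<partial>lebesgue)"
        by (rule nn_integral_cong_AE, use Zfin in eventually_elim) (auto simp: wZ ennreal_rpow_def)
      with int show "(\<integral>\<^sup>+x. (if s x = \<infinity> then 0 else ennreal ((w x / (2 * b)) powr real_of_ereal (s x))) \<partial>lebesgue) \<le> 2" by simp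
      show "AE x in lebesgue. s x = \<infinity> \<longrightarrow> w x \<le> 2 * b"
        using top
      proof eventually_elim
        case (elim x)
        show ?case
        proof
          assume "s x = \<infinity>"
          with elim have "Z x \<le> 1" by simp
          hence "enn2real (Z x) \<le> 1" using enn2real_mono[of "Z x" 1] by simp
          hence "w x / (2 * b) \<le> 1" by (simp add: wZ)
          thus "w x \<le> 2 * b" using b by (simp add: field_simps)
        qed
      qed
    qed
  qed
qed

end

section \<open>The exponents\<close>

lemma borel_measurable_lebesgue_AE_eq:
  fixes f g :: "'a :: euclidean_space \<Rightarrow> real"
  assumes f: "f \<in> borel_measurable lebesgue" and eq: "AE x in lebesgue. f x = g x"
  shows "g \<in> borel_measurable lebesgue"
proof (rule borel_measurableI)
  fix S :: "real set" assume "open S"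
  hence "f -` S \<inter> space lebesgue \<in> sets lebesgue" using f by (intro measurable_sets) auto
  moreover have "AE x in lebesgue. x \<in> f -` S \<inter> space lebesgue \<longleftrightarrow> x \<in> g -` S \<inter> space lebesgue"
    using eq by eventually_elim auto
  ultimately show "g -` S \<inter> space lebesgue \<in> sets lebesgue"
    by (intro completion.in_sets_AE[of "f -` S \<inter> space lebesgue" "g -` S \<inter> space lebesgue"]) auto
qed

text \<open>The supremum need not be attained a priori; countably many lower bounds P - 1/(k+1)
  share one null set, and their limit gives P.\<close>

lemma ess_inf_AE:
  assumes "ess_inf p = ereal P"
  shows "AE x in lebesgue. P \<le> p x"
proof -
  have lower: "AE x in lebesgue. P - 1 / real (Suc k) \<le> p x" for k
  proof -
    have "ereal (P - 1 / real (Suc k)) < ess_inf p" using assms by simp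
    then obtain z where z: "AE x in lebesgue. z \<le> ereal (p x)" "ereal (P - 1 / real (Suc k)) < z"
      unfolding ess_inf_def less_Sup_iff by auto
    from z(1) show ?thesis
    proof eventually_elim
      case (elim x)
      with z(2) have "ereal (P - 1 / real (Suc k)) < ereal (p x)" by (rule less_le_trans)
      thus ?case by simp
    qed
  qed
  have "AE x in lebesgue. \<forall>k. P - 1 / real (Suc k) \<le> p x"
    by (rule AE_all_countable[THEN iffD2]) (rule allI, rule lower)
  thus ?thesis
  proof eventually_elim
    case (elim x)
    have "(\<lambda>k. P - 1 / real (Suc k)) \<longlonglongrightarrow> P - 0"
      using LIMSEQ_inverse_real_of_nat by (intro tendsto_intros) (simp add: inverse_eq_divide)
    hence "P - 0 \<le> p x" by (rule LIMSEQ_le_const2) (use elim in auto)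
    thus ?case by simp
  qed
qed

text \<open>With \<open>d = 1 / p\<^sub>0 - 1 / p\<close> the hypotheses say \<open>1 / q = e - d\<close>, and the conjugate exponent of
  \<open>e q\<close> is \<open>e / d\<close>.\<close>

lemma conj_exponent_eq:
  fixes p0 p q e :: real
  assumes "1 \<le> p0" "p0 \<le> p" "0 < e" "1 / q = e - (1 / p0 - 1 / p)" "0 < q"
  shows "p = p0 \<Longrightarrow> e * q = 1"
    and "p \<noteq> p0 \<Longrightarrow> 1 < e * q"
    and "p \<noteq> p0 \<Longrightarrow> e * q / (e * q - 1) = e * p0 * p / (p - p0)"
    and "p \<noteq> p0 \<Longrightarrow> (q - 1 / e) * (e * q / (e * q - 1)) = q"
    and "1 / e \<le> q"
proof -
  have q: "e * q = 1 + (1 / p0 - 1 / p) * q"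
    using assms(4,5) by (simp add: field_simps)
  show "e * q = 1" if "p = p0" using q that by simp
  show 1: "1 < e * q" if "p \<noteq> p0"
  proof -
    have "1 / p < 1 / p0" using that assms by (intro divide_strict_left_mono) auto
    thus ?thesis using q assms(5) by simp
  qed
  show "e * q / (e * q - 1) = e * p0 * p / (p - p0)" if "p \<noteq> p0"
  proof -
    have "e * q - 1 = (1 / p0 - 1 / p) * q" using q by simp
    also have "\<dots> = (p - p0) / (p0 * p) * q" using assms by (simp add: field_simps)
    finally have "e * q - 1 = (p - p0) / (p0 * p) * q" .
    thus ?thesis using that assms by simp
  qed
  show "(q - 1 / e) * (e * q / (e * q - 1)) = q" if "p \<noteq> p0"
  proof -
    have "q - 1 / e = (e * q - 1) / e" using assms(3) by (simp add: field_simps)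
    thus ?thesis using 1[OF that] assms(3) by simp
  qed
  have "1 / p \<le> 1 / p0" using assms by (intro divide_left_mono) auto
  hence "1 \<le> e * q" using q assms(5) by simp
  thus "1 / e \<le> q" using assms(3) by (simp add: field_simps)
qed

text \<open>Young's inequality for the exponents p / p0 and p / (p - p0), proved with constants 1 by
  asking which factor dominates. The exponent of v is that of the conjugate exponent of e q.\<close>

lemma powr_mult_le_add:
  fixes f v p0 p e :: real
  assumes "0 \<le> f" "0 \<le> v" "1 \<le> p0" "p0 < p" "0 < e"
  shows "f powr p0 * v powr (p0 * e) \<le> f powr p + v powr (e * p0 * p / (p - p0))"
proof (cases "f = 0 \<or> v powr (p0 * e) \<le> f powr (p - p0)")
  case True
  have "f powr p0 * v powr (p0 * e) \<le> f powr p"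
  proof (cases "f = 0")
    case False
    hence "f powr p0 * v powr (p0 * e) \<le> f powr p0 * f powr (p - p0)"
      using True by (intro mult_left_mono) auto
    also have "\<dots> = f powr p" by (subst powr_add[symmetric]) simp
    finally show ?thesis .
  qed simp
  thus ?thesis by (simp add: add_increasing2)
next
  case False
  hence f: "0 < f" and lt: "f powr (p - p0) < v powr (p0 * e)" using assms by auto
  hence "(f powr (p - p0)) powr (p0 / (p - p0)) \<le> (v powr (p0 * e)) powr (p0 / (p - p0))"
    using assms by (intro powr_mono2) auto
  hence "f powr p0 \<le> v powr (p0 * e * (p0 / (p - p0)))"
    using assms by (simp add: powr_powr)
  hence "f powr p0 * v powr (p0 * e) \<le> v powr (p0 * e * (p0 / (p - p0))) * v powr (p0 * e)"
    by (intro mult_right_mono) auto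
  also have "\<dots> = v powr (e * p0 * p / (p - p0))"
  proof -
    have "p0 * e * (p0 / (p - p0)) + p0 * e = e * p0 * p / (p - p0)"
      using assms by (simp add: field_simps)
    thus ?thesis by (simp flip: powr_add)
  qed
  finally show ?thesis by (simp add: add_increasing)
qed

lemma A1_weight_scale:
  fixes w :: "real ^ 'n \<Rightarrow> real"
  assumes "A1_weight w K" and c: "0 < c"
  shows "A1_weight (\<lambda>x. c * w x) K"
    and "S \<in> sets borel \<Longrightarrow> emeasure (density lborel (\<lambda>x. c * w x)) S = ennreal c * emeasure (density lborel w) S"
proof -
  interpret A1_weight w K by fact
  show sc: "emeasure (density lborel (\<lambda>x. c * w x)) S = ennreal c * emeasure (density lborel w) S" if "S \<in> sets borel" for S
  proof -
    note [measurable] = that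
    have "emeasure (density lborel (\<lambda>x. c * w x)) S = (\<integral>\<^sup>+x. ennreal c * (ennreal (w x) * indicator S x) \<partial>lborel)"
      using c w_nonneg by (simp add: emeasure_density ennreal_mult mult.assoc)
    also have "\<dots> = ennreal c * emeasure (density lborel w) S"
      by (simp add: nn_integral_cmult emeasure_density)
    finally show ?thesis .
  qed
  show "A1_weight (\<lambda>x. c * w x) K"
  proof
    show "AE y in lborel. 0 < c * w y" using w_pos by eventually_elim (use c in simp)
    show "AE y in lborel. \<forall>x r. y \<in> ball x r \<longrightarrow>
        emeasure (density lborel (\<lambda>x. c * w x)) (ball x r) \<le> ennreal (K * (c * w y)) * emeasure lborel (ball x r)"
      using A1
    proof eventually_elim
      case (elim y)
      show ?case
      proof (intro allI impI)
        fix x r assume "y \<in> ball x r"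
        hence "ennreal c * emeasure (density lborel w) (ball x r) \<le> ennreal c * (ennreal (K * w y) * emeasure lborel (ball x r))"
          using elim by (intro mult_left_mono) auto
        also have "\<dots> = ennreal (K * (c * w y)) * emeasure lborel (ball x r)"
        proof -
          have "K * (c * w y) = c * (K * w y)" by simp
          thus ?thesis using c by (simp only: ennreal_mult'[OF less_imp_le[OF c]] mult.assoc)
        qed
        finally show "emeasure (density lborel (\<lambda>x. c * w x)) (ball x r) \<le> ennreal (K * (c * w y)) * emeasure lborel (ball x r)"
          by (simp add: sc)
      qed
    qed
  qed (use c w_nonneg K_ge_1 in auto)
qed

lemma T_kernel_measurable:
  "(\<lambda>(x, y). T_kernel m a A x y) \<in> borel_measurable (lborel \<Otimes>\<^sub>M lborel)"
  unfolding T_kernel_def by measurable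

section \<open>The modular inequality\<close>

text \<open>Because p(A y) = p(y), the exponent s at A y is the one paired with p(y) in Young's
  inequality, so f at y and w at A y can be separated. The modular of f yields the 1, that of w the
  2 c after the change of variables; where s is infinite, w \<le> B replaces Young.\<close>

lemma weight_condition:
  fixes A :: "real ^ 'n ^ 'n" and p f w :: "real ^ 'n \<Rightarrow> real" and s :: "real ^ 'n \<Rightarrow> ereal" and p0 e B c :: real
  assumes [measurable]: "p \<in> borel_measurable lebesgue" "s \<in> borel_measurable lebesgue"
      "f \<in> borel_measurable borel" "w \<in> borel_measurable borel"
    and f_nonneg: "\<And>x. 0 \<le> f x" and w_nonneg: "\<And>x. 0 \<le> w x"
    and A: "invertible A" and pA: "AE x in lebesgue. p (A *v x) = p x"
    and p0: "1 \<le> p0" "AE x in lebesgue. p0 \<le> p x" and e: "0 < e" and B: "0 < B" and c_pos: "0 < c"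
    and s: "AE x in lebesgue. s x = (if p x = p0 then \<infinity> else ereal (e * p0 * p x / (p x - p0)))"
    and c: "\<And>g. g \<in> borel_measurable borel \<Longrightarrow> (\<integral>\<^sup>+y. g (A *v y) \<partial>lborel) \<le> ennreal c * (\<integral>\<^sup>+z. g z \<partial>lborel)"
    and f: "(\<integral>\<^sup>+x. ennreal (f x powr p x) \<partial>lebesgue) \<le> 1"
    and w_int: "(\<integral>\<^sup>+x. (if s x = \<infinity> then 0 else ennreal ((w x / B) powr real_of_ereal (s x))) \<partial>lebesgue) \<le> 2"
    and w_top: "AE x in lebesgue. s x = \<infinity> \<longrightarrow> w x \<le> B"
  shows "(\<integral>\<^sup>+y. ennreal (f y powr p0 * w (A *v y) powr (p0 * e)) \<partial>lborel) \<le> ennreal (B powr (p0 * e) * (1 + 2 * c))"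
proof -
  have w_leb [measurable]: "w \<in> borel_measurable lebesgue" and f_leb [measurable]: "f \<in> borel_measurable lebesgue"
    by (intro measurable_completion; simp)+
  define \<psi> where "\<psi> z = (if s z = \<infinity> then 0 else ennreal ((w z / B) powr real_of_ereal (s z)))" for z
  have "\<psi> \<in> borel_measurable lebesgue" unfolding \<psi>_def[abs_def] by measurable
  \<comment> \<open>The change of variables is available for Borel functions, whereas s is only
    Lebesgue measurable.\<close>
  then obtain \<psi>' where [measurable]: "\<psi>' \<in> borel_measurable lborel" and \<psi>': "AE x in lborel. \<psi> x = \<psi>' x"
    using completion_ex_borel_measurable by blast
  have \<psi>'_leb: "(\<lambda>y. \<psi>' (A *v y)) \<in> borel_measurable lebesgue"
    by (rule measurable_completion) measurable
  have \<psi>'_int: "(\<integral>\<^sup>+y. \<psi>' (A *v y) \<partial>lborel) \<le> ennreal c * 2"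
  proof -
    have "(\<integral>\<^sup>+z. \<psi>' z \<partial>lborel) = (\<integral>\<^sup>+z. \<psi> z \<partial>lborel)"
      by (rule nn_integral_cong_AE, use \<psi>' in eventually_elim) simp
    also have "\<dots> \<le> 2" using w_int unfolding \<psi>_def nn_integral_completion .
    finally have "ennreal c * (\<integral>\<^sup>+z. \<psi>' z \<partial>lborel) \<le> ennreal c * 2" by (rule mult_left_mono) simp
    thus ?thesis using c[of \<psi>'] by simp
  qed
  define P where "P z \<longleftrightarrow> \<psi> z = \<psi>' z \<and> s z = (if p z = p0 then \<infinity> else ereal (e * p0 * p z / (p z - p0))) \<and>
      (s z = \<infinity> \<longrightarrow> w z \<le> B)" for z
  have "AE z in lborel. P z"
    using \<psi>' s[unfolded AE_completion_iff] w_top[unfolded AE_completion_iff]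
    by eventually_elim (simp add: P_def)
  hence "AE y in lborel. P (A *v y)" by (rule AE_matrix_image[OF A])
  hence pw: "AE y in lborel. ennreal (f y powr p0 * w (A *v y) powr (p0 * e))
      \<le> ennreal (B powr (p0 * e)) * (ennreal (f y powr p y) + \<psi>' (A *v y))"
    using pA[unfolded AE_completion_iff] p0(2)[unfolded AE_completion_iff]
  proof eventually_elim
    case (elim y)
    define z where "z = A *v y"
    define v where "v = w z / B"
    have v: "0 \<le> v" using w_nonneg B by (simp add: v_def)
    have wv: "w z powr (p0 * e) = B powr (p0 * e) * v powr (p0 * e)"
    proof -
      have "w z = B * v" using B by (simp add: v_def)
      thus ?thesis using B v by (simp add: powr_mult)
    qed
    have "ennreal (f y powr p0 * v powr (p0 * e)) \<le> ennreal (f y powr p y) + \<psi>' z"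
    proof (cases "p y = p0")
      case True
      hence "s z = \<infinity>" using elim by (simp add: P_def z_def)
      hence "v \<le> 1" using elim B by (simp add: P_def z_def v_def)
      hence "v powr (p0 * e) \<le> 1" using v p0 e by (intro powr_le1) auto
      hence "f y powr p0 * v powr (p0 * e) \<le> f y powr p y * 1"
        unfolding True by (intro mult_left_mono) auto
      hence "ennreal (f y powr p0 * v powr (p0 * e)) \<le> ennreal (f y powr p y)" by (simp add: ennreal_leI)
      thus ?thesis by (rule order.trans) simp
    next
      case False
      hence sz: "s z = ereal (e * p0 * p y / (p y - p0))" using elim by (simp add: P_def z_def)
      have "p0 < p y" using False elim by simp
      hence "f y powr p0 * v powr (p0 * e) \<le> f y powr p y + v powr (e * p0 * p y / (p y - p0))"
        by (rule powr_mult_le_add[OF f_nonneg v p0(1) _ e])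
      hence "ennreal (f y powr p0 * v powr (p0 * e)) \<le> ennreal (f y powr p y + v powr (e * p0 * p y / (p y - p0)))"
        by (rule ennreal_leI)
      also have "\<dots> = ennreal (f y powr p y) + \<psi> z" by (simp add: \<psi>_def sz v_def)
      also have "\<psi> z = \<psi>' z" using elim by (simp add: P_def z_def)
      finally show ?thesis .
    qed
    hence "ennreal (B powr (p0 * e)) * ennreal (f y powr p0 * v powr (p0 * e))
        \<le> ennreal (B powr (p0 * e)) * (ennreal (f y powr p y) + \<psi>' z)"
      by (rule mult_left_mono) simp
    moreover have "ennreal (B powr (p0 * e)) * ennreal (f y powr p0 * v powr (p0 * e)) = ennreal (f y powr p0 * w z powr (p0 * e))"
      unfolding wv by (subst ennreal_mult'[symmetric]) (simp_all add: mult_ac)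
    ultimately show ?case by (simp add: z_def)
  qed
  have "(\<integral>\<^sup>+y. ennreal (f y powr p0 * w (A *v y) powr (p0 * e)) \<partial>lborel)
      \<le> (\<integral>\<^sup>+y. ennreal (B powr (p0 * e)) * (ennreal (f y powr p y) + \<psi>' (A *v y)) \<partial>lebesgue)"
    unfolding nn_integral_completion by (rule nn_integral_mono_AE[OF pw])
  also have "\<dots> = ennreal (B powr (p0 * e)) * ((\<integral>\<^sup>+y. ennreal (f y powr p y) \<partial>lebesgue) + (\<integral>\<^sup>+y. \<psi>' (A *v y) \<partial>lebesgue))"
  proof -
    have m: "(\<lambda>y. ennreal (f y powr p y)) \<in> borel_measurable lebesgue"
      by (intro measurable_compose[OF _ measurable_ennreal] powr_real_measurable f_leb assms(1))
    show ?thesis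
      unfolding nn_integral_cmult[OF borel_measurable_add[OF m \<psi>'_leb]] nn_integral_add[OF m \<psi>'_leb] ..
  qed
  also have "\<dots> \<le> ennreal (B powr (p0 * e)) * (1 + ennreal c * 2)"
    using f \<psi>'_int by (intro mult_left_mono add_mono) (auto simp: nn_integral_completion)
  also have "1 + ennreal c * 2 = ennreal (1 + 2 * c)"
    using c_pos by (simp add: ennreal_mult' mult.commute)
  also have "ennreal (B powr (p0 * e)) * \<dots> = ennreal (B powr (p0 * e) * (1 + 2 * c))"
    by (rule ennreal_mult'[symmetric]) simp
  finally show ?thesis .
qed

text \<open>Scaling by powers of two replaces an integral exceeding 1 by one between 1 and \<open>2\<^sup>Q\<close>.\<close>

lemma dyadic_normalisation:
  fixes q :: "real ^ 'n \<Rightarrow> real" and \<tau> c Q :: real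
  assumes [measurable]: "q \<in> borel_measurable lebesgue" and F [measurable]: "F \<in> sets lebesgue" and fin: "emeasure lebesgue F < \<infinity>"
    and q: "AE x in lebesgue. 1 \<le> q x \<and> q x \<le> Q" and \<tau>: "0 < \<tau>" and c: "0 < c"
    and gt: "1 < (\<integral>\<^sup>+x. ennreal ((\<tau> / c) powr q x) * indicator F x \<partial>lebesgue)"
  shows "\<exists>\<nu>\<ge>c. 1 < (\<integral>\<^sup>+x. ennreal ((\<tau> / \<nu>) powr q x) * indicator F x \<partial>lebesgue) \<and>
    (\<integral>\<^sup>+x. ennreal ((\<tau> / \<nu>) powr q x) * indicator F x \<partial>lebesgue) \<le> ennreal (2 powr Q)"
proof -
  define S where "S \<nu> = (\<integral>\<^sup>+x. ennreal ((\<tau> / \<nu>) powr q x) * indicator F x \<partial>lebesgue)" for \<nu>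
  have scale: "S \<nu> \<le> ennreal d * S \<nu>'" if d: "0 \<le> d" and "AE x in lebesgue. (\<tau> / \<nu>) powr q x \<le> d * (\<tau> / \<nu>') powr q x" for d \<nu> \<nu>'
  proof -
    have "S \<nu> \<le> (\<integral>\<^sup>+x. ennreal d * (ennreal ((\<tau> / \<nu>') powr q x) * indicator F x) \<partial>lebesgue)"
      unfolding S_def
    proof (rule nn_integral_mono_AE, use that(2) in eventually_elim)
      case (elim x)
      hence "ennreal ((\<tau> / \<nu>) powr q x) \<le> ennreal d * ennreal ((\<tau> / \<nu>') powr q x)"
        unfolding ennreal_mult'[OF d, symmetric] by (rule ennreal_leI)
      thus ?case by (simp add: indicator_def)
    qed
    also have "\<dots> = ennreal d * S \<nu>'" unfolding S_def by (rule nn_integral_cmult) measurable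
    finally show ?thesis .
  qed
  \<comment> \<open>Finite measure of \<open>F\<close> and q \<le> Q make the integral finite; as q
    \<ge> 1, each halving of \<tau> / c at least halves it, so it eventually drops to 1 or
    less.\<close>
  have S_fin: "S c < \<infinity>"
  proof -
    have "S c \<le> (\<integral>\<^sup>+x. ennreal ((max 1 (\<tau> / c)) powr Q) * indicator F x \<partial>lebesgue)"
      unfolding S_def
    proof (rule nn_integral_mono_AE, use q in eventually_elim)
      case (elim x)
      have "(\<tau> / c) powr q x \<le> (max 1 (\<tau> / c)) powr q x" using elim \<tau> c by (intro powr_mono2) auto
      also have "\<dots> \<le> (max 1 (\<tau> / c)) powr Q" using elim by (intro powr_mono) auto
      finally show ?case by (auto simp: indicator_def intro: ennreal_leI)
    qed
    also have "\<dots> = ennreal ((max 1 (\<tau> / c)) powr Q) * emeasure lebesgue F"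
      by (rule nn_integral_cmult_indicator) measurable
    also have "\<dots> < \<infinity>" using fin by (simp add: ennreal_mult_less_top)
    finally show ?thesis .
  qed
  have decay: "S (2 ^ k * c) \<le> ennreal ((1 / 2) ^ k) * S c" for k
  proof (rule scale)
    show "AE x in lebesgue. (\<tau> / (2 ^ k * c)) powr q x \<le> (1 / 2) ^ k * (\<tau> / c) powr q x"
      using q
    proof eventually_elim
      case (elim x)
      have "\<tau> / (2 ^ k * c) = (1 / 2) ^ k * (\<tau> / c)" by (simp add: power_divide)
      hence "(\<tau> / (2 ^ k * c)) powr q x = ((1 / 2) ^ k) powr q x * (\<tau> / c) powr q x"
        using \<tau> c by (simp only:) (intro powr_mult; simp)
      also have "((1 / 2) ^ k) powr q x \<le> ((1 / 2 :: real) ^ k) powr 1"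
        using elim by (intro powr_mono') (auto simp: power_le_one)
      also have "((1 / 2 :: real) ^ k) powr 1 = (1 / 2) ^ k" by simp
      finally show ?case by (simp add: mult_right_mono)
    qed
  qed simp
  obtain r where r: "0 \<le> r" "S c = ennreal r" using S_fin by (cases "S c") auto
  have "0 < 1 / (r + 1)" using r by simp
  then obtain N where "(1 / 2 :: real) ^ N < 1 / (r + 1)" using real_arch_pow_inv[of "1 / (r + 1)" "1 / 2"] by auto
  hence "(1 / 2) ^ N * r \<le> 1" using r by (simp add: field_simps) 
  hence "S (2 ^ N * c) \<le> 1"
    using order.trans[OF decay[of N]] r by (simp add: ennreal_le_1 flip: ennreal_mult')
  hence ex: "\<exists>k. S (2 ^ k * c) \<le> 1" by blast
  define k where "k = (LEAST k. S (2 ^ k * c) \<le> 1)"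
  have k: "S (2 ^ k * c) \<le> 1" unfolding k_def by (rule LeastI_ex[OF ex])
  have "k \<noteq> 0"
  proof
    assume "k = 0"
    hence "S c \<le> 1" using k by simp
    thus False using gt unfolding S_def by simp
  qed
  then obtain j where j: "k = Suc j" by (cases k) auto
  have "\<not> S (2 ^ j * c) \<le> 1" using not_less_Least[of j "\<lambda>k. S (2 ^ k * c) \<le> 1"] j by (simp add: k_def)
  hence 1: "1 < S (2 ^ j * c)" by simp
  \<comment> \<open>The last value above 1 exceeds its successor at most by the factor 2^Q.\<close>
  have "S (2 ^ j * c) \<le> ennreal (2 powr Q) * S (2 ^ k * c)"
  proof (rule scale)
    show "AE x in lebesgue. (\<tau> / (2 ^ j * c)) powr q x \<le> 2 powr Q * (\<tau> / (2 ^ k * c)) powr q x"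
      using q
    proof eventually_elim
      case (elim x)
      have "\<tau> / (2 ^ j * c) = 2 * (\<tau> / (2 ^ k * c))" by (simp add: j)
      hence "(\<tau> / (2 ^ j * c)) powr q x = 2 powr q x * (\<tau> / (2 ^ k * c)) powr q x"
        using \<tau> c by (simp only:) (intro powr_mult; simp)
      also have "\<dots> \<le> 2 powr Q * (\<tau> / (2 ^ k * c)) powr q x"
        using elim by (intro mult_right_mono powr_mono) auto
      finally show ?case .
    qed
  qed simp
  also have "\<dots> \<le> ennreal (2 powr Q) * 1" using k by (rule mult_left_mono) simp
  finally have 2: "S (2 ^ j * c) \<le> ennreal (2 powr Q)" by simp
  have "1 * c \<le> 2 ^ j * c" using c by (intro mult_right_mono) auto
  thus ?thesis using 1 2 unfolding S_def by (intro exI[of _ "2 ^ j * c"]) auto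
qed

lemma modular_inequality:
  fixes m :: nat and \<alpha> p0 P1 :: real and a :: "nat \<Rightarrow> real" and A :: "nat \<Rightarrow> real ^ 'n ^ 'n"
    and p q :: "real ^ 'n \<Rightarrow> real" and n e :: real
  defines "n \<equiv> real CARD('n)"
  defines "e \<equiv> 1 / p0 - \<alpha> / n"
  assumes m: "1 \<le> m" and \<alpha>: "0 \<le> \<alpha>" "\<alpha> < n"
    and a: "\<And>i. i \<in> {1..m} \<Longrightarrow> 0 < a i \<and> a i < n" and sum_a: "(\<Sum>i=1..m. a i) = n - \<alpha>"
    and A: "\<And>i. i \<in> {1..m} \<Longrightarrow> invertible (A i)"
    and AA: "\<And>i j. i \<in> {1..m} \<Longrightarrow> j \<in> {1..m} \<Longrightarrow> i \<noteq> j \<Longrightarrow> invertible (A i - A j)"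
    and p_meas [measurable]: "p \<in> borel_measurable lebesgue"
    and p0: "1 \<le> p0" "p0 \<le> P1" and P1: "0 < 1 / P1 - \<alpha> / n"
    and p: "AE x in lebesgue. p0 \<le> p x" "AE x in lebesgue. p x \<le> P1"
    and pA: "\<And>i. i \<in> {1..m} \<Longrightarrow> AE x in lebesgue. p (A i *v x) = p x"
    and pq: "AE x in lebesgue. 1 / p x - 1 / q x = \<alpha> / n"
    and HL: "HL_maximal_bounded_on (conj_exponent (\<lambda>x. e * q x))"
  shows "\<exists>c>0. \<forall>f \<tau>. f \<in> borel_measurable borel \<longrightarrow> (\<forall>x. 0 \<le> f x) \<longrightarrow> (\<integral>\<^sup>+x. ennreal (f x powr p x) \<partial>lebesgue) \<le> 1 \<longrightarrow> 0 < \<tau> \<longrightarrow>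
    (\<integral>\<^sup>+x. ennreal ((\<tau> / c) powr q x) * indicator {x. ennreal \<tau> < (\<integral>\<^sup>+y. ennreal (T_kernel m a A x y * f y) \<partial>lborel)} x \<partial>lebesgue) \<le> 1"
proof -
  define Q where "Q = 1 / (1 / P1 - \<alpha> / n)"
  have "1 / P1 \<le> 1 / p0" using p0 by (intro divide_left_mono) auto
  hence e: "0 < e" using P1 by (simp add: e_def)
  have n: "0 < n" by (simp add: n_def)
  \<comment> \<open>The relation with p determines q off a null set, and thus its
    measurability.\<close>
  have "AE x in lebesgue. 1 / (1 / p x - \<alpha> / n) = q x"
    using pq
  proof eventually_elim
    case (elim x)
    hence "1 / p x - \<alpha> / n = 1 / q x" by simp
    thus ?case by simp
  qed
  hence q_meas [measurable]: "q \<in> borel_measurable lebesgue"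
    by (rule borel_measurable_lebesgue_AE_eq[rotated]) measurable
  have q: "AE x in lebesgue. p0 \<le> p x \<and> 1 / q x = e - (1 / p0 - 1 / p x) \<and> 0 < q x \<and> 1 \<le> q x \<and> q x \<le> Q"
    using p pq
  proof eventually_elim
    case (elim x)
    have 1: "1 / q x = 1 / p x - \<alpha> / n" using elim(3) by simp
    have "1 / P1 \<le> 1 / p x" using elim p0 by (intro divide_left_mono) auto
    hence ge: "1 / P1 - \<alpha> / n \<le> 1 / q x" using 1 by simp
    hence pos: "0 < q x" using P1 zero_less_divide_1_iff[of "q x"] by linarith
    have "1 / (1 / q x) \<le> Q" unfolding Q_def using ge P1 pos by (intro divide_left_mono) auto
    hence "q x \<le> Q" by simp
    moreover have "1 / q x \<le> 1 / p x" using 1 \<alpha> n by simp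
    hence "p x \<le> q x" using pos elim p0 by (simp add: field_simps)
    ultimately show ?case using 1 pos elim p0 by (auto simp: e_def)
  qed
  define s where "s = conj_exponent (\<lambda>x. e * q x)"
  have s_meas: "s \<in> borel_measurable lebesgue" unfolding s_def conj_exponent_def by measurable
  have s: "AE x in lebesgue. s x = (if p x = p0 then \<infinity> else ereal (e * p0 * p x / (p x - p0)))"
    using q
  proof eventually_elim
    case (elim x)
    have cj: "1 \<le> p0" "p0 \<le> p x" "0 < e" "1 / q x = e - (1 / p0 - 1 / p x)" "0 < q x" using elim p0 e by auto
    show ?case
    proof (cases "p x = p0")
      case True
      thus ?thesis using conj_exponent_eq(1)[OF cj] by (simp add: s_def conj_exponent_def)
    next
      case False
      from conj_exponent_eq(2,3)[OF cj False] show ?thesis using False by (simp add: s_def conj_exponent_def)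
    qed
  qed
  interpret variable_exponent s
  proof
    show "AE x in lebesgue. 1 \<le> s x"
      using q
    proof eventually_elim
      case (elim x)
      have cj: "1 \<le> p0" "p0 \<le> p x" "0 < e" "1 / q x = e - (1 / p0 - 1 / p x)" "0 < q x" using elim p0 e by auto
      show ?case
      proof (cases "p x = p0")
        case True
        thus ?thesis using conj_exponent_eq(1)[OF cj] by (simp add: s_def conj_exponent_def)
      next
        case False
        hence "1 < e * q x" by (rule conj_exponent_eq(2)[OF cj])
        thus ?thesis by (simp add: s_def conj_exponent_def)
      qed
    qed
  qed (rule s_meas)
  \<comment> \<open>The modular of h has an integral part at most 2^Q, from the dyadic choice, and
    an essential supremum part at most 1.\<close>
  define b where "b = 2 powr Q + 1"
  have b: "1 \<le> b" by (simp add: b_def)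
  from Rubio_de_Francia[OF HL[folded s_def]] obtain K where K: "1 \<le> K"
    and RdF: "\<forall>h b. h \<in> borel_measurable borel \<longrightarrow> (\<forall>x. 0 \<le> h x) \<longrightarrow> (\<integral>\<^sup>+x. ennreal (h x) \<partial>lborel) \<noteq> 0 \<longrightarrow>
      1 \<le> b \<longrightarrow> vexp_modular s (\<lambda>x. ennreal (h x)) \<le> ennreal b \<longrightarrow>
      (\<exists>w. A1_weight w K \<and> (AE x in lborel. h x \<le> w x) \<and>
        (\<integral>\<^sup>+x. (if s x = \<infinity> then 0 else ennreal ((w x / (2 * b)) powr real_of_ereal (s x))) \<partial>lebesgue) \<le> 2 \<and>
        (AE x in lebesgue. s x = \<infinity> \<longrightarrow> w x \<le> 2 * b))"
    by (elim exE conjE)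
  have "\<exists>c. \<forall>i\<in>{1..m}. 0 < c i \<and> (\<forall>g\<in>borel_measurable borel. (\<integral>\<^sup>+y. g (A i *v y) \<partial>lborel) \<le> ennreal (c i) * (\<integral>\<^sup>+z. g z \<partial>lborel))"
    using nn_integral_matrix_image_le[OF A] by (intro bchoice ballI) simp
  then obtain c where c: "\<And>i. i \<in> {1..m} \<Longrightarrow> 0 < c i"
    "\<And>i g. i \<in> {1..m} \<Longrightarrow> g \<in> borel_measurable borel \<Longrightarrow> (\<integral>\<^sup>+y. g (A i *v y) \<partial>lborel) \<le> ennreal (c i) * (\<integral>\<^sup>+z. g z \<partial>lborel)"
    by blast
  \<comment> \<open>The bound of \<open>weight_condition\<close> with B = 2 b, uniform in i because
    the sum dominates each \<open>c i\<close>.\<close>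
  define X where "X = (2 * b) powr (p0 * e) * (1 + 2 * (\<Sum>i=1..m. c i))"
  have "0 \<le> (\<Sum>i=1..m. c i)" using c(1) by (intro sum_nonneg) (auto intro: less_imp_le)
  hence X: "0 < X" using b by (simp add: X_def)
  note data = m \<alpha>(1) \<alpha>(2) a sum_a A AA p0(1) e X K
  have "\<exists>C\<ge>0. \<forall>w f. A1_weight w K \<longrightarrow> f \<in> borel_measurable borel \<longrightarrow> (\<forall>y. 0 \<le> f y) \<longrightarrow>
    (\<forall>i\<in>{1..m}. (\<integral>\<^sup>+y. ennreal (f y powr p0 * w (A i *v y) powr (p0 * e)) \<partial>lborel) \<le> ennreal X) \<longrightarrow>
    (\<exists>G\<in>sets borel. {x. 1 < (\<integral>\<^sup>+y. ennreal (T_kernel m a A x y * f y) \<partial>lborel)} \<subseteq> G \<and>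
       emeasure (density lborel w) G \<le> ennreal C)"
    unfolding e_def n_def by (rule weighted_weak_type) (fact data[unfolded e_def n_def])+
  then obtain C where C: "0 \<le> C" and weak: "\<forall>w f. A1_weight w K \<longrightarrow> f \<in> borel_measurable borel \<longrightarrow> (\<forall>y. 0 \<le> f y) \<longrightarrow>
    (\<forall>i\<in>{1..m}. (\<integral>\<^sup>+y. ennreal (f y powr p0 * w (A i *v y) powr (p0 * e)) \<partial>lborel) \<le> ennreal X) \<longrightarrow>
    (\<exists>G\<in>sets borel. {x. 1 < (\<integral>\<^sup>+y. ennreal (T_kernel m a A x y * f y) \<partial>lborel)} \<subseteq> G \<and>
       emeasure (density lborel w) G \<le> ennreal C)"
    by (elim exE conjE)
  \<comment> \<open>Chosen so that C times cc^(-1/e) is C / (C + 1), which contradicts an integral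
    above 1.\<close>
  define cc where "cc = (C + 1) powr e"
  have cc: "0 < cc" using C by (simp add: cc_def)
  show ?thesis
  proof (intro exI[of _ cc] conjI cc allI impI)
    fix f :: "real ^ 'n \<Rightarrow> real" and \<tau> :: real
    assume f [measurable]: "f \<in> borel_measurable borel" and f_nonneg: "\<forall>x. 0 \<le> f x"
      and f_int: "(\<integral>\<^sup>+x. ennreal (f x powr p x) \<partial>lebesgue) \<le> 1" and \<tau>: "0 < \<tau>"
    define E where "E = {x. ennreal \<tau> < (\<integral>\<^sup>+y. ennreal (T_kernel m a A x y * f y) \<partial>lborel)}"
    have "(\<lambda>x. \<integral>\<^sup>+y. ennreal (T_kernel m a A x y * f y) \<partial>lborel) \<in> borel_measurable lborel"
      using T_kernel_measurable[of m a A, measurable] by measurable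
    hence E_borel [measurable]: "E \<in> sets borel" unfolding E_def by measurable
    have bounded_part: "(\<integral>\<^sup>+x. ennreal ((\<tau> / cc) powr q x) * indicator (E \<inter> ball 0 (real k)) x \<partial>lebesgue) \<le> 1" for k :: nat
    proof (rule ccontr)
      assume "\<not> ?thesis"
      define F where "F = E \<inter> ball 0 (real k)"
      have F_borel [measurable]: "F \<in> sets borel" unfolding F_def by auto
      have F_leb [measurable]: "F \<in> sets lebesgue" using F_borel by (simp add: sets_completionI_sets)
      have "emeasure lborel F \<le> emeasure lborel (ball 0 (real k) :: (real ^ 'n) set)"
        unfolding F_def by (intro emeasure_mono) auto
      hence F_fin: "emeasure lebesgue F < \<infinity>"
        using F_borel by (simp add: emeasure_ball le_less_trans)
      have "1 < (\<integral>\<^sup>+x. ennreal ((\<tau> / cc) powr q x) * indicator F x \<partial>lebesgue)"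
        using \<open>\<not> _ \<le> 1\<close> by (simp add: F_def)
      then obtain \<nu> where \<nu>: "cc \<le> \<nu>" and S1: "1 < (\<integral>\<^sup>+x. ennreal ((\<tau> / \<nu>) powr q x) * indicator F x \<partial>lebesgue)"
        and S2: "(\<integral>\<^sup>+x. ennreal ((\<tau> / \<nu>) powr q x) * indicator F x \<partial>lebesgue) \<le> ennreal (2 powr Q)"
        using dyadic_normalisation[OF q_meas F_leb F_fin _ \<tau> cc, of Q] q by (auto elim: eventually_mono)
      have \<nu>0: "0 < \<nu>" using \<nu> cc by simp
      \<comment> \<open>Here 1 / e is q_0. This exponent makes (\<tau> / \<nu>)^(q_0) h0 equal to
        the integrand, and the power of h0 with the conjugate exponent equal to it as well.\<close>
      define h0 where "h0 x = (\<tau> / \<nu>) powr (q x - 1 / e) * indicator F x" for x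
      have h0_meas: "h0 \<in> borel_measurable lebesgue" unfolding h0_def[abs_def] by measurable
      \<comment> \<open>The iteration starts from a Borel function; \<open>max 0\<close> below
        restores nonnegativity at every point.\<close>
      obtain h1 where h1 [measurable]: "h1 \<in> borel_measurable lborel" "AE x in lborel. h0 x = h1 x"
        using completion_ex_borel_measurable_real[OF h0_meas] by blast
      define h where "h x = max 0 (h1 x)" for x
      have h_meas [measurable]: "h \<in> borel_measurable borel" using h1(1) unfolding h_def[abs_def] by simp
      have h_nonneg: "0 \<le> h x" for x by (simp add: h_def)
      have h: "AE x in lborel. h x = (\<tau> / \<nu>) powr (q x - 1 / e) * indicator F x"
        using h1(2)
      proof eventually_elim
        case (elim x)
        have "0 \<le> h0 x" by (simp add: h0_def)
        hence "h x = h0 x" using elim by (simp add: h_def)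
        thus ?case by (simp only: h0_def)
      qed
      have S_h: "(\<integral>\<^sup>+x. ennreal ((\<tau> / \<nu>) powr q x) * indicator F x \<partial>lebesgue) = ennreal ((\<tau> / \<nu>) powr (1 / e)) * (\<integral>\<^sup>+x. ennreal (h x) \<partial>lborel)"
      proof -
        have "(\<integral>\<^sup>+x. ennreal ((\<tau> / \<nu>) powr q x) * indicator F x \<partial>lborel) = (\<integral>\<^sup>+x. ennreal ((\<tau> / \<nu>) powr (1 / e)) * ennreal (h x) \<partial>lborel)"
        proof (rule nn_integral_cong_AE, use h in eventually_elim)
          case (elim x)
          have "(\<tau> / \<nu>) powr q x = (\<tau> / \<nu>) powr (1 / e) * (\<tau> / \<nu>) powr (q x - 1 / e)" by (simp flip: powr_add)
          thus ?case unfolding elim by (auto simp: indicator_def ennreal_mult)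
        qed
        also have "\<dots> = ennreal ((\<tau> / \<nu>) powr (1 / e)) * (\<integral>\<^sup>+x. ennreal (h x) \<partial>lborel)"
          by (rule nn_integral_cmult) measurable
        finally show ?thesis by (simp only: nn_integral_completion)
      qed
      have h_nz: "(\<integral>\<^sup>+x. ennreal (h x) \<partial>lborel) \<noteq> 0"
      proof
        assume "(\<integral>\<^sup>+x. ennreal (h x) \<partial>lborel) = 0"
        with S_h S1 show False by simp
      qed
      have h_leb: "(\<lambda>x. ennreal (h x)) \<in> borel_measurable lebesgue"
        by (rule measurable_completion) measurable
      have "vexp_modular s (\<lambda>x. ennreal (h x)) \<le> ennreal (2 powr Q) + 1"
        unfolding vexp_modular_def
      proof (rule add_mono)
        have "(\<integral>\<^sup>+x. (if s x = \<infinity> then 0 else ennreal_rpow (ennreal (h x)) (real_of_ereal (s x))) \<partial>lebesgue)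
          \<le> (\<integral>\<^sup>+x. ennreal ((\<tau> / \<nu>) powr q x) * indicator F x \<partial>lebesgue)"
        proof (rule nn_integral_mono_AE, use AE_completion[OF h] q in eventually_elim)
          case (elim x)
          have cj: "1 \<le> p0" "p0 \<le> p x" "0 < e" "1 / q x = e - (1 / p0 - 1 / p x)" "0 < q x" using elim p0 e by auto
          show ?case
          proof (cases "p x = p0 \<or> x \<notin> F")
            case True
            thus ?thesis using elim conj_exponent_eq(1)[OF cj] by (auto simp: s_def conj_exponent_def)
          next
            case False
            have "((\<tau> / \<nu>) powr (q x - 1 / e)) powr (e * q x / (e * q x - 1)) = (\<tau> / \<nu>) powr q x"
              unfolding powr_powr using conj_exponent_eq(4)[OF cj] False by simp
            moreover have "e * q x \<noteq> 1" using conj_exponent_eq(2)[OF cj] False by simp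
            ultimately show ?thesis using False elim by (simp add: s_def conj_exponent_def)
          qed
        qed
        also note S2
        finally show "(\<integral>\<^sup>+x. (if s x = \<infinity> then 0 else ennreal_rpow (ennreal (h x)) (real_of_ereal (s x))) \<partial>lebesgue)
          \<le> ennreal (2 powr Q)" .
        \<comment> \<open>Where s is infinite, q = q_0 and h is just the indicator of
          \<open>F\<close>.\<close>
        have "AE x in lebesgue. (if s x = \<infinity> then ennreal (h x) else 0) \<le> 1"
          using AE_completion[OF h] q
        proof eventually_elim
          case (elim x)
          have cj: "1 \<le> p0" "p0 \<le> p x" "0 < e" "1 / q x = e - (1 / p0 - 1 / p x)" "0 < q x" using elim p0 e by auto
          show ?case
          proof (cases "p x = p0")
            case True
            hence "e * q x = 1" by (rule conj_exponent_eq(1)[OF cj])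
            hence "q x - 1 / e = 0" using e by (simp add: field_simps)
            thus ?thesis using elim \<tau> \<nu>0 by (simp add: indicator_def)
          next
            case False
            hence "e * q x \<noteq> 1" using conj_exponent_eq(2)[OF cj] by simp
            thus ?thesis by (simp add: s_def conj_exponent_def)
          qed
        qed
        thus "esssup lebesgue (\<lambda>x. if s x = \<infinity> then ennreal (h x) else 0) \<le> 1"
          using indicator_top_measurable[OF h_leb] by (intro esssup_I)
      qed
      also have "\<dots> = ennreal b" by (simp add: b_def)
      finally have h_mod: "vexp_modular s (\<lambda>x. ennreal (h x)) \<le> ennreal b" .
      obtain w where w: "A1_weight w K" "AE x in lborel. h x \<le> w x"
        "(\<integral>\<^sup>+x. (if s x = \<infinity> then 0 else ennreal ((w x / (2 * b)) powr real_of_ereal (s x))) \<partial>lebesgue) \<le> 2"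
        "AE x in lebesgue. s x = \<infinity> \<longrightarrow> w x \<le> 2 * b"
        using RdF[rule_format, OF h_meas h_nonneg h_nz b h_mod] by (elim exE conjE)
      have w_borel [measurable]: "w \<in> borel_measurable borel" and w_nonneg: "0 \<le> w x" for x
        using w(1) by (auto simp: A1_weight_def)
      \<comment> \<open>Replacing f by f / \<tau> and w by d w moves level \<tau> to level 1 and
        leaves the weighted integrals of f unchanged.\<close>
      define d where "d = \<tau> powr (1 / e)"
      have d: "0 < d" using \<tau> by (simp add: d_def)
      have Xi: "(\<integral>\<^sup>+y. ennreal ((f y / \<tau>) powr p0 * (d * w (A i *v y)) powr (p0 * e)) \<partial>lborel) \<le> ennreal X" if i: "i \<in> {1..m}" for i
      proof -
        have "(f y / \<tau>) powr p0 * (d * w (A i *v y)) powr (p0 * e) = f y powr p0 * w (A i *v y) powr (p0 * e)" for y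
        proof -
          have "d powr (p0 * e) = \<tau> powr p0" using e by (simp add: d_def powr_powr)
          thus ?thesis using f_nonneg w_nonneg \<tau> d by (simp add: powr_mult powr_divide)
        qed
        hence "(\<integral>\<^sup>+y. ennreal ((f y / \<tau>) powr p0 * (d * w (A i *v y)) powr (p0 * e)) \<partial>lborel)
          = (\<integral>\<^sup>+y. ennreal (f y powr p0 * w (A i *v y) powr (p0 * e)) \<partial>lborel)" by simp
        also have "\<dots> \<le> ennreal ((2 * b) powr (p0 * e) * (1 + 2 * c i))"
        proof (rule weight_condition[OF p_meas s_meas f w_borel _ w_nonneg A[OF i] pA[OF i] p0(1) p(1) e _ c(1)[OF i] s c(2)[OF i] f_int w(3) w(4)])
        qed (use f_nonneg b in auto)
        also have "\<dots> \<le> ennreal X"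
        proof -
          have "c i \<le> (\<Sum>i=1..m. c i)" using i c(1) by (intro member_le_sum) (auto intro: less_imp_le)
          thus ?thesis unfolding X_def by (intro ennreal_leI mult_left_mono) auto
        qed
        finally show ?thesis .
      qed
      obtain G where G: "G \<in> sets borel" "{x. 1 < (\<integral>\<^sup>+y. ennreal (T_kernel m a A x y * (f y / \<tau>)) \<partial>lborel)} \<subseteq> G"
        "emeasure (density lborel (\<lambda>x. d * w x)) G \<le> ennreal C"
      proof -
        have "(\<lambda>y. f y / \<tau>) \<in> borel_measurable borel" by measurable
        from weak[rule_format, OF A1_weight_scale(1)[OF w(1) d] this _ Xi] that show thesis
          using f_nonneg \<tau> by auto
      qed
      have "E \<subseteq> G"
      proof
        fix x assume "x \<in> E"
        have "T_kernel m a A x y * f y = \<tau> * (T_kernel m a A x y * (f y / \<tau>))" for y using \<tau> by simp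
        hence "(\<integral>\<^sup>+y. ennreal (T_kernel m a A x y * f y) \<partial>lborel) = (\<integral>\<^sup>+y. ennreal \<tau> * ennreal (T_kernel m a A x y * (f y / \<tau>)) \<partial>lborel)"
          using \<tau> by (simp add: ennreal_mult'[symmetric])
        also have "\<dots> = ennreal \<tau> * (\<integral>\<^sup>+y. ennreal (T_kernel m a A x y * (f y / \<tau>)) \<partial>lborel)"
        proof (rule nn_integral_cmult)
          have "T_kernel m a A x \<in> borel_measurable lborel"
            using measurable_compose[OF measurable_Pair1'[of x lborel lborel] T_kernel_measurable[of m a A]] by simp
          thus "(\<lambda>y. ennreal (T_kernel m a A x y * (f y / \<tau>))) \<in> borel_measurable lborel" by measurable
        qed
        finally have "ennreal \<tau> * 1 < ennreal \<tau> * (\<integral>\<^sup>+y. ennreal (T_kernel m a A x y * (f y / \<tau>)) \<partial>lborel)"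
          using \<open>x \<in> E\<close> by (simp add: E_def)
        hence "1 < (\<integral>\<^sup>+y. ennreal (T_kernel m a A x y * (f y / \<tau>)) \<partial>lborel)"
          by (metis mult_left_mono not_less zero_le)
        thus "x \<in> G" using G(2) by blast
      qed
      have "(\<integral>\<^sup>+x. ennreal (h x) \<partial>lborel) \<le> (\<integral>\<^sup>+x. ennreal (w x) * indicator G x \<partial>lborel)"
      proof (rule nn_integral_mono_AE, use h w(2) in eventually_elim)
        case (elim x)
        show ?case
        proof (cases "x \<in> F")
          case True
          hence "x \<in> G" using \<open>E \<subseteq> G\<close> by (auto simp: F_def)
          thus ?thesis using elim(2) by (simp add: ennreal_leI)
        next
          case False
          hence "h x = 0" using elim(1) by simp
          thus ?thesis by simp
        qed
      qed
      also have "\<dots> = emeasure (density lborel w) G" using G(1) by (subst emeasure_density) auto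
      finally have "ennreal d * (\<integral>\<^sup>+x. ennreal (h x) \<partial>lborel) \<le> ennreal d * emeasure (density lborel w) G"
        by (rule mult_left_mono) simp
      also have "\<dots> \<le> ennreal C" using G(3) A1_weight_scale(2)[OF w(1) d G(1)] by simp
      finally have dh: "ennreal d * (\<integral>\<^sup>+x. ennreal (h x) \<partial>lborel) \<le> ennreal C" .
      \<comment> \<open>The weak type bound controls d times the integral of h by C; the remaining
        power of \<nu> is at most that of \<open>cc\<close>, since \<nu> \<ge> cc.\<close>
      have "(\<tau> / \<nu>) powr (1 / e) = \<nu> powr (- (1 / e)) * d"
        using \<tau> \<nu>0 by (simp add: d_def powr_divide powr_minus field_simps)
      hence "ennreal ((\<tau> / \<nu>) powr (1 / e)) * (\<integral>\<^sup>+x. ennreal (h x) \<partial>lborel)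
          = ennreal (\<nu> powr (- (1 / e))) * (ennreal d * (\<integral>\<^sup>+x. ennreal (h x) \<partial>lborel))"
        by (simp add: ennreal_mult' mult.assoc)
      also have "\<dots> \<le> ennreal (\<nu> powr (- (1 / e))) * ennreal C" using dh by (rule mult_left_mono) simp
      also have "\<dots> \<le> ennreal (cc powr (- (1 / e))) * ennreal C"
        using \<nu> cc e by (intro mult_right_mono ennreal_leI powr_mono2') auto
      also have "cc powr (- (1 / e)) = 1 / (C + 1)"
        using e C by (simp add: cc_def powr_powr powr_minus_divide)
      also have "ennreal (1 / (C + 1)) * ennreal C = ennreal (C / (C + 1))"
        using C by (subst ennreal_mult'[symmetric]) auto
      also have "\<dots> \<le> 1" using C by (simp add: ennreal_le_1)
      finally show False using S1 unfolding S_h by simp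
    qed
    \<comment> \<open>Written as a measure, the modular of the full superlevel set is the limit of
      its values on balls.\<close>
    define M where "M = density lebesgue (\<lambda>x. ennreal ((\<tau> / cc) powr q x))"
    have E_leb: "E \<in> sets lebesgue" using E_borel by (simp add: sets_completionI_sets)
    have M: "emeasure M S = (\<integral>\<^sup>+x. ennreal ((\<tau> / cc) powr q x) * indicator S x \<partial>lebesgue)" if "S \<in> sets lebesgue" for S
      unfolding M_def using that by (intro emeasure_density) measurable
    have EB: "E \<inter> ball 0 (real k) \<in> sets lebesgue" for k using E_leb by (intro sets.Int) auto
    have "emeasure M (\<Union>k. E \<inter> ball 0 (real k)) = (SUP k. emeasure M (E \<inter> ball 0 (real k)))"
      using EB by (intro SUP_emeasure_incseq[symmetric]) (auto simp: incseq_def M_def)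
    also have "\<dots> \<le> 1" using bounded_part by (intro SUP_least) (simp add: M[OF EB])
    also have "(\<Union>k. E \<inter> ball 0 (real k)) = E"
    proof -
      have "\<exists>k. norm x < real k" for x :: "real ^ 'n" using reals_Archimedean2 by blast
      thus ?thesis by auto
    qed
    finally have "(\<integral>\<^sup>+x. ennreal ((\<tau> / cc) powr q x) * indicator E x \<partial>lebesgue) \<le> 1"
      unfolding M[OF E_leb] .
    thus "(\<integral>\<^sup>+x. ennreal ((\<tau> / cc) powr q x) * indicator {x. ennreal \<tau> < (\<integral>\<^sup>+y. ennreal (T_kernel m a A x y * f y) \<partial>lborel)} x \<partial>lebesgue) \<le> 1"
      unfolding E_def .
  qed
qed

section \<open>From modulars to norms\<close>

theorem theorem7:
  fixes m :: nat and \<alpha> :: real and a :: "nat \<Rightarrow> real"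
    and A :: "nat \<Rightarrow> real ^ 'n ^ 'n"
    and p q :: "real ^ 'n \<Rightarrow> real" and n :: real
  defines "n \<equiv> real CARD('n)"
  assumes "1 \<le> m"
    and "0 \<le> \<alpha>" and "\<alpha> < n"
    and "\<And>i. i \<in> {1..m} \<Longrightarrow> 0 < a i \<and> a i < n"
    and "(\<Sum>i=1..m. a i) = n - \<alpha>"
    and "\<And>i. i \<in> {1..m} \<Longrightarrow> invertible (A i)"
    and "\<And>i j. i \<in> {1..m} \<Longrightarrow> j \<in> {1..m} \<Longrightarrow> i \<noteq> j \<Longrightarrow> invertible (A i - A j)"
    and "p \<in> borel_measurable lebesgue"
    and "\<And>x. 1 \<le> p x"
    and "1 \<le> ess_inf p" and "ess_inf p \<le> ess_sup p"
    and "ess_sup p < (if \<alpha> = 0 then \<infinity> else ereal (n / \<alpha>))"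
    and "\<And>i. i \<in> {1..m} \<Longrightarrow> AE x in lebesgue. p (A i *v x) = p x"
    and "AE x in lebesgue. 1 / p x - 1 / q x = \<alpha> / n"
    and "HL_maximal_bounded_on
           (conj_exponent (\<lambda>x. (n - \<alpha> * real_of_ereal (ess_inf p))
                                / (n * real_of_ereal (ess_inf p)) * q x))"
  shows "\<exists>c::real>0. \<forall>t::real>0. \<forall>f\<in>vexp_space (\<lambda>x. ereal (p x)).
           vexp_norm (\<lambda>x. ereal (q x))
             (\<lambda>x. ennreal (t * indicator {x. T_op m a A f x > ereal t} x))
           \<le> ennreal c * vexp_norm (\<lambda>x. ereal (p x)) (\<lambda>x. ennreal \<bar>f x\<bar>)"
proof -
  note data = assms
  have n: "0 < n" by (simp add: n_def)
  obtain p0 where p0: "ess_inf p = ereal p0" and p0_ge: "1 \<le> p0"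
  proof (cases "ess_inf p")
    case (real r)
    thus ?thesis using that data(11) by simp
  next
    case PInf
    thus ?thesis using data(12,13) by (simp split: if_splits)
  next
    case MInf
    thus ?thesis using data(11) by simp
  qed
  obtain P1 where P1: "ess_sup p = ereal P1"
  proof (cases "ess_sup p")
    case (real r)
    thus ?thesis using that by simp
  next
    case PInf
    thus ?thesis using data(13) by (simp split: if_splits)
  next
    case MInf
    thus ?thesis using data(12) p0 by simp
  qed
  have p0_le: "p0 \<le> P1" using data(12) p0 P1 by simp
  have P1_e: "0 < 1 / P1 - \<alpha> / n"
  proof (cases "\<alpha> = 0")
    case True
    thus ?thesis using p0_le p0_ge by simp
  next
    case False
    hence "P1 < n / \<alpha>" using data(13) P1 by simp
    thus ?thesis using False data(3) n p0_le p0_ge by (simp add: field_simps)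
  qed
  have p_lower: "AE x in lebesgue. p0 \<le> p x" by (rule ess_inf_AE[OF p0])
  have p_upper: "AE x in lebesgue. p x \<le> P1"
    using esssup_AE[of "\<lambda>x. ereal (p x)" lebesgue] P1 by (simp add: ess_sup_def)
  \<comment> \<open>The factor in the hypothesis on the maximal operator is 1 / q_0.\<close>
  have "(n - \<alpha> * p0) / (n * p0) = 1 / p0 - \<alpha> / n"
    using n p0_ge by (simp add: field_simps)
  hence HL: "HL_maximal_bounded_on (conj_exponent (\<lambda>x. (1 / p0 - \<alpha> / n) * q x))"
    using data(16) by (simp add: p0)
  note facts = data(2-4) data(5-10) p0_ge p0_le P1_e p_lower p_upper data(14,15) HL
  have "\<exists>c>0. \<forall>f \<tau>. f \<in> borel_measurable borel \<longrightarrow> (\<forall>x. 0 \<le> f x) \<longrightarrow> (\<integral>\<^sup>+x. ennreal (f x powr p x) \<partial>lebesgue) \<le> 1 \<longrightarrow> 0 < \<tau> \<longrightarrow>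
    (\<integral>\<^sup>+x. ennreal ((\<tau> / c) powr q x) * indicator {x. ennreal \<tau> < (\<integral>\<^sup>+y. ennreal (T_kernel m a A x y * f y) \<partial>lborel)} x \<partial>lebesgue) \<le> 1"
    by (rule modular_inequality[where p = p and \<alpha> = \<alpha> and ?p0.0 = p0 and ?P1.0 = P1]) (fact facts[unfolded n_def])+
  then obtain c where c: "0 < c" and mod: "\<forall>f \<tau>. f \<in> borel_measurable borel \<longrightarrow> (\<forall>x. 0 \<le> f x) \<longrightarrow> (\<integral>\<^sup>+x. ennreal (f x powr p x) \<partial>lebesgue) \<le> 1 \<longrightarrow> 0 < \<tau> \<longrightarrow>
    (\<integral>\<^sup>+x. ennreal ((\<tau> / c) powr q x) * indicator {x. ennreal \<tau> < (\<integral>\<^sup>+y. ennreal (T_kernel m a A x y * f y) \<partial>lborel)} x \<partial>lebesgue) \<le> 1"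
    by (elim exE conjE)
  show ?thesis
  proof (intro exI[of _ c] conjI c allI impI ballI)
    fix t :: real and f assume t: "0 < t" and "f \<in> vexp_space (\<lambda>x. ereal (p x))"
    hence f: "f \<in> borel_measurable lebesgue" by (simp add: vexp_space_def)
    define E where "E = {x. T_op m a A f x > ereal t}"
    obtain F0 where F0: "F0 \<in> borel_measurable lborel" "AE x in lborel. f x = F0 x"
      using completion_ex_borel_measurable_real[OF f] by blast
    define F where "F x = \<bar>F0 x\<bar>" for x
    have F_borel [measurable]: "F \<in> borel_measurable borel" using F0(1) unfolding F_def[abs_def] by simp
    have fF: "AE x in lborel. \<bar>f x\<bar> = F x" using F0(2) by eventually_elim (simp add: F_def)
    \<comment> \<open>Dropping the nonnegative subtrahend is legitimate also where both parts
      diverge, as the difference is then infinity, like the minuend.\<close>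
    have E_sub: "ennreal t < (\<integral>\<^sup>+y. ennreal (T_kernel m a A x y * F y) \<partial>lborel)" if "x \<in> E" for x
    proof -
      define P where "P = (\<integral>\<^sup>+y. ennreal (T_kernel m a A x y * f y) \<partial>lborel)"
      define N where "N = (\<integral>\<^sup>+y. ennreal (- (T_kernel m a A x y * f y)) \<partial>lborel)"
      have "ereal t < enn2ereal P - enn2ereal N"
        using that by (simp add: E_def T_op_def P_def N_def nn_integral_completion)
      also have "\<dots> \<le> enn2ereal P - 0" by (rule ereal_minus_mono) simp_all
      finally have "ennreal t < P"
        using t by (simp add: less_ennreal.rep_eq enn2ereal_ennreal)
      also have "P \<le> (\<integral>\<^sup>+y. ennreal (T_kernel m a A x y * F y) \<partial>lborel)"
        unfolding P_def
      proof (rule nn_integral_mono_AE, use fF in eventually_elim)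
        case (elim y)
        show ?case unfolding elim[symmetric] by (intro ennreal_leI mult_left_mono T_kernel_nonneg) simp
      qed
      finally show ?thesis .
    qed
    have bound: "vexp_norm (\<lambda>x. ereal (q x)) (\<lambda>x. ennreal (t * indicator E x)) \<le> ennreal (c * l)"
      if l: "0 < l" "vexp_modular (\<lambda>x. ereal (p x)) (\<lambda>x. ennreal \<bar>f x\<bar> / ennreal l) \<le> 1" for l
    proof -
      have "(\<integral>\<^sup>+x. ennreal ((F x / l) powr p x) \<partial>lebesgue)
          = (\<integral>\<^sup>+x. ennreal_rpow (ennreal \<bar>f x\<bar> / ennreal l) (p x) \<partial>lebesgue)"
      proof (rule nn_integral_cong_AE, use AE_completion[OF fF] in eventually_elim)
        case (elim x)
        have "0 \<le> F x / l" using l by (simp add: F_def)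
        moreover have "ennreal (F x) / ennreal l = ennreal (F x / l)"
          using l by (intro divide_ennreal) (simp_all add: F_def)
        ultimately show ?case unfolding elim by simp
      qed
      also have "\<dots> \<le> vexp_modular (\<lambda>x. ereal (p x)) (\<lambda>x. ennreal \<bar>f x\<bar> / ennreal l)"
        by (simp add: vexp_modular_def)
      also note l(2)
      finally have int: "(\<integral>\<^sup>+x. ennreal ((F x / l) powr p x) \<partial>lebesgue) \<le> 1" .
      define G where "G = {x. ennreal (t / l) < (\<integral>\<^sup>+y. ennreal (T_kernel m a A x y * (F y / l)) \<partial>lborel)}"
      have "(\<lambda>x. F x / l) \<in> borel_measurable borel" by measurable
      from mod[rule_format, OF this _ int, of "t / l"]
      have G: "(\<integral>\<^sup>+x. ennreal ((t / l / c) powr q x) * indicator G x \<partial>lebesgue) \<le> 1"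
        using l t by (simp add: G_def F_def)
      have EG: "E \<subseteq> G"
      proof
        fix x assume "x \<in> E"
        have "T_kernel m a A x \<in> borel_measurable lborel"
          using measurable_compose[OF measurable_Pair1'[of x lborel lborel] T_kernel_measurable[of m a A]] by simp
        hence meas: "(\<lambda>y. ennreal (T_kernel m a A x y * F y)) \<in> borel_measurable lborel" by measurable
        have "ennreal (1 / l) * ennreal t < ennreal (1 / l) * (\<integral>\<^sup>+y. ennreal (T_kernel m a A x y * F y) \<partial>lborel)"
          using E_sub[OF \<open>x \<in> E\<close>] l by (intro ennreal_mult_strict_left_mono) (auto simp: ennreal_zero_less_mult_iff)
        also have "\<dots> = (\<integral>\<^sup>+y. ennreal (1 / l) * ennreal (T_kernel m a A x y * F y) \<partial>lborel)"
          by (rule nn_integral_cmult[OF meas, symmetric])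
        also have "\<dots> = (\<integral>\<^sup>+y. ennreal (T_kernel m a A x y * (F y / l)) \<partial>lborel)"
          using l by (simp add: ennreal_mult'[symmetric])
        also have "ennreal (1 / l) * ennreal t = ennreal (t / l)"
          using l by (simp add: ennreal_mult'[symmetric])
        finally show "x \<in> G" by (simp add: G_def)
      qed
      have "vexp_modular (\<lambda>x. ereal (q x)) (\<lambda>x. ennreal (t * indicator E x) / ennreal (c * l))
          = (\<integral>\<^sup>+x. ennreal_rpow (ennreal (t * indicator E x) / ennreal (c * l)) (q x) \<partial>lebesgue) + esssup lebesgue (\<lambda>x::real^'n. 0 :: ennreal)"
        by (simp add: vexp_modular_def)
      also have "esssup lebesgue (\<lambda>x::real^'n. 0 :: ennreal) = 0" by (rule esssup_const) simp
      also have "(\<integral>\<^sup>+x. ennreal_rpow (ennreal (t * indicator E x) / ennreal (c * l)) (q x) \<partial>lebesgue) + 0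
          \<le> (\<integral>\<^sup>+x. ennreal ((t / l / c) powr q x) * indicator G x \<partial>lebesgue)"
      proof -
        \<comment> \<open>True at every x, whatever q(x) is: off \<open>E\<close> the base is 0, and
          0 \<open>powr\<close> any exponent is 0.\<close>
        have "ennreal_rpow (ennreal (t * indicator E x) / ennreal (c * l)) (q x) \<le> ennreal ((t / l / c) powr q x) * indicator G x" for x
        proof -
          have "ennreal (t * indicator E x) / ennreal (c * l) = ennreal (t * indicator E x / (c * l))"
            using c l t by (intro divide_ennreal) auto
          hence "ennreal_rpow (ennreal (t * indicator E x) / ennreal (c * l)) (q x) = ennreal ((t * indicator E x / (c * l)) powr q x)"
            using c l t by simp
          thus ?thesis using EG by (auto simp: indicator_def mult.commute)
        qed
        thus ?thesis by (simp add: nn_integral_mono)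
      qed
      also note G
      finally have "vexp_modular (\<lambda>x. ereal (q x)) (\<lambda>x. ennreal (t * indicator E x) / ennreal (c * l)) \<le> 1" .
      thus ?thesis unfolding vexp_norm_def using c l by (intro INF_lower) auto
    qed
    \<comment> \<open>Division by c isolates the infimum on the right, so the bound for each
      admissible l suffices.\<close>
    have "vexp_norm (\<lambda>x. ereal (q x)) (\<lambda>x. ennreal (t * indicator E x)) / ennreal c
        \<le> vexp_norm (\<lambda>x. ereal (p x)) (\<lambda>x. ennreal \<bar>f x\<bar>)"
      unfolding vexp_norm_def[of "\<lambda>x. ereal (p x)"]
    proof (rule INF_greatest)
      fix l assume l: "l \<in> {l. 0 < l \<and> vexp_modular (\<lambda>x. ereal (p x)) (\<lambda>x. ennreal \<bar>f x\<bar> / ennreal l) \<le> 1}"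
      hence "vexp_norm (\<lambda>x. ereal (q x)) (\<lambda>x. ennreal (t * indicator E x)) \<le> ennreal (c * l)" by (intro bound) auto
      hence "vexp_norm (\<lambda>x. ereal (q x)) (\<lambda>x. ennreal (t * indicator E x)) / ennreal c \<le> ennreal (c * l) / ennreal c"
        by (rule divide_right_mono_ennreal)
      also have "\<dots> = ennreal l" using c l by (subst divide_ennreal) auto
      finally show "vexp_norm (\<lambda>x. ereal (q x)) (\<lambda>x. ennreal (t * indicator E x)) / ennreal c \<le> ennreal l" .
    qed
    hence "ennreal c * (vexp_norm (\<lambda>x. ereal (q x)) (\<lambda>x. ennreal (t * indicator E x)) / ennreal c)
        \<le> ennreal c * vexp_norm (\<lambda>x. ereal (p x)) (\<lambda>x. ennreal \<bar>f x\<bar>)"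
      by (rule mult_left_mono) simp
    also have "ennreal c * (vexp_norm (\<lambda>x. ereal (q x)) (\<lambda>x. ennreal (t * indicator E x)) / ennreal c)
        = vexp_norm (\<lambda>x. ereal (q x)) (\<lambda>x. ennreal (t * indicator E x))"
      using c by (subst ennreal_times_divide, subst mult.commute, subst mult_divide_eq_ennreal) auto
    finally show "vexp_norm (\<lambda>x. ereal (q x)) (\<lambda>x. ennreal (t * indicator {x. T_op m a A f x > ereal t} x))
        \<le> ennreal c * vexp_norm (\<lambda>x. ereal (p x)) (\<lambda>x. ennreal \<bar>f x\<bar>)"
      unfolding E_def .
  qed
qed

end
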